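(* Let $Y$ be an almost surely positive random variable with distribution function $F\in\mathcal{D}(G_\gamma)$, $\gamma\in\mathbb{R}$. Let $\bm Y=(Y_1,\ldots,Y_n)$ be i.i.d. copies of $Y$ and let $\hat{\bm Y}=(\hat Y_1,\ldots,\hat Y_n)$ be an approximated sample. Suppose that $k=k_n$ satisfies $k_n\to\infty$ and $k_n/n\to 0$ as $n\to\infty$, and that $$\max_{0\leq j\leq k}\left|\frac{\hat{\bm Y}_{n-j,n}}{\bm Y_{n-j,n}}-1\right|=O_{\mathbb{P}}(h_n)$$ for some sequence $h_n$ such that $z_n=\frac{h_nU(n/k)}{a(n/k)}=o(1)$. Then $$\left|\hat\gamma_M(\hat{\bm Y})-\hat\gamma_M(\bm Y)\right|=O_{\mathbb{P}}(z_n),$$ $$\left|\frac{\hat{\bm Y}_{n-k,n}-\bm Y_{n-k,n}}{a(n/k)}\right|=O_{\mathbb{P}}(z_n),$$ $$\left|\frac{\hat\sigma_M(\hat{\bm Y})-\hat\sigma_M(\bm Y)}{a(n/k)}\right|=O_{\mathbb{P}}(z_n).$$ Furthermore, suppose in addition that $p=p_n\in(0,1)$ satisfies $np=o(k)$ and $\ln(np)=o(\sqrt{k})$, and that $\sqrt{k}\,(\hat\gamma_M(\bm Y)-\gamma)=O_{\mathbb{P}}(1)$ and $\sqrt{k}\,z_n=O(1)$. Let $d_n=k/(np)$ and $q_\gamma(t)=\int_1^t s^{\gamma-1}\ln s\,\mathrm{d}s$. Then $$\left|\frac{\hat x_p(\hat{\bm Y})-\hat x_p(\bm Y)}{a(n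/k)\,q_\gamma(d_n)}\right|=O_{\mathbb{P}}(z_n).$$
   Context: All limits and asymptotic notation are as $n\to\infty$. Throughout, $k=k_n<n$ is a positive integer. The random variables $\hat Y_1,\ldots,\hat Y_n$ (which may depend on $n$) are arbitrary real random variables defined on the same probability space as $\bm Y$. For a vector $\bm y=(y_1,\ldots,y_n)$, $\bm y_{1,n}\le\cdots\le\bm y_{n,n}$ denote its entries sorted in increasing order (order statistics); in particular $\hat{\bm Y}_{n-j,n}$ is the $(n-j)$-th order statistic of $\hat{\bm Y}$. $G_\gamma(x)=\exp(-(1+\gamma x)^{-1/\gamma})$ for $1+\gamma x>0$ if $\gamma\ne 0$, and $G_0(x)=\exp(-e^{-x})$, $x\in\mathbb{R}$. The relation $F\in\mathcal{D}(G_\gamma)$ means that there are sequences $a_n>0$, $b_n\in\mathbb{R}$ such that $(\bm Y_{n,n}-b_n)/a_n$ converges in distribution to $G_\gamma$, for an i.i.d. sample $\bm Y$ from $F$. $U(t)=F^{\leftarrow}(1-1/t)$ for $t>1$, where $g^{\leftarrow}(x)=\inf\{y\in\mathbb{R}: g(y)\ge x\}$. It is known that $F\in\mathcal{D}(G_\gamma)$ if and only if there is a positive scaling function $a(t)$ with $$\lim_{t\to\infty}\frac{U(tx)-U(t)}{a(t)}=\frac{x^\gamma-1}{\gamma}\quad\text{for all }x>0,$$ (for $\gamma=0$ the right-hand side is read as $\ln x$); the function $a$ in the claim is such a scaling function. For a sample $\bm Y$ and $\ell\in\{1,2\}$, $$M_n^{(\ell)}(\bm Y)=\frac1k\sum_{j=0}^{k-1}\left(\ln\bm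 Y_{n-j,n}-\ln\bm Y_{n-k,n}\right)^\ell,$$ $$\hat\gamma_+(\bm Y)=M_n^{(1)}(\bm Y),\qquad \hat\gamma_-(\bm Y)=1-\frac12\left(1-\frac{(M_n^{(1)}(\bm Y))^2}{M_n^{(2)}(\bm Y)}\right)^{-1},$$ $$\hat\gamma_M(\bm Y)=\hat\gamma_+(\bm Y)+\hat\gamma_-(\bm Y),\qquad \hat\sigma_M(\bm Y)=\bm Y_{n-k,n}\,M_n^{(1)}(\bm Y)\,(1-\hat\gamma_-(\bm Y)),$$ $$\hat x_p(\bm Y)=\bm Y_{n-k,n}+\hat\sigma_M(\bm Y)\,\frac{\left(\frac{k}{np}\right)^{\hat\gamma_M(\bm Y)}-1}{\hat\gamma_M(\bm Y)},$$ where the last fraction is read as $\ln(k/(np))$ if $\hat\gamma_M(\bm Y)=0$. The same definitions apply with $\hat{\bm Y}$ in place of $\bm Y$. $X_n=O_{\mathbb{P}}(Y_n)$ means $X_n=Y_nZ_n$ for some uniformly tight sequence of random variables $Z_n$. *)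

theory Defs
  imports "HOL-Probability.Probability" "HOL-Library.Landau_Symbols"
begin

definition sample :: "nat \<Rightarrow> (nat \<Rightarrow> real) \<Rightarrow> real list" where
  "sample n y = map y [1..<Suc n]"

text \<open>The order statistics are numbered from 1, so that \<open>order_stat y 1\<close> is the minimum and
  \<open>order_stat y (length y)\<close> the maximum.\<close>

definition order_stat :: "real list \<Rightarrow> nat \<Rightarrow> real" where
  "order_stat y i = sort y ! (i - 1)"

text \<open>The generalised extreme value distribution function. Outside \<open>1 + \<gamma> x > 0\<close> it takes the
  value that makes it a distribution function on the whole line.\<close>

definition gev_cdf :: "real \<Rightarrow> real \<Rightarrow> real" where
  "gev_cdf \<gamma> x =
    (if \<gamma> = 0 then exp (- exp (- x))
     else if 1 + \<gamma> * x > 0 then exp (- ((1 + \<gamma> * x) powr (- 1 / \<gamma>)))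
     else if \<gamma> > 0 then 0 else 1)"

text \<open>Domain of attraction of the extreme value distribution with index \<open>\<gamma>\<close>. The i.i.d. sample of
  size \<open>n\<close> from the law \<open>\<mu>\<close> is realised by the coordinates of the product measure.\<close>

definition in_max_domain :: "real measure \<Rightarrow> real \<Rightarrow> bool" where
  "in_max_domain \<mu> \<gamma> \<longleftrightarrow>
    (\<exists>a b. (\<forall>n. a n > 0) \<and>
      weak_conv
        (\<lambda>n. cdf (distr (\<Pi>\<^sub>M i\<in>{1..n}. \<mu>) borel
               (\<lambda>y. (order_stat (sample n y) n - b n) / a n)))
        (gev_cdf \<gamma>))"

definition gen_inverse :: "(real \<Rightarrow> real) \<Rightarrow> real \<Rightarrow> real" where
  "gen_inverse g x = Inf {y. g y \<ge> x}"

definition tail_quantile :: "(real \<Rightarrow> real) \<Rightarrow> real \<Rightarrow> real" where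
  "tail_quantile F t = gen_inverse F (1 - 1 / t)"

definition box_cox :: "real \<Rightarrow> real \<Rightarrow> real" where
  "box_cox \<gamma> x = (if \<gamma> = 0 then ln x else (x powr \<gamma> - 1) / \<gamma>)"

definition scaling_function :: "(real \<Rightarrow> real) \<Rightarrow> real \<Rightarrow> (real \<Rightarrow> real) \<Rightarrow> bool" where
  "scaling_function F \<gamma> a \<longleftrightarrow>
    (\<forall>t>1. a t > 0) \<and>
    (\<forall>x>0. ((\<lambda>t. (tail_quantile F (t * x) - tail_quantile F t) / a t)
              \<longlongrightarrow> box_cox \<gamma> x) at_top)"

text \<open>In all of the following estimators, \<open>y\<close> is the sample, \<open>n = length y\<close> its size, and \<open>k\<close> is
  the number of upper order statistics in use; they are meaningful for \<open>0 < k < n\<close>.\<close>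

definition log_moment :: "nat \<Rightarrow> nat \<Rightarrow> real list \<Rightarrow> real" where
  "log_moment l k y =
    (1 / real k) * (\<Sum>j<k. (ln (order_stat y (length y - j)) - ln (order_stat y (length y - k))) ^ l)"

definition gamma_plus :: "nat \<Rightarrow> real list \<Rightarrow> real" where
  "gamma_plus k y = log_moment 1 k y"

definition gamma_minus :: "nat \<Rightarrow> real list \<Rightarrow> real" where
  "gamma_minus k y = 1 - 1 / 2 * inverse (1 - (log_moment 1 k y)\<^sup>2 / log_moment 2 k y)"

definition gamma_moment :: "nat \<Rightarrow> real list \<Rightarrow> real" where
  "gamma_moment k y = gamma_plus k y + gamma_minus k y"

definition sigma_moment :: "nat \<Rightarrow> real list \<Rightarrow> real" where
  "sigma_moment k y =
    order_stat y (length y - k) * log_moment 1 k y * (1 - gamma_minus k y)"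

definition quantile_moment :: "nat \<Rightarrow> real \<Rightarrow> real list \<Rightarrow> real" where
  "quantile_moment k p y =
    order_stat y (length y - k)
    + sigma_moment k y * box_cox (gamma_moment k y) (real k / (real (length y) * p))"

definition q_fun :: "real \<Rightarrow> real \<Rightarrow> real" where
  "q_fun \<gamma> t = (LBINT s=1..t. s powr (\<gamma> - 1) * ln s)"

text \<open>Boundedness in probability \<open>X\<^sub>n = O\<^sub>P(r\<^sub>n)\<close> with a deterministic rate \<open>r\<close>, where the random
  variable \<open>X\<^sub>n\<close> lives on the probability space \<open>M n\<close>. Random variables are identified when almost
  surely equal, and only large \<open>n\<close> matter. Where \<open>r\<^sub>n = 0\<close>, the condition forces \<open>X\<^sub>n = 0\<close>
  almost surely.\<close>

definition big_o_prob ::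
  "(nat \<Rightarrow> 'a measure) \<Rightarrow> (nat \<Rightarrow> 'a \<Rightarrow> real) \<Rightarrow> (nat \<Rightarrow> real) \<Rightarrow> bool" where
  "big_o_prob M X r \<longleftrightarrow>
    (\<exists>Z. (\<forall>n. Z n \<in> borel_measurable (M n)) \<and>
         tight (\<lambda>n. distr (M n) borel (Z n)) \<and>
         (\<forall>\<^sub>F n in sequentially. AE \<omega> in M n. X n \<omega> = r n * Z n \<omega>))"

end

theory Submission
  imports Defs
begin

text \<open>
  Write \<open>t = n / k\<close> and \<open>A = a(t) / U(t)\<close>. The relative error of every one of the \<open>k + 1\<close> largest
  observations is at most a constant times \<open>|h| = |z| A\<close> with high probability, so each log-excess
  \<open>ln Y\<^sub>n\<^sub>-\<^sub>j - ln Y\<^sub>n\<^sub>-\<^sub>k\<close> is perturbed by \<open>O(|z| A)\<close>. This has to be compared with the size of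
  the log-excesses of the true sample, which is \<open>A\<close>: after division by \<open>A\<close> the first two log-moments
  \<open>m\<^sub>1, m\<^sub>2\<close> are perturbed by \<open>O(z)\<close>. The estimators are smooth functions of \<open>m\<^sub>1\<close>, \<open>m\<^sub>2\<close>, \<open>A\<close> and
  \<open>Y\<^sub>n\<^sub>-\<^sub>k / U(t)\<close>, as long as these stay bounded and the empirical variance \<open>m\<^sub>2 - m\<^sub>1\<^sup>2\<close> stays away
  from zero, because \<open>1 - m\<^sub>1\<^sup>2 / m\<^sub>2\<close> occurs as a denominator.

  Hence no limit theorem for the moment estimator is required, only tightness of \<open>m\<^sub>2\<close>, of
  \<open>1 / (m\<^sub>2 - m\<^sub>1\<^sup>2)\<close> and of \<open>Y\<^sub>n\<^sub>-\<^sub>k / U(t)\<close>; this is \<open>regular_tail_whp\<close>. It rests on two facts.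
  By Chebyshev's inequality the number of observations above \<open>U(c t)\<close> is of order \<open>k / c\<close>. With high
  probability this places \<open>Y\<^sub>n\<^sub>-\<^sub>k\<close> between \<open>U(t / 2)\<close> and \<open>U(4 t)\<close>, and it puts a fixed fraction of the
  \<open>k\<close> largest observations below \<open>U(4 t)\<close> and another fixed fraction above \<open>U(8 t)\<close>; as
  \<open>ln U(8 t) - ln U(4 t)\<close> is at least a constant times \<open>A\<close>, the variance is bounded below.
  Secondly, \<open>E ((ln Y - ln U(s))\<^sub>+)\<^sup>2\<close> is at most a constant times \<open>A(s)\<^sup>2 / s\<close>, by a dyadic
  decomposition at the quantiles \<open>U(2\<^sup>i s)\<close>, and Markov's inequality bounds \<open>m\<^sub>2\<close>. The inequality
  needs \<open>A(2\<^sup>i s)\<close> to grow more slowly than \<open>2\<^sup>i\<^sup>/\<^sup>2\<close>, which follows from the scaling relation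
  that defines \<open>a\<close>.

  For the quantile estimator, \<open>(d\<^sup>g - 1) / g\<close> is the integral of \<open>s\<^sup>g\<^sup>-\<^sup>1\<close> over \<open>[1, d]\<close>, and its
  derivative in \<open>g\<close> is \<open>q\<^sub>g(d)\<close>. The two growth conditions on \<open>n p\<close> give \<open>ln d = o(\<surd>k)\<close>, so
  both shape estimates are within \<open>o(1 / ln d)\<close> of \<open>\<gamma>\<close>; there the integrands for different \<open>g\<close>
  differ by a bounded factor only, and every term of the error is \<open>O(z q\<^sub>\<gamma>(d))\<close>.

  All probabilistic statements are carried by the predicate \<open>bounded_whp\<close>: on events of probability
  close to one the argument is deterministic, with constants that depend on the event only.
  If \<open>z\<^sub>n = 0\<close>, the definition of \<open>O\<^sub>P\<close> demands that the errors vanish almost surely. They do, since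
  \<open>h\<^sub>n = 0\<close> forces the top order statistics of the two samples to coincide.
\<close>

section \<open>Boundedness in probability through events of high probability\<close>

text \<open>
  The free constant \<open>C\<close> may depend on the probability \<open>\<epsilon>\<close> that is given away, but not on \<open>n\<close>. The
  event \<open>E\<close> carries the measurability; \<open>Q C n\<close> is an arbitrary statement that holds on it.
\<close>
definition bounded_whp :: "(nat \<Rightarrow> 'a measure) \<Rightarrow> (real \<Rightarrow> nat \<Rightarrow> 'a \<Rightarrow> bool) \<Rightarrow> bool" where
  "bounded_whp M Q \<longleftrightarrow>
    (\<forall>\<epsilon>>0. \<exists>C. \<forall>\<^sub>F n in sequentially.
       \<exists>E\<in>sets (M n). measure (M n) E \<ge> 1 - \<epsilon> \<and> (\<forall>\<omega>\<in>E. Q C n \<omega>))"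

lemma (in prob_space) prob_Int_ge:
  assumes E: "E \<in> events" and G: "G \<in> events"
  shows "prob E + prob G - 1 \<le> prob (E \<inter> G)"
proof -
  have "prob (E \<inter> G) = prob E - prob (E - G)"
    using E G by (simp add: finite_measure_Diff')
  moreover have "prob (E - G) \<le> prob (space M - G)"
    using E G sets.sets_into_space by (intro finite_measure_mono) auto
  moreover have "prob (space M - G) = 1 - prob G"
    using G by (simp add: prob_compl)
  ultimately show ?thesis by linarith
qed

text \<open>
  Monotonicity in the constant lets both statements use the maximum of their constants.
\<close>
lemma bounded_whp_conj:
  assumes "\<And>n. prob_space (M n)" and Q: "bounded_whp M Q" and R: "bounded_whp M R"
    and monoQ: "\<And>C C' n \<omega>. C \<le> C' \<Longrightarrow> Q C n \<omega> \<Longrightarrow> Q C' n \<omega>"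
    and monoR: "\<And>C C' n \<omega>. C \<le> C' \<Longrightarrow> R C n \<omega> \<Longrightarrow> R C' n \<omega>"
  shows "bounded_whp M (\<lambda>C n \<omega>. Q C n \<omega> \<and> R C n \<omega>)"
  unfolding bounded_whp_def
proof (intro allI impI)
  fix \<epsilon> :: real assume "\<epsilon> > 0"
  then have e: "\<epsilon> / 2 > 0" by simp
  obtain C where C: "\<forall>\<^sub>F n in sequentially.
      \<exists>E\<in>sets (M n). measure (M n) E \<ge> 1 - \<epsilon>/2 \<and> (\<forall>\<omega>\<in>E. Q C n \<omega>)"
    using Q e unfolding bounded_whp_def by blast
  obtain D where D: "\<forall>\<^sub>F n in sequentially.
      \<exists>E\<in>sets (M n). measure (M n) E \<ge> 1 - \<epsilon>/2 \<and> (\<forall>\<omega>\<in>E. R D n \<omega>)"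
    using R e unfolding bounded_whp_def by blast
  show "\<exists>C. \<forall>\<^sub>F n in sequentially. \<exists>E\<in>sets (M n). measure (M n) E \<ge> 1 - \<epsilon>
          \<and> (\<forall>\<omega>\<in>E. Q C n \<omega> \<and> R C n \<omega>)"
  proof (rule exI[of _ "max C D"], use C D in eventually_elim)
    case (elim n)
    interpret prob_space "M n" by fact
    from elim obtain E G where
      E: "E \<in> events" "prob E \<ge> 1 - \<epsilon>/2" "\<forall>\<omega>\<in>E. Q C n \<omega>" and
      G: "G \<in> events" "prob G \<ge> 1 - \<epsilon>/2" "\<forall>\<omega>\<in>G. R D n \<omega>" by blast
    have "prob (E \<inter> G) \<ge> 1 - \<epsilon>" using E G prob_Int_ge[of E G] by linarith
    moreover have "\<forall>\<omega>\<in>E \<inter> G. Q (max C D) n \<omega> \<and> R (max C D) n \<omega>"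
      using E(3) G(3) monoQ[of C "max C D"] monoR[of D "max C D"] by auto
    ultimately show ?case using E(1) G(1) by (intro bexI[of _ "E \<inter> G"]) auto
  qed
qed

text \<open>
  The bridge from probability to analysis: a deterministic implication, valid for large \<open>n\<close> and with
  constants depending on \<open>C\<close> only, transports boundedness.
\<close>
lemma bounded_whp_mono:
  assumes "bounded_whp M Q"
    and "\<And>C. \<exists>C'. \<forall>\<^sub>F n in sequentially. \<forall>\<omega>\<in>space (M n). Q C n \<omega> \<longrightarrow> R C' n \<omega>"
  shows "bounded_whp M R"
  unfolding bounded_whp_def
proof (intro allI impI)
  fix \<epsilon> :: real assume "\<epsilon> > 0"
  then obtain C where C: "\<forall>\<^sub>F n in sequentially.
      \<exists>E\<in>sets (M n). measure (M n) E \<ge> 1 - \<epsilon> \<and> (\<forall>\<omega>\<in>E. Q C n \<omega>)"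
    using assms(1) unfolding bounded_whp_def by blast
  obtain C' where C': "\<forall>\<^sub>F n in sequentially. \<forall>\<omega>\<in>space (M n). Q C n \<omega> \<longrightarrow> R C' n \<omega>"
    using assms(2) by blast
  show "\<exists>C. \<forall>\<^sub>F n in sequentially.
      \<exists>E\<in>sets (M n). measure (M n) E \<ge> 1 - \<epsilon> \<and> (\<forall>\<omega>\<in>E. R C n \<omega>)"
  proof (rule exI[of _ C'], use C C' in eventually_elim)
    case (elim n)
    then obtain E where E: "E \<in> sets (M n)" "measure (M n) E \<ge> 1 - \<epsilon>" "\<forall>\<omega>\<in>E. Q C n \<omega>"
      by blast
    with elim sets.sets_into_space[OF E(1)] show ?case by (intro bexI[of _ E]) blast+
  qed
qed

lemma bounded_whp_weaken:
  assumes "bounded_whp M Q" "\<And>C n \<omega>. Q C n \<omega> \<Longrightarrow> R C n \<omega>"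
  shows "bounded_whp M R"
  by (rule bounded_whp_mono[OF assms(1)]) (use assms(2) in \<open>auto intro!: exI always_eventually\<close>)

lemma bounded_whp_tendsto:
  assumes "\<And>n. prob_space (M n)"
    and "\<forall>\<^sub>F n in sequentially. B n \<in> sets (M n) \<and> measure (M n) (B n) \<le> e n"
    and "e \<longlonglongrightarrow> 0"
    and Q: "\<forall>\<^sub>F n in sequentially. \<forall>\<omega>\<in>space (M n). \<omega> \<notin> B n \<longrightarrow> Q n \<omega>"
  shows "bounded_whp M (\<lambda>C n \<omega>. Q n \<omega>)"
  unfolding bounded_whp_def
proof (intro allI impI exI[of _ 0])
  fix \<epsilon> :: real assume "\<epsilon> > 0"
  from order_tendstoD(2)[OF assms(3) this]
  show "\<forall>\<^sub>F n in sequentially. \<exists>E\<in>sets (M n). measure (M n) E \<ge> 1 - \<epsilon> \<and> (\<forall>\<omega>\<in>E. Q n \<omega>)"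
    using assms(2) Q
  proof eventually_elim
    case (elim n)
    interpret prob_space "M n" by fact
    from elim show ?case
      by (intro bexI[of _ "space (M n) - B n"]) (auto simp: prob_compl)
  qed
qed

lemma tight_sequence_bound:
  assumes "tight \<mu>" "\<epsilon> > 0"
  obtains C where "C > 0" "\<And>n. measure (\<mu> n) {-C..C} > 1 - \<epsilon>"
proof -
  from assms obtain a b where ab: "\<And>n. measure (\<mu> n) {a<..b} > 1 - \<epsilon>"
    unfolding tight_def by blast
  define C where "C = max 1 (max \<bar>a\<bar> \<bar>b\<bar>)"
  have "measure (\<mu> n) {-C..C} > 1 - \<epsilon>" for n
  proof -
    interpret real_distribution "\<mu> n" using assms unfolding tight_def by blast
    have "measure (\<mu> n) {a<..b} \<le> measure (\<mu> n) {-C..C}"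
      by (intro finite_measure_mono) (auto simp: C_def)
    with ab[of n] show ?thesis by linarith
  qed
  moreover have "C > 0" by (simp add: C_def)
  ultimately show ?thesis using that by blast
qed

lemma big_o_probD:
  assumes M: "\<And>n. prob_space (M n)" and "big_o_prob M X r"
  shows "bounded_whp M (\<lambda>C n \<omega>. \<bar>X n \<omega>\<bar> \<le> C * \<bar>r n\<bar>)"
  unfolding bounded_whp_def
proof (intro allI impI)
  fix \<epsilon> :: real assume "\<epsilon> > 0"
  from assms(2) obtain Z where Z: "\<And>n. Z n \<in> borel_measurable (M n)"
    "tight (\<lambda>n. distr (M n) borel (Z n))"
    "\<forall>\<^sub>F n in sequentially. AE \<omega> in M n. X n \<omega> = r n * Z n \<omega>"
    unfolding big_o_prob_def by blast
  obtain C where C: "C > 0" "\<And>n. measure (distr (M n) borel (Z n)) {-C..C} > 1 - \<epsilon>"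
    using tight_sequence_bound[OF Z(2) \<open>\<epsilon> > 0\<close>] by blast
  show "\<exists>C. \<forall>\<^sub>F n in sequentially.
      \<exists>E\<in>sets (M n). measure (M n) E \<ge> 1 - \<epsilon> \<and> (\<forall>\<omega>\<in>E. \<bar>X n \<omega>\<bar> \<le> C * \<bar>r n\<bar>)"
  proof (rule exI[of _ C], use Z(3) in eventually_elim)
    case (elim n)
    interpret prob_space "M n" by (rule M)
    note [measurable] = Z(1)
    obtain E where E: "E \<subseteq> {\<omega> \<in> space (M n). X n \<omega> = r n * Z n \<omega>}" "E \<in> events" "prob E = 1"
      by (rule AE_E_prob[OF elim])
    define G where "G = Z n -` {-C..C} \<inter> space (M n)"
    have G: "G \<in> events" "prob G > 1 - \<epsilon>"
      using C(2)[of n] Z(1)[of n] by (auto simp: G_def measure_distr)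
    have "\<bar>X n \<omega>\<bar> \<le> C * \<bar>r n\<bar>" if "\<omega> \<in> E \<inter> G" for \<omega>
    proof -
      have "\<bar>Z n \<omega>\<bar> \<le> C" using that by (auto simp: G_def)
      moreover have "X n \<omega> = r n * Z n \<omega>" using E(1) that by blast
      ultimately show ?thesis by (simp add: abs_mult mult.commute[of C] mult_left_mono)
    qed
    moreover have "prob (E \<inter> G) \<ge> 1 - \<epsilon>"
      using E G prob_Int_ge[of E G] by linarith
    ultimately show ?case using E(2) G(1) by (intro bexI[of _ "E \<inter> G"]) blast+
  qed
qed

text \<open>
  Tightness asks for a bound uniform in all indices. The finitely many exceptional ones are absorbed
  because every single distribution on the line is tight.
\<close>
lemma tight_if_eventually_bounded:
  assumes \<mu>: "\<And>n. real_distribution (\<mu> n)"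
    and ev: "\<And>\<epsilon>::real. \<epsilon> > 0 \<Longrightarrow> \<exists>C. \<forall>\<^sub>F n in sequentially. measure (\<mu> n) {-C..C} > 1 - \<epsilon>"
  shows "tight \<mu>"
  unfolding tight_def
proof (intro conjI allI impI \<mu>)
  fix \<epsilon> :: real assume "\<epsilon> > 0"
  have single: "\<exists>C. measure (\<mu> n) {-C..C} > 1 - \<epsilon>" for n
  proof -
    interpret real_distribution "\<mu> n" by (rule \<mu>)
    have "(\<lambda>i. prob {- real i..real i}) \<longlonglongrightarrow> prob (\<Union>i. {- real i..real i})"
      by (intro finite_Lim_measure_incseq) (auto simp: incseq_def)
    also have "(\<Union>i. {- real i..real i}) = (UNIV :: real set)"
    proof (intro equalityI subsetI)
      fix x :: real
      show "x \<in> (\<Union>i. {- real i..real i})"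
        using real_arch_simple[of "\<bar>x\<bar>"] by (auto simp: abs_le_iff minus_le_iff)
    qed simp
    finally have "(\<lambda>i. prob {- real i..real i}) \<longlonglongrightarrow> 1"
      using prob_space by simp
    from order_tendstoD(1)[OF this, of "1 - \<epsilon>"] \<open>\<epsilon> > 0\<close> show ?thesis
      by (auto simp: eventually_sequentially)
  qed
  obtain C N where C: "\<And>n. n \<ge> N \<Longrightarrow> measure (\<mu> n) {-C..C} > 1 - \<epsilon>"
    using ev[OF \<open>\<epsilon> > 0\<close>] by (auto simp: eventually_sequentially)
  from single obtain c where c: "\<And>n. measure (\<mu> n) {-c n..c n} > 1 - \<epsilon>" by metis
  define D where "D = Max (insert 1 (insert C (c ` {..<N})))"
  have D: "1 \<le> D" "C \<le> D" "\<And>n. n < N \<Longrightarrow> c n \<le> D" 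
    unfolding D_def by (rule Max_ge; force)+
  have "measure (\<mu> n) {- D - 1<..D} > 1 - \<epsilon>" for n
  proof -
    interpret real_distribution "\<mu> n" by (rule \<mu>)
    show ?thesis
    proof (cases "n < N")
      case True
      then have "prob {- c n..c n} \<le> prob {- D - 1<..D}"
        using D(3)[of n] by (intro finite_measure_mono) auto
      with c[of n] show ?thesis by linarith
    next
      case False
      then have "prob {- C..C} \<le> prob {- D - 1<..D}"
        using D(2) by (intro finite_measure_mono) auto
      with C[of n] False show ?thesis by linarith
    qed
  qed
  with D(1) show "\<exists>a b. a < b \<and> (\<forall>n. measure (\<mu> n) {a<..b} > 1 - \<epsilon>)"
    by (intro exI[of _ "-D - 1"] exI[of _ D]) auto
qed

text \<open>
  The witness for \<open>Z\<^sub>n\<close> is the quotient \<open>X\<^sub>n / r\<^sub>n\<close>. It exists where \<open>r\<^sub>n \<noteq> 0\<close>; the other indices are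
  the reason for the separate last assumption, which a bound holding with probability
  \<open>1 - \<epsilon>\<close> for each \<open>\<epsilon>\<close> from some index onwards would not give.
\<close>
lemma big_o_probI:
  assumes M: "\<And>n. prob_space (M n)"
    and X: "\<forall>\<^sub>F n in sequentially. X n \<in> borel_measurable (M n)"
    and bd: "bounded_whp M (\<lambda>C n \<omega>. \<bar>X n \<omega>\<bar> \<le> C * \<bar>r n\<bar>)"
    and zero: "\<forall>\<^sub>F n in sequentially. r n = 0 \<longrightarrow> (AE \<omega> in M n. X n \<omega> = 0)"
  shows "big_o_prob M X r"
proof -
  obtain N where N: "\<And>n. n \<ge> N \<Longrightarrow> X n \<in> borel_measurable (M n)"
    using X by (auto simp: eventually_sequentially)
  define Z where "Z n \<omega> = (if n \<ge> N \<and> r n \<noteq> 0 then X n \<omega> / r n else 0)" for n \<omega>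
  have meas: "Z n \<in> borel_measurable (M n)" for n
    unfolding Z_def using N by (cases "n \<ge> N \<and> r n \<noteq> 0") auto
  have "tight (\<lambda>n. distr (M n) borel (Z n))"
  proof (rule tight_if_eventually_bounded)
    show "real_distribution (distr (M n) borel (Z n))" for n
      using prob_space.real_distribution_distr[OF M meas] .
    fix \<epsilon> :: real assume "\<epsilon> > 0"
    then have e: "\<epsilon> / 2 > 0" by simp
    obtain C where C: "\<forall>\<^sub>F n in sequentially.
        \<exists>E\<in>sets (M n). measure (M n) E \<ge> 1 - \<epsilon>/2 \<and> (\<forall>\<omega>\<in>E. \<bar>X n \<omega>\<bar> \<le> C * \<bar>r n\<bar>)"
      using bd e unfolding bounded_whp_def by blast
    show "\<exists>C. \<forall>\<^sub>F n in sequentially. measure (distr (M n) borel (Z n)) {-C..C} > 1 - \<epsilon>"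
    proof (rule exI[of _ "max C 0"], use C in eventually_elim)
      case (elim n)
      interpret prob_space "M n" by (rule M)
      obtain E where E: "E \<in> events" "prob E \<ge> 1 - \<epsilon>/2" "\<forall>\<omega>\<in>E. \<bar>X n \<omega>\<bar> \<le> C * \<bar>r n\<bar>"
        using elim by blast
      have "\<bar>Z n \<omega>\<bar> \<le> max C 0" if "\<omega> \<in> E" for \<omega>
      proof (cases "n \<ge> N \<and> r n \<noteq> 0")
        case True
        then have "\<bar>Z n \<omega>\<bar> \<le> C"
          using E(3) that by (simp add: Z_def divide_le_eq)
        then show ?thesis by simp
      qed (auto simp: Z_def)
      then have "E \<subseteq> Z n -` {- max C 0..max C 0} \<inter> space (M n)"
        using sets.sets_into_space[OF E(1)] by (force simp: abs_le_iff)
      then have "prob E \<le> prob (Z n -` {- max C 0..max C 0} \<inter> space (M n))"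
        using meas[of n] by (intro finite_measure_mono) auto
      with E(2) \<open>\<epsilon> > 0\<close> meas[of n] show ?case by (simp add: measure_distr)
    qed
  qed
  moreover have "\<forall>\<^sub>F n in sequentially. AE \<omega> in M n. X n \<omega> = r n * Z n \<omega>"
    using zero eventually_ge_at_top[of N] by eventually_elim (auto simp: Z_def)
  ultimately show ?thesis using meas unfolding big_o_prob_def by blast
qed

section \<open>Order statistics of a sample\<close>

lemma length_sample [simp]: "length (sample n y) = n"
  by (simp add: sample_def)

text \<open>
  This turns every statement about an order statistic into one about a count of observations. The
  upward closed property \<open>P\<close> will be \<open>v \<ge> c\<close> or \<open>v > c\<close>; both are needed because the common law may have
  atoms.
\<close>
lemma order_stat_upper_iff:
  assumes P: "\<And>u v. u \<le> v \<Longrightarrow> P u \<Longrightarrow> P v" and "j < n"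
  shows "P (order_stat (sample n y) (n - j)) \<longleftrightarrow> j < card {i\<in>{1..n}. P (y i)}"
proof -
  define xs where "xs = sort (sample n y)"
  have len: "length xs = n" by (simp add: xs_def)
  have "length (filter P xs) = size (filter_mset P (mset xs))"
    by (simp flip: mset_filter)
  also have "\<dots> = length (filter P (sample n y))"
    by (simp add: xs_def flip: mset_filter)
  also have "\<dots> = length (filter (\<lambda>i. P (y i)) [1..<Suc n])"
    by (simp add: sample_def filter_map o_def)
  also have "\<dots> = card (set (filter (\<lambda>i. P (y i)) [1..<Suc n]))"
    by (subst distinct_card) auto
  also have "set (filter (\<lambda>i. P (y i)) [1..<Suc n]) = {i\<in>{1..n}. P (y i)}"
    by auto
  finally have card: "card {i\<in>{1..n}. P (y i)} = card {i. i < n \<and> P (xs ! i)}"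
    by (simp add: length_filter_conv_card len)
  have mono: "xs ! i \<le> xs ! l" if "i \<le> l" "l < n" for i l
    using that by (intro sorted_nth_mono) (auto simp: xs_def)
  have eq: "order_stat (sample n y) (n - j) = xs ! (n - Suc j)"
    by (simp add: order_stat_def xs_def)
  show ?thesis
  proof
    assume "P (order_stat (sample n y) (n - j))"
    then have "P (xs ! (n - Suc j))" by (simp add: eq)
    then have "{n - Suc j..<n} \<subseteq> {i. i < n \<and> P (xs ! i)}"
      using P mono by (auto intro: P[OF mono])
    then have "card {n - Suc j..<n} \<le> card {i. i < n \<and> P (xs ! i)}"
      by (intro card_mono) auto
    with \<open>j < n\<close> show "j < card {i\<in>{1..n}. P (y i)}" unfolding card by simp
  next
    assume j: "j < card {i\<in>{1..n}. P (y i)}"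
    show "P (order_stat (sample n y) (n - j))"
    proof (rule ccontr)
      assume "\<not> P (order_stat (sample n y) (n - j))"
      then have *: "\<not> P (xs ! (n - Suc j))" by (simp add: eq)
      have "{i. i < n \<and> P (xs ! i)} \<subseteq> {n - j..<n}"
      proof
        fix i assume i: "i \<in> {i. i < n \<and> P (xs ! i)}"
        have "\<not> i \<le> n - Suc j"
          using * i P[OF mono[of i "n - Suc j"]] \<open>j < n\<close> by auto
        with i \<open>j < n\<close> show "i \<in> {n - j..<n}" by auto
      qed
      then have "card {i. i < n \<and> P (xs ! i)} \<le> card {n - j..<n}"
        by (intro card_mono) auto
      with j \<open>j < n\<close> show False unfolding card by simp
    qed
  qed
qed

lemma order_stat_sample_mono:
  assumes "i \<le> j" "j < n"
  shows "order_stat (sample n y) (n - j) \<le> order_stat (sample n y) (n - i)"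
  unfolding order_stat_def using assms by (intro sorted_nth_mono) auto

text \<open>
  A sum over the largest observations is dominated by the sum over the whole sample, whose
  expectation is computable without knowing the joint law of the order statistics.
\<close>
lemma sum_order_stat_le:
  fixes g :: "real \<Rightarrow> real"
  assumes "\<And>x. g x \<ge> 0" "k \<le> n"
  shows "(\<Sum>j<k. g (order_stat (sample n y) (n - j))) \<le> (\<Sum>i\<in>{1..n}. g (y i))"
proof -
  define xs where "xs = sort (sample n y)"
  have "(\<Sum>j<k. g (order_stat (sample n y) (n - j))) = (\<Sum>j<k. g (xs ! (n - Suc j)))"
    by (simp add: order_stat_def xs_def)
  also have "\<dots> \<le> (\<Sum>j<n. g (xs ! (n - Suc j)))"
    using assms by (intro sum_mono2) auto
  also have "\<dots> = (\<Sum>j<n. g (xs ! j))"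
    by (rule sum.nat_diff_reindex)
  also have "\<dots> = sum_list (map g xs)"
    by (simp add: sum_list_sum_nth xs_def atLeast0LessThan)
  also have "\<dots> = sum_list (map g (sample n y))"
    by (simp only: xs_def mset_map mset_sort flip: sum_mset_sum_list)
  also have "\<dots> = (\<Sum>i\<in>{1..n}. g (y i))"
    by (simp add: sample_def o_def interv_sum_list_conv_sum_set_nat atLeastLessThanSuc_atLeastAtMost del: upt_Suc)
  finally show ?thesis .
qed

lemma borel_measurable_order_stat [measurable]:
  assumes Y: "\<And>i. i \<in> {1..n} \<Longrightarrow> Y i \<in> borel_measurable M" and "j < n"
  shows "(\<lambda>\<omega>. order_stat (sample n (\<lambda>i. Y i \<omega>)) (n - j)) \<in> borel_measurable M"
  unfolding borel_measurable_iff_ge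
proof
  fix c :: real
  have card: "real (card {i\<in>{1..n}. c \<le> Y i \<omega>}) = (\<Sum>i\<in>{1..n}. indicator {c..} (Y i \<omega>))" for \<omega>
    by (simp add: indicator_def sum.If_cases Int_def)
  have [measurable]: "(\<lambda>\<omega>. \<Sum>i\<in>{1..n}. indicator {c..} (Y i \<omega>) :: real) \<in> borel_measurable M"
    using Y by measurable
  have "{\<omega>\<in>space M. c \<le> order_stat (sample n (\<lambda>i. Y i \<omega>)) (n - j)} =
        {\<omega>\<in>space M. real j < (\<Sum>i\<in>{1..n}. indicator {c..} (Y i \<omega>))}"
    unfolding card[symmetric] of_nat_less_iff
    using order_stat_upper_iff[where P="\<lambda>v. c \<le> v", OF _ \<open>j < n\<close>] by auto
  also have "\<dots> \<in> sets M" by measurable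
  finally show "{\<omega>\<in>space M. c \<le> order_stat (sample n (\<lambda>i. Y i \<omega>)) (n - j)} \<in> sets M" .
qed

lemma box_cox_measurable [measurable]:
  assumes [measurable]: "g \<in> borel_measurable M"
  shows "(\<lambda>\<omega>. box_cox (g \<omega>) c) \<in> borel_measurable M"
  unfolding box_cox_def by measurable

lemma estimators_measurable:
  assumes Y: "\<And>i. i \<in> {1..n} \<Longrightarrow> Y i \<in> borel_measurable M" and "k < n"
  shows "(\<lambda>\<omega>. gamma_moment k (sample n (\<lambda>i. Y i \<omega>))) \<in> borel_measurable M"
    and "(\<lambda>\<omega>. sigma_moment k (sample n (\<lambda>i. Y i \<omega>))) \<in> borel_measurable M"
    and "(\<lambda>\<omega>. quantile_moment k p (sample n (\<lambda>i. Y i \<omega>))) \<in> borel_measurable M"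
proof -
  have [measurable]: "(\<lambda>\<omega>. order_stat (sample n (\<lambda>i. Y i \<omega>)) (n - j)) \<in> borel_measurable M" if "j < n" for j
    using Y that by (rule borel_measurable_order_stat)
  have [measurable]: "(\<lambda>\<omega>. log_moment l k (sample n (\<lambda>i. Y i \<omega>))) \<in> borel_measurable M" for l
    unfolding log_moment_def length_sample using \<open>k < n\<close>
    by (intro borel_measurable_times borel_measurable_const borel_measurable_sum borel_measurable_power
        borel_measurable_diff borel_measurable_ln) auto
  have [measurable]: "(\<lambda>\<omega>. gamma_minus k (sample n (\<lambda>i. Y i \<omega>))) \<in> borel_measurable M"
    unfolding gamma_minus_def by measurable
  show g [measurable]: "(\<lambda>\<omega>. gamma_moment k (sample n (\<lambda>i. Y i \<omega>))) \<in> borel_measurable M"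
    unfolding gamma_moment_def gamma_plus_def by measurable
  have [measurable]: "(\<lambda>\<omega>. order_stat (sample n (\<lambda>i. Y i \<omega>)) (n - k)) \<in> borel_measurable M"
    using Y \<open>k < n\<close> by (rule borel_measurable_order_stat)
  show s [measurable]: "(\<lambda>\<omega>. sigma_moment k (sample n (\<lambda>i. Y i \<omega>))) \<in> borel_measurable M"
    unfolding sigma_moment_def length_sample by measurable
  show "(\<lambda>\<omega>. quantile_moment k p (sample n (\<lambda>i. Y i \<omega>))) \<in> borel_measurable M"
    unfolding quantile_moment_def length_sample by measurable
qed

text \<open>
  The estimators look only at the \<open>k + 1\<close> largest observations.
\<close>
lemma sample_estimators_cong:
  assumes k: "0 < k" "k < n"
    and eq: "\<And>j. j \<le> k \<Longrightarrow> order_stat (sample n y') (n - j) = order_stat (sample n y) (n - j)"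
  shows "gamma_moment k (sample n y') = gamma_moment k (sample n y)"
    and "sigma_moment k (sample n y') = sigma_moment k (sample n y)"
    and "quantile_moment k p (sample n y') = quantile_moment k p (sample n y)"
proof -
  have lm: "log_moment l k (sample n y') = log_moment l k (sample n y)" for l
    unfolding log_moment_def length_sample using eq by (intro arg_cong2[where f="(*)"] refl sum.cong) auto
  show g: "gamma_moment k (sample n y') = gamma_moment k (sample n y)"
    by (simp add: gamma_moment_def gamma_plus_def gamma_minus_def lm)
  show s: "sigma_moment k (sample n y') = sigma_moment k (sample n y)"
    using eq[of k] by (simp add: sigma_moment_def gamma_minus_def lm)
  show "quantile_moment k p (sample n y') = quantile_moment k p (sample n y)"
    using eq[of k] by (simp add: quantile_moment_def g s)
qed

section \<open>Extended regular variation of the tail quantile function\<close>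

text \<open>
  The cocycle identity behind the regular variation of \<open>a\<close>.
\<close>
lemma box_cox_mult:
  assumes "x > 0" "y > 0"
  shows "box_cox \<gamma> (x * y) = box_cox \<gamma> x + x powr \<gamma> * box_cox \<gamma> y"
  using assms by (simp add: box_cox_def ln_mult powr_mult field_simps)

lemma box_cox_1 [simp]: "box_cox \<gamma> 1 = 0"
  by (simp add: box_cox_def)

lemma box_cox_pos: "x > 1 \<Longrightarrow> box_cox \<gamma> x > 0"
proof -
  assume x: "x > 1"
  consider "\<gamma> = 0" | "\<gamma> > 0" | "\<gamma> < 0" by linarith
  then show ?thesis
  proof cases
    case 2
    then have "x powr \<gamma> > 1" using x by simp
    with 2 show ?thesis by (simp add: box_cox_def)
  next
    case 3
    then have "x powr \<gamma> < x powr 0" using x by (intro powr_less_mono) auto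
    with 3 x show ?thesis by (simp add: box_cox_def divide_neg_neg)
  qed (use x in \<open>simp add: box_cox_def\<close>)
qed

lemma at_top_scale: "x > 0 \<Longrightarrow> filterlim (\<lambda>t::real. t * x) at_top at_top"
  by (rule filterlim_at_top_mult_tendsto_pos[OF tendsto_const _ filterlim_ident, THEN filterlim_cong[OF refl refl, THEN iffD1, rotated]])
     (auto simp: mult.commute)

text \<open>
  The analytic properties of a tail quantile function of a positive random variable, together with a
  scaling function for it.
\<close>
locale extended_regular_variation =
  fixes U a :: "real \<Rightarrow> real" and \<gamma> :: real
  assumes U_pos: "t > 1 \<Longrightarrow> U t > 0"
    and U_mono: "1 < s \<Longrightarrow> s \<le> t \<Longrightarrow> U s \<le> U t"
    and a_pos: "t > 1 \<Longrightarrow> a t > 0"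
    and U_lim: "x > 0 \<Longrightarrow> ((\<lambda>t. (U (t * x) - U t) / a t) \<longlongrightarrow> box_cox \<gamma> x) at_top"
begin

text \<open>
  The scale of the log-excesses: the increments of \<open>ln U\<close> near \<open>t\<close> are of order \<open>a t / U t\<close>.
\<close>
definition A :: "real \<Rightarrow> real" where "A t = a t / U t"

lemma A_pos: "t > 1 \<Longrightarrow> A t > 0"
  by (simp add: A_def U_pos a_pos)

text \<open>
  The increment of \<open>U\<close> from \<open>t x\<close> to \<open>2 t x\<close> is compared with \<open>a (t x)\<close> directly, and with \<open>a t\<close> as a
  difference of two increments starting at \<open>t\<close>. Since its normalised limit is not zero, the quotient
  of the two comparisons gives the limit of the ratio.
\<close>
lemma a_ratio:
  assumes "x > 0"
  shows "((\<lambda>t. a (t * x) / a t) \<longlongrightarrow> x powr \<gamma>) at_top"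
proof -
  have 1: "((\<lambda>t. (U (t * x * 2) - U (t * x)) / a (t * x)) \<longlongrightarrow> box_cox \<gamma> 2) at_top"
    using filterlim_compose[OF U_lim[of 2] at_top_scale[OF assms]] by simp
  have "((\<lambda>t. (U (t * (x * 2)) - U t) / a t - (U (t * x) - U t) / a t)
      \<longlongrightarrow> box_cox \<gamma> (x * 2) - box_cox \<gamma> x) at_top"
    using assms by (intro tendsto_diff U_lim) auto
  then have 2: "((\<lambda>t. (U (t * (x * 2)) - U (t * x)) / a t) \<longlongrightarrow> x powr \<gamma> * box_cox \<gamma> 2) at_top"
    using assms by (simp add: box_cox_mult diff_divide_distrib[symmetric])
  have nz: "box_cox \<gamma> 2 > 0" by (simp add: box_cox_pos)
  have "((\<lambda>t. ((U (t * (x * 2)) - U (t * x)) / a t) / ((U (t * x * 2) - U (t * x)) / a (t * x)))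
      \<longlongrightarrow> x powr \<gamma> * box_cox \<gamma> 2 / box_cox \<gamma> 2) at_top"
    using nz by (intro tendsto_divide 1 2) auto
  moreover have "\<forall>\<^sub>F t in at_top. ((U (t * (x * 2)) - U (t * x)) / a t) / ((U (t * x * 2) - U (t * x)) / a (t * x)) = a (t * x) / a t"
    using order_tendstoD(1)[OF 1 nz]
  proof eventually_elim
    case (elim t)
    then have "U (t * (x * 2)) - U (t * x) \<noteq> 0" by (auto simp: mult.assoc)
    then show ?case by (simp add: mult.assoc)
  qed
  ultimately show ?thesis using nz
    by (simp add: filterlim_cong[OF refl refl])
qed

text \<open>
  Positivity of \<open>U\<close> is what bounds \<open>a\<close>: stepping from \<open>t\<close> down to \<open>t / 2\<close> lowers \<open>U\<close> by an amount
  comparable to \<open>a t\<close>, and that cannot exceed \<open>U t\<close>.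
\<close>
lemma A_bounded: "\<exists>C>0. \<forall>\<^sub>F t in at_top. A t \<le> C"
proof -
  \<comment> \<open>the limit of \<open>(U t - U (t / 2)) / a t\<close>\<close>
  define \<beta> where "\<beta> = - box_cox \<gamma> (1/2)"
  have "\<beta> = 2 powr - \<gamma> * box_cox \<gamma> 2"
    using box_cox_mult[of "1/2" 2 \<gamma>] by (simp add: \<beta>_def powr_divide powr_minus_divide)
  then have \<beta>: "\<beta> > 0" by (simp add: box_cox_pos)
  have "\<forall>\<^sub>F t in at_top. (U (t * (1/2)) - U t) / a t < - \<beta> / 2"
    using \<beta> by (intro order_tendstoD(2)[OF U_lim]) (auto simp: \<beta>_def)
  with eventually_gt_at_top[of 2]
  have "\<forall>\<^sub>F t in at_top. A t \<le> 2 / \<beta>"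
  proof eventually_elim
    case (elim t)
    have "- U t \<le> U (t * (1/2)) - U t" using U_pos[of "t * (1/2)"] elim by simp
    also have "\<dots> \<le> - \<beta> / 2 * a t" using elim a_pos[of t] by (simp add: divide_less_eq)
    finally show ?case using U_pos[of t] elim \<beta> by (simp add: A_def field_simps)
  qed
  with \<beta> show ?thesis by (intro exI[of _ "2 / \<beta>"]) auto
qed

lemma increment_bounded: 
  assumes "x > 0"
  shows "\<forall>\<^sub>F t in at_top. U (t * x) - U t \<le> (box_cox \<gamma> x + 1) * a t"
proof -
  have "\<forall>\<^sub>F t in at_top. (U (t * x) - U t) / a t < box_cox \<gamma> x + 1"
    using assms by (intro order_tendstoD(2)[OF U_lim]) auto
  with eventually_gt_at_top[of 1] show ?thesis
    by eventually_elim (use a_pos in \<open>simp add: divide_less_eq less_imp_le\<close>)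
qed

lemma U_ratio_bounded:
  assumes "x \<ge> 1"
  shows "\<exists>C>0. \<forall>\<^sub>F t in at_top. U (t * x) \<le> C * U t"
proof -
  obtain C where C: "C > 0" "\<forall>\<^sub>F t in at_top. A t \<le> C" using A_bounded by blast
  define D where "D = box_cox \<gamma> x + 1"
  have D: "D > 0" using assms box_cox_pos[of x \<gamma>] by (cases "x = 1") (auto simp: D_def box_cox_def)
  have "\<forall>\<^sub>F t in at_top. U (t * x) - U t \<le> D * a t"
    using increment_bounded[of x] assms by (simp add: D_def)
  with C(2) eventually_gt_at_top[of 1] have "\<forall>\<^sub>F t in at_top. U (t * x) \<le> (1 + D * C) * U t"
  proof eventually_elim
    case (elim t)
    have "D * a t \<le> D * (C * U t)"
      using elim U_pos[of t] D by (intro mult_left_mono) (auto simp: A_def divide_le_eq)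
    with elim show ?case by (simp add: algebra_simps)
  qed
  with C D show ?thesis by (intro exI[of _ "1 + D * C"]) (auto intro: add_pos_pos)
qed

text \<open>
  For \<open>x \<le> 1\<close> only: \<open>a\<close> varies by a bounded factor and \<open>U (t x)\<close> is at least a fixed fraction of
  \<open>U t\<close>.
\<close>
lemma A_shift:
  assumes "0 < x" "x \<le> 1"
  shows "\<exists>C>0. \<forall>\<^sub>F t in at_top. A (t * x) \<le> C * A t"
proof -
  obtain C where C: "C > 0" "\<forall>\<^sub>F t in at_top. U (t * (1/x)) \<le> C * U t"
    using U_ratio_bounded[of "1/x"] assms by auto
  have 1: "\<forall>\<^sub>F t in at_top. U t \<le> C * U (t * x)"
    using eventually_compose_filterlim[OF C(2) at_top_scale[OF assms(1)]] assms by simp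
  define D where "D = x powr \<gamma> + 1"
  have D: "D > 0" by (auto simp: D_def intro: add_nonneg_pos)
  have 2: "\<forall>\<^sub>F t in at_top. a (t * x) / a t < D"
    using assms by (intro order_tendstoD(2)[OF a_ratio]) (auto simp: D_def)
  have 3: "\<forall>\<^sub>F t in at_top. t * x > 1"
    using at_top_scale[OF assms(1)] by (simp add: filterlim_at_top_dense)
  from 1 2 3 eventually_gt_at_top[of 1] have "\<forall>\<^sub>F t in at_top. A (t * x) \<le> (D * C) * A t"
  proof eventually_elim
    case (elim t)
    have U: "U t > 0" "U (t * x) > 0" "a t > 0" using U_pos a_pos elim by auto
    have "a (t * x) * U t \<le> (D * a t) * (C * U (t * x))"
      using elim U D by (intro mult_mono) (auto simp: divide_less_eq)
    then show ?case using U by (simp add: A_def field_simps)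
  qed
  with C D show ?thesis by (intro exI[of _ "D * C"]) auto
qed

text \<open>
  The ratio \<open>r = U / a\<close> satisfies \<open>r (2 t) \<le> q (r t + K)\<close> with \<open>q < 1\<close>, because \<open>a t / a (2 t)\<close> tends to
  \<open>2 powr - \<gamma> < 1\<close>. Such a recursion keeps \<open>r\<close> bounded once it is bounded on one interval
  \<open>[t\<^sub>0, 2 t\<^sub>0]\<close>. On that interval monotonicity of \<open>U\<close> helps, as nothing else is known about \<open>a\<close> there:
  \<open>U (4 t) - U t\<close> is at least \<open>U (4 t\<^sub>0) - U (2 t\<^sub>0)\<close>, which keeps \<open>a\<close> away from zero.
\<close>
lemma A_bounded_below:
  assumes "\<gamma> > 0"
  shows "\<exists>B>0. \<forall>\<^sub>F t in at_top. 1 \<le> B * A t"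
proof -
  define q where "q = (1 + 2 powr - \<gamma>) / 2"
  have "2 powr - \<gamma> < 2 powr (0::real)" using assms by (intro powr_less_mono) auto
  then have q: "0 < q" "q < 1" "2 powr - \<gamma> < q" by (auto simp: q_def intro: add_pos_nonneg)
  have "((\<lambda>t. 1 / (a (t * 2) / a t)) \<longlongrightarrow> 1 / 2 powr \<gamma>) at_top"
    by (intro tendsto_divide tendsto_const a_ratio) auto
  from order_tendstoD(2)[OF this, of q] q
  have e1: "\<forall>\<^sub>F t in at_top. a t / a (t * 2) < q" by (simp add: powr_minus_divide)
  define K where "K = box_cox \<gamma> 2 + 1"
  define L where "L = box_cox \<gamma> 4 + 1"
  have K: "K > 0" "L > 0" using box_cox_pos[of 2 \<gamma>] box_cox_pos[of 4 \<gamma>] by (auto simp: K_def L_def)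
  have e2: "\<forall>\<^sub>F t in at_top. U (t * 2) - U t \<le> K * a t"
    using increment_bounded[of 2] by (simp add: K_def)
  have e3: "\<forall>\<^sub>F t in at_top. U (t * 4) - U t \<le> L * a t"
    using increment_bounded[of 4] by (simp add: L_def)
  have e4: "\<forall>\<^sub>F t in at_top. (U (t * 2) - U t) / a t > 0"
    by (intro order_tendstoD(1)[OF U_lim]) (auto simp: box_cox_pos)
  from eventually_conj[OF eventually_gt_at_top[of 1]
      eventually_conj[OF e1 eventually_conj[OF e2 eventually_conj[OF e3 e4]]]]
  obtain t0 where t0': "\<And>t. t \<ge> t0 \<Longrightarrow> 1 < t \<and> a t / a (t * 2) < q \<and> U (t * 2) - U t \<le> K * a t
      \<and> U (t * 4) - U t \<le> L * a t \<and> (U (t * 2) - U t) / a t > 0"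
    by (auto simp: eventually_at_top_linorder)
  then have t0: "t0 > 1" by blast
  define r where "r t = U t / a t" for t
  define G where "G = U (t0 * 4) - U (t0 * 2)"
  have "U (t0 * 2 * 2) - U (t0 * 2) > 0"
    using t0'[of "t0 * 2"] a_pos[of "t0 * 2"] t0 by (simp add: zero_less_divide_iff)
  then have G: "G > 0" by (simp add: G_def mult.commute)
  define B where "B = max (U (t0 * 2) * L / G) (q * K / (1 - q))"
  have "q * K / (1 - q) > 0" using q K by simp
  then have B: "B > 0" by (simp add: B_def)
  have "q * K / (1 - q) \<le> B" by (simp add: B_def)
  then have "q * K \<le> B * (1 - q)" using q by (simp add: divide_le_eq)
  then have B2: "q * (B + K) \<le> B" by (simp add: algebra_simps)
  have base: "r t \<le> B" if "t0 \<le> t" "t \<le> 2 * t0" for t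
  proof -
    have "G \<le> U (t * 4) - U t"
      unfolding G_def using that t0 by (intro diff_mono U_mono) auto
    also have "\<dots> \<le> L * a t" using t0'[of t] that by blast
    finally have "G \<le> L * a t" .
    have "U t * G \<le> U (t0 * 2) * (L * a t)"
      using that t0 G U_pos[of "t0*2"] \<open>G \<le> L * a t\<close> by (intro mult_mono U_mono) auto
    then have "r t \<le> U (t0 * 2) * L / G"
      using G a_pos[of t] that t0 by (simp add: r_def field_simps)
    then show ?thesis by (simp add: B_def)
  qed
  have step: "r (t * 2) \<le> B" if t: "t \<ge> t0" and "r t \<le> B" for t
  proof -
    have p: "a t > 0" "a (t * 2) > 0" "U t > 0" using a_pos U_pos t t0 by auto
    have "U (t * 2) \<le> (r t + K) * a t"
      using t0'[of t] t p by (simp add: r_def algebra_simps)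
    also have "\<dots> \<le> (B + K) * a t" using that p by (intro mult_right_mono) auto
    finally have "U (t * 2) \<le> (B + K) * a t" .
    then have "r (t * 2) \<le> (B + K) * (a t / a (t * 2))"
      using p by (simp add: r_def divide_right_mono)
    also have "\<dots> \<le> (B + K) * q"
      using t0'[of t] t B K by (intro mult_left_mono) auto
    finally show ?thesis using B2 by (simp add: mult.commute)
  qed
  have "\<forall>t. t0 \<le> t \<and> t \<le> 2 ^ Suc i * t0 \<longrightarrow> r t \<le> B" for i
  proof (induction i)
    case 0
    then show ?case using base by simp
  next
    case (Suc i)
    show ?case
    proof (intro allI impI)
      fix t assume t: "t0 \<le> t \<and> t \<le> 2 ^ Suc (Suc i) * t0"
      show "r t \<le> B"
      proof (cases "t \<le> 2 * t0")
        case False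
        with t Suc.IH have "r (t / 2) \<le> B" by simp
        with step[of "t/2"] False show ?thesis by simp
      qed (use t base in auto)
    qed
  qed
  moreover have "\<exists>i. t \<le> 2 ^ Suc i * t0" if "t \<ge> t0" for t
  proof -
    obtain i where "t / t0 < 2 ^ i" using real_arch_pow[of 2 "t / t0"] by auto
    then have "t \<le> 2 ^ i * t0" using t0 by (simp add: divide_less_eq)
    also have "\<dots> \<le> 2 ^ Suc i * t0" using t0 by simp
    finally show ?thesis by blast
  qed
  ultimately have r: "r t \<le> B" if "t \<ge> t0" for t using that by blast
  have "1 \<le> B * A t" if "t \<ge> t0" for t
    using r[of t] that U_pos[of t] a_pos[of t] t0 by (simp add: r_def A_def field_simps)
  with B show ?thesis by (auto simp: eventually_at_top_linorder)
qed

text \<open>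
  For \<open>\<gamma> > 0\<close> the function \<open>A\<close> is bounded from both sides. For \<open>\<gamma> \<le> 0\<close> doubling the argument
  multiplies \<open>a\<close>, and by monotonicity of \<open>U\<close> also \<open>A\<close>, by a factor whose limit superior is at most \<open>1\<close>.
  Any rate between \<open>1\<close> and \<open>\<surd>2\<close> could stand in place of \<open>5/4\<close>: it has to exceed \<open>1\<close> here, and its
  square has to stay below the factor \<open>2\<close> by which tail probabilities decrease.
\<close>
lemma A_growth:
  "\<exists>C>0. \<exists>t0>1. \<forall>t\<ge>t0. \<forall>i. A (2 ^ i * t) \<le> C * (5/4) ^ i * A t"
proof (cases "\<gamma> > 0")
  case True
  obtain B where B: "B > 0" "\<forall>\<^sub>F t in at_top. 1 \<le> B * A t" using A_bounded_below[OF True] by blast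
  obtain C where C: "C > 0" "\<forall>\<^sub>F t in at_top. A t \<le> C" using A_bounded by blast
  from eventually_conj[OF eventually_gt_at_top[of 1] eventually_conj[OF B(2) C(2)]]
  obtain t0 where t0: "\<And>t. t \<ge> t0 \<Longrightarrow> 1 < t \<and> 1 \<le> B * A t \<and> A t \<le> C"
    by (auto simp: eventually_at_top_linorder)
  have "A (2 ^ i * t) \<le> C * B * (5/4) ^ i * A t" if t: "t \<ge> t0" for t i
  proof -
    have "1 * t \<le> 2 ^ i * t" using t t0[of t] by (intro mult_right_mono) auto
    then have "A (2 ^ i * t) \<le> C * 1" using t0[of "2 ^ i * t"] t by simp
    also have "\<dots> \<le> C * (B * A t)" using t0[of t] t C by (intro mult_left_mono) auto
    also have "C * (B * A t) \<le> (5/4) ^ i * (C * (B * A t))"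
      using mult_right_mono[of 1 "(5/4::real) ^ i" "C * (B * A t)"] C B A_pos[of t] t0[of t] t by simp
    finally show ?thesis by (simp add: mult_ac)
  qed
  with t0[of t0] B C show ?thesis by (intro exI[of _ "C * B"] conjI exI[of _ t0]) auto
next
  case False
  have "2 powr \<gamma> \<le> 2 powr (0::real)" using False by (intro powr_mono) auto
  then have "\<forall>\<^sub>F t in at_top. a (t * 2) / a t < 5/4"
    by (intro order_tendstoD(2)[OF a_ratio]) auto
  from eventually_conj[OF eventually_gt_at_top[of 1] this]
  obtain t0 where t0: "\<And>t. t \<ge> t0 \<Longrightarrow> 1 < t \<and> a (t * 2) / a t < 5/4"
    by (auto simp: eventually_at_top_linorder)
  have step: "A (2 * t) \<le> 5/4 * A t" if t: "t \<ge> t0" for t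
  proof -
    have "A (2 * t) \<le> a (2 * t) / U t"
      unfolding A_def using t0[OF t] U_mono[of t "2 * t"] U_pos[of t] U_pos[of "2*t"] a_pos[of "2 * t"]
      by (intro divide_left_mono) auto
    also have "\<dots> \<le> (5/4 * a t) / U t"
      using t0[OF t] U_pos[of t] a_pos[of t] by (intro divide_right_mono) (auto simp: divide_less_eq mult.commute)
    finally show ?thesis by (simp add: A_def)
  qed
  have "A (2 ^ i * t) \<le> 1 * (5/4) ^ i * A t" if t: "t \<ge> t0" for t i
  proof (induction i)
    case (Suc i)
    have "1 * t \<le> 2 ^ i * t" using t t0[of t] by (intro mult_right_mono) auto
    then have "A (2 * (2 ^ i * t)) \<le> 5/4 * A (2 ^ i * t)" using t by (intro step) auto
    with Suc show ?case by (simp add: mult_ac)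
  qed simp
  with t0[of t0] show ?thesis by (intro exI[of _ 1] conjI exI[of _ t0]) auto
qed

text \<open>
  A Potter-type bound along dyadic points: one doubling increases \<open>ln U\<close> by at most a constant times
  \<open>A\<close>, and the increments sum up as a geometric series.
\<close>
lemma log_growth:
  "\<exists>C>0. \<exists>t0>1. \<forall>t\<ge>t0. \<forall>i. ln (U (2 ^ i * t)) - ln (U t) \<le> C * (5/4) ^ i * A t"
proof -
  obtain C t1 where C: "C > 0" "t1 > 1" "\<And>t i. t \<ge> t1 \<Longrightarrow> A (2 ^ i * t) \<le> C * (5/4) ^ i * A t"
    using A_growth by blast
  define D where "D = box_cox \<gamma> 2 + 1"
  have D: "D > 0" using box_cox_pos[of 2 \<gamma>] by (simp add: D_def)
  obtain t2 where t2: "\<And>t. t \<ge> t2 \<Longrightarrow> U (t * 2) - U t \<le> D * a t"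
    using increment_bounded[of 2] by (auto simp: D_def eventually_at_top_linorder)
  define t0 where "t0 = max t1 t2"
  have inc: "ln (U (2 * t)) - ln (U t) \<le> D * A t" if t: "t \<ge> t0" for t
  proof -
    have p: "U t > 0" "U (2 * t) > 0" using U_pos[of t] U_pos[of "2*t"] t C(2) by (auto simp: t0_def)
    have "ln (U (2 * t)) - ln (U t) = ln (U (2 * t) / U t)" using p by (simp add: ln_div)
    also have "\<dots> \<le> U (2 * t) / U t - 1" using p by (intro ln_le_minus_one) auto
    also have "\<dots> = (U (t * 2) - U t) / U t" using p by (simp add: field_simps)
    also have "\<dots> \<le> D * a t / U t" using p t2[of t] t by (intro divide_right_mono) (auto simp: t0_def)
    finally show ?thesis by (simp add: A_def)
  qed
  have "ln (U (2 ^ i * t)) - ln (U t) \<le> 4 * D * C * ((5/4) ^ i - 1) * A t" if t: "t \<ge> t0" for t i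
  proof (induction i)
    case (Suc i)
    have "t > 1" using t C(2) by (auto simp: t0_def)
    then have "1 * t \<le> 2 ^ i * t" by (intro mult_right_mono) auto
    then have "ln (U (2 * (2 ^ i * t))) - ln (U (2 ^ i * t)) \<le> D * A (2 ^ i * t)"
      using t by (intro inc) auto
    also have "\<dots> \<le> D * (C * (5/4) ^ i * A t)"
      using C(3)[of t i] t D by (intro mult_left_mono) (auto simp: t0_def)
    finally show ?case using Suc by (simp add: algebra_simps)
  qed simp
  moreover have "4 * D * C * ((5/4) ^ i - 1) * A t \<le> 4 * D * C * (5/4) ^ i * A t" if "t \<ge> t0" for t i
    using D C A_pos[of t] that by (intro mult_right_mono mult_left_mono) (auto simp: t0_def)
  ultimately have "ln (U (2 ^ i * t)) - ln (U t) \<le> 4 * D * C * (5/4) ^ i * A t" if "t \<ge> t0" for t i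
    using that by (meson order_trans)
  moreover have "4 * D * C > 0" "t0 > 1" using C D by (auto simp: t0_def)
  ultimately show ?thesis by blast
qed

text \<open>
  The reverse of \<open>log_growth\<close> for a single step; it separates two groups of large observations on
  the scale \<open>A\<close>.
\<close>
lemma log_gap:
  "\<exists>c>0. \<forall>\<^sub>F t in at_top. c * A t \<le> ln (U (t * 8)) - ln (U (t * 4))"
proof -
  define D where "D = box_cox \<gamma> 2 / 2"
  have D: "D > 0" using box_cox_pos[of 2 \<gamma>] by (simp add: D_def)
  have "\<forall>\<^sub>F t in at_top. (U (t * 2) - U t) / a t > D"
    using D by (intro order_tendstoD(1)[OF U_lim]) (auto simp: D_def)
  from eventually_compose_filterlim[OF this at_top_scale[of 4]]
  have e1: "\<forall>\<^sub>F t in at_top. (U (t * 8) - U (t * 4)) / a (t * 4) > D" by (simp add: mult.assoc)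
  obtain C where C: "C > 0" "\<forall>\<^sub>F t in at_top. A (t * (1/4)) \<le> C * A t"
    using A_shift[of "1/4"] by auto
  from eventually_compose_filterlim[OF C(2) at_top_scale[of 4]]
  have e2: "\<forall>\<^sub>F t in at_top. A t \<le> C * A (t * 4)" by simp
  obtain E where E: "E > 0" "\<forall>\<^sub>F t in at_top. U (t * 2) \<le> E * U t"
    using U_ratio_bounded[of 2] by auto
  from eventually_compose_filterlim[OF E(2) at_top_scale[of 4]]
  have e3: "\<forall>\<^sub>F t in at_top. U (t * 8) \<le> E * U (t * 4)" by (simp add: mult.assoc)
  from e1 e2 e3 eventually_gt_at_top[of 1]
  have "\<forall>\<^sub>F t in at_top. (D / (C * E)) * A t \<le> ln (U (t * 8)) - ln (U (t * 4))"
  proof eventually_elim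
    case (elim t)
    have p: "U (t * 4) > 0" "U (t * 8) > 0" "a (t * 4) > 0" using U_pos a_pos elim by auto
    have "D * A (t * 4) / E = D * a (t * 4) / (E * U (t * 4))" by (simp add: A_def)
    also have "\<dots> \<le> (U (t * 8) - U (t * 4)) / U (t * 8)"
      using p elim E D U_mono[of "t * 4" "t * 8"] by (intro frac_le) (auto simp: less_divide_eq)
    also have "\<dots> = 1 - U (t * 4) / U (t * 8)" using p by (simp add: field_simps)
    also have "\<dots> \<le> - ln (U (t * 4) / U (t * 8))"
      using ln_le_minus_one[of "U (t * 4) / U (t * 8)"] p by simp
    also have "\<dots> = ln (U (t * 8)) - ln (U (t * 4))" using p by (simp add: ln_div)
    finally have "D * A (t * 4) / E \<le> ln (U (t * 8)) - ln (U (t * 4))" .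
    moreover have "(D / (C * E)) * A t \<le> (D / (C * E)) * (C * A (t * 4))"
      using elim D C E by (intro mult_left_mono) auto
    ultimately show ?case using C by simp
  qed
  moreover have "D / (C * E) > 0" using C D E by simp
  ultimately show ?thesis by blast
qed

end

section \<open>Tail probabilities and the excess over a high quantile\<close>

lemma tail_quantile_le_iff:
  assumes "real_distribution \<mu>" "t > 1"
  shows "tail_quantile (cdf \<mu>) t \<le> x \<longleftrightarrow> 1 - 1 / t \<le> cdf \<mu> x"
proof -
  interpret cdf_distribution \<mu> using assms by (simp add: cdf_distribution_def)
  show ?thesis using pseudoinverse[of "1 - 1/t" x] assms(2)
    by (simp add: tail_quantile_def gen_inverse_def)
qed

lemma tail_quantile_mono:
  assumes "real_distribution \<mu>" "1 < s" "s \<le> t"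
  shows "tail_quantile (cdf \<mu>) s \<le> tail_quantile (cdf \<mu>) t"
proof -
  have "1 - 1 / s \<le> 1 - 1 / t" using assms by (simp add: frac_le)
  also have "\<dots> \<le> cdf \<mu> (tail_quantile (cdf \<mu>) t)"
    using tail_quantile_le_iff[of \<mu> t] assms by auto
  finally show ?thesis using tail_quantile_le_iff[of \<mu> s] assms by auto
qed

lemma tail_quantile_pos:
  assumes "real_distribution \<mu>" "AE y in \<mu>. y > 0" "t > 1"
  shows "tail_quantile (cdf \<mu>) t > 0"
proof -
  interpret real_distribution \<mu> by fact
  have "cdf \<mu> 0 = measure \<mu> {}" unfolding cdf_def
    using assms(2) by (intro measure_eq_AE) auto
  with tail_quantile_le_iff[OF assms(1,3), of 0] assms(3) show ?thesis by (simp add: not_le[symmetric])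
qed

lemma measure_greater_tail_quantile:
  assumes "real_distribution \<mu>" "t > 1"
  shows "measure \<mu> {tail_quantile (cdf \<mu>) t<..} \<le> 1 / t"
proof -
  interpret real_distribution \<mu> by fact
  have "measure \<mu> {tail_quantile (cdf \<mu>) t<..} = 1 - cdf \<mu> (tail_quantile (cdf \<mu>) t)"
  proof -
    have "measure \<mu> {u<..} = 1 - cdf \<mu> u" for u
      using prob_compl[of "{..u}"] by (simp add: cdf_def Compl_eq_Diff_UNIV[symmetric] Compl_atMost)
    then show ?thesis .
  qed
  then show ?thesis using tail_quantile_le_iff[OF assms, of "tail_quantile (cdf \<mu>) t"] by simp
qed

text \<open>
  The closed half-line is essential: an atom at the quantile belongs to this set and is missing from
  the one in \<open>measure_greater_tail_quantile\<close>.
\<close>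
lemma measure_ge_tail_quantile:
  assumes "real_distribution \<mu>" "t > 1"
  shows "measure \<mu> {tail_quantile (cdf \<mu>) t..} \<ge> 1 / t"
proof -
  interpret real_distribution \<mu> by fact
  let ?u = "tail_quantile (cdf \<mu>) t"
  have "cdf \<mu> x \<le> 1 - 1 / t" if "x < ?u" for x
    using tail_quantile_le_iff[OF assms, of x] that by linarith
  then have "\<forall>\<^sub>F x in at_left ?u. cdf \<mu> x \<le> 1 - 1 / t"
    unfolding eventually_at_left_field by (intro exI[of _ "?u - 1"]) auto
  then have "measure \<mu> {..<?u} \<le> 1 - 1 / t"
    by (intro tendsto_upperbound[OF cdf_at_left]) auto
  moreover have "measure \<mu> {?u..} = 1 - measure \<mu> {..<?u}"
    using prob_compl[of "{..<?u}"]
    by (simp add: Compl_eq_Diff_UNIV[symmetric] Compl_lessThan)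
  ultimately show ?thesis by simp
qed

lemma one_less_power2_mult: "s > 1 \<Longrightarrow> (2::real) ^ i * s > 1"
  by (induction i) (auto simp: mult.assoc)

lemma AE_le_tail_quantile:
  assumes "real_distribution \<mu>" "s > 1"
  shows "AE y in \<mu>. \<exists>i. y \<le> tail_quantile (cdf \<mu>) (2 ^ i * s)"
proof -
  interpret real_distribution \<mu> by fact
  let ?u = "\<lambda>i. tail_quantile (cdf \<mu>) (2 ^ i * s)"
  have gt: "2 ^ i * s > 1" for i using assms(2) by (rule one_less_power2_mult)
  have "measure \<mu> {y. \<forall>i. ?u i < y} \<le> (1/2) ^ i" for i
  proof -
    have "measure \<mu> {y. \<forall>i. ?u i < y} \<le> measure \<mu> {?u i<..}"
      by (intro finite_measure_mono) auto
    also have "\<dots> \<le> 1 / (2 ^ i * s)" by (intro measure_greater_tail_quantile assms gt)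
    also have "\<dots> \<le> 1 / 2 ^ i" using assms by (intro divide_left_mono) auto
    finally show ?thesis by (simp add: power_divide)
  qed
  then have "measure \<mu> {y. \<forall>i. ?u i < y} \<le> 0"
    by (intro LIMSEQ_le_const[OF LIMSEQ_power_zero[of "1/2"]]) auto
  moreover have "{y. \<forall>i. ?u i < y} \<in> sets \<mu>"
  proof -
    have "{y. \<forall>i. ?u i < y} = (\<Inter>i. {?u i<..})" by auto
    then show ?thesis by auto
  qed
  ultimately have "AE y in \<mu>. \<not> (\<forall>i. ?u i < y)"
    by (intro AE_I[where N="{y. \<forall>i. ?u i < y}"]) (auto simp: emeasure_eq_measure measure_le_0_iff)
  then show ?thesis by (auto simp: not_less)
qed

text \<open>
  On the layer between \<open>U (2\<^sup>i s)\<close> and \<open>U (2\<^sup>i\<^sup>+\<^sup>1 s)\<close> the squared log-excess is at most of order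
  \<open>(25/16)\<^sup>i A(s)\<^sup>2\<close> by \<open>log_growth\<close>, and the layer has probability at most \<open>1 / (2\<^sup>i s)\<close>. Since
  \<open>25/32 < 1\<close>, the sum over the layers converges.
\<close>
lemma (in extended_regular_variation) log_excess_second_moment:
  assumes \<mu>: "real_distribution \<mu>" and pos: "AE y in \<mu>. y > 0" and U: "U = tail_quantile (cdf \<mu>)"
  shows "\<exists>C>0. \<forall>\<^sub>F s in at_top.
    (\<integral>\<^sup>+y. ennreal ((max 0 (ln y - ln (U s)))\<^sup>2) \<partial>\<mu>) \<le> ennreal (C * (A s)\<^sup>2 / s)"
proof -
  obtain C t0 where C: "C > 0" "t0 > 1"
    "\<And>t i. t \<ge> t0 \<Longrightarrow> ln (U (2 ^ i * t)) - ln (U t) \<le> C * (5/4) ^ i * A t"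
    using log_growth by blast
  interpret real_distribution \<mu> by fact
  have bound: "(\<integral>\<^sup>+y. ennreal ((max 0 (ln y - ln (U s)))\<^sup>2) \<partial>\<mu>) \<le> ennreal (8 * C\<^sup>2 * (A s)\<^sup>2 / s)"
    if s: "s \<ge> t0" for s
  proof -
    have s1: "s > 1" using s C by simp
    have gt: "2 ^ i * s > 1" for i using s1 by (rule one_less_power2_mult)
    define w where "w i = (C * (5/4) ^ Suc i * A s)\<^sup>2" for i
    have w: "w i \<ge> 0" for i by (simp add: w_def)
    have w_eq: "w i = (25/16) * C\<^sup>2 * (A s)\<^sup>2 * (25/16) ^ i" for i
    proof -
      have "((5/4::real) ^ Suc i)\<^sup>2 = (25/16) * (25/16) ^ i"
        unfolding power_Suc power_mult_distrib power_mult[symmetric] mult.commute[of i]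
        by (simp add: power_mult power2_eq_square)
      then show ?thesis unfolding w_def power_mult_distrib by simp
    qed
    have pw: "ennreal ((max 0 (ln y - ln (U s)))\<^sup>2) \<le> (\<Sum>i. ennreal (w i) * indicator {U (2 ^ i * s)<..} y)"
      if y: "y > 0" and ex: "\<exists>i. y \<le> U (2 ^ i * s)" for y
    proof (cases "y \<le> U s")
      case True
      then show ?thesis using y U_pos[OF s1] by simp
    next
      case False
      \<comment> \<open>\<open>y\<close> lies in layer \<open>l = i - 1\<close>, so that a single term of the series dominates\<close>
      define i where "i = (LEAST i. y \<le> U (2 ^ i * s))"
      have i: "y \<le> U (2 ^ i * s)" unfolding i_def using ex by (rule LeastI_ex)
      then obtain l where l: "i = Suc l" using False by (cases i) auto
      have less: "U (2 ^ l * s) < y"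
        using not_less_Least[of l "\<lambda>i. y \<le> U (2 ^ i * s)"] by (simp add: i_def[symmetric] l)
      have y: "y > 0" "ln y - ln (U s) \<ge> 0" using y False U_pos[OF s1] by auto
      have "ln y - ln (U s) \<le> ln (U (2 ^ Suc l * s)) - ln (U s)"
        using i y U_pos[OF gt[of i]] by (simp add: l)
      also have "\<dots> \<le> C * (5/4) ^ Suc l * A s" by (rule C(3)[OF s])
      finally have "(max 0 (ln y - ln (U s)))\<^sup>2 \<le> w l"
        unfolding w_def using y by (intro power_mono) auto
      then have "ennreal ((max 0 (ln y - ln (U s)))\<^sup>2) \<le> (\<Sum>i\<in>{l}. ennreal (w i) * indicator {U (2 ^ i * s)<..} y)"
        using less by (simp add: ennreal_leI)
      also have "\<dots> \<le> (\<Sum>i. ennreal (w i) * indicator {U (2 ^ i * s)<..} y)"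
        by (intro sum_le_suminf) auto
      finally show ?thesis .
    qed
    have "(\<integral>\<^sup>+y. ennreal ((max 0 (ln y - ln (U s)))\<^sup>2) \<partial>\<mu>)
       \<le> (\<integral>\<^sup>+y. (\<Sum>i. ennreal (w i) * indicator {U (2 ^ i * s)<..} y) \<partial>\<mu>)"
    proof (rule nn_integral_mono_AE)
      show "AE y in \<mu>. ennreal ((max 0 (ln y - ln (U s)))\<^sup>2) \<le> (\<Sum>i. ennreal (w i) * indicator {U (2 ^ i * s)<..} y)"
        using AE_le_tail_quantile[OF \<mu> s1] pos 
        by eventually_elim (rule pw, auto simp: U)
    qed
    also have "\<dots> = (\<Sum>i. \<integral>\<^sup>+y. ennreal (w i) * indicator {U (2 ^ i * s)<..} y \<partial>\<mu>)"
      by (rule nn_integral_suminf) auto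
    also have "\<dots> = (\<Sum>i. ennreal (w i * measure \<mu> {U (2 ^ i * s)<..}))"
      by (simp add: nn_integral_cmult_indicator emeasure_eq_measure ennreal_mult w)
    also have "\<dots> \<le> (\<Sum>i. ennreal ((25/16) * C\<^sup>2 * (A s)\<^sup>2 / s * (25/32) ^ i))"
    proof (intro suminf_le allI ennreal_leI)
      fix i
      have "w i * measure \<mu> {U (2 ^ i * s)<..} \<le> w i * (1 / (2 ^ i * s))"
        unfolding U by (intro mult_left_mono measure_greater_tail_quantile \<mu> gt w)
      also have "\<dots> = (25/16) * C\<^sup>2 * (A s)\<^sup>2 / s * ((25/16) ^ i / 2 ^ i)"
        by (simp add: w_eq)
      also have "(25/16) ^ i / 2 ^ i = (25/32 :: real) ^ i" by (simp flip: power_divide)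
      finally show "w i * measure \<mu> {U (2 ^ i * s)<..} \<le> (25/16) * C\<^sup>2 * (A s)\<^sup>2 / s * (25/32) ^ i" .
    qed auto
    also have "\<dots> = ennreal (\<Sum>i. (25/16) * C\<^sup>2 * (A s)\<^sup>2 / s * (25/32) ^ i)"
      using s1 by (intro suminf_ennreal2 summable_mult summable_geometric) auto
    also have "(\<Sum>i. (25/16) * C\<^sup>2 * (A s)\<^sup>2 / s * (25/32) ^ i) = (25/16) * C\<^sup>2 * (A s)\<^sup>2 / s * (32/7)"
      by (subst suminf_mult) (auto simp: suminf_geometric summable_geometric)
    also have "ennreal \<dots> \<le> ennreal (8 * C\<^sup>2 * (A s)\<^sup>2 / s)"
      using s1 by (intro ennreal_leI) (simp add: field_simps)
    finally show ?thesis .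
  qed
  with C show ?thesis
    by (intro exI[of _ "8 * C\<^sup>2"] conjI eventually_at_top_linorderI[of t0]) auto
qed

section \<open>Counting exceedances, and a lower bound for the empirical variance\<close>

text \<open>
  The variance of the count is at most its mean \<open>n \<mu>(B)\<close>, which is what makes the bound useful for
  rare events.
\<close>
lemma (in prob_space) chebyshev_count:
  fixes Y :: "nat \<Rightarrow> 'a \<Rightarrow> real"
  assumes indep: "indep_vars (\<lambda>_. borel) Y {1..n}"
    and distr: "\<And>i. i \<in> {1..n} \<Longrightarrow> distr M borel (Y i) = \<mu>"
    and B [measurable]: "B \<in> sets borel" and "s > 0"
  defines "cnt \<equiv> \<lambda>\<omega>. real (card {i\<in>{1..n}. Y i \<omega> \<in> B})"
  shows "{\<omega>\<in>space M. s \<le> \<bar>cnt \<omega> - real n * measure \<mu> B\<bar>} \<in> events"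
    and "prob {\<omega>\<in>space M. s \<le> \<bar>cnt \<omega> - real n * measure \<mu> B\<bar>} \<le> real n * measure \<mu> B / s\<^sup>2"
proof -
  have Y [measurable]: "Y i \<in> borel_measurable M" if "i \<in> {1..n}" for i
    using indep that by (auto simp: indep_vars_def)
  define q where "q = measure \<mu> B"
  define X where "X i \<omega> = indicator B (Y i \<omega>) - q" for i \<omega>
  have X_meas [measurable]: "X i \<in> borel_measurable M" if "i \<in> {1..n}" for i
    unfolding X_def using Y[OF that] by measurable
  have q: "q = prob (Y i -` B \<inter> space M)" if "i \<in> {1..n}" for i
    unfolding q_def distr[OF that, symmetric] using Y[OF that] by (simp add: measure_distr)
  have q01: "0 \<le> q" "q \<le> 1" if "i \<in> {1..n}" for i using q[OF that] by (auto simp: prob_le_1)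
  have int_ind: "integrable M (\<lambda>\<omega>. indicat_real B (Y i \<omega>))" if "i \<in> {1..n}" for i
    using Y[OF that] by (intro integrable_const_bound[where B=1]) (auto simp: indicator_def)
  have E_ind: "expectation (\<lambda>\<omega>. indicat_real B (Y i \<omega>)) = q" if "i \<in> {1..n}" for i
  proof -
    have "expectation (\<lambda>\<omega>. indicat_real B (Y i \<omega>)) = expectation (indicat_real (Y i -` B \<inter> space M))"
      by (intro Bochner_Integration.integral_cong) (auto simp: indicator_def)
    also have "\<dots> = q" using Y[OF that] q[OF that] by simp
    finally show ?thesis .
  qed
  have X_int: "integrable M (X i)" if "i \<in> {1..n}" for i
    unfolding X_def using int_ind[OF that] by auto
  have X_mean: "expectation (X i) = 0" if "i \<in> {1..n}" for i
    unfolding X_def using int_ind[OF that] E_ind[OF that] by (simp add: prob_space)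
  have X_sq: "(X i \<omega>)\<^sup>2 = indicator B (Y i \<omega>) * (1 - 2 * q) + q\<^sup>2" for i \<omega>
    by (auto simp: X_def indicator_def power2_eq_square algebra_simps)
  have X_var: "expectation (\<lambda>\<omega>. X i \<omega> * X i \<omega>) \<le> q" if "i \<in> {1..n}" for i
  proof -
    have "expectation (\<lambda>\<omega>. (X i \<omega>)\<^sup>2) = q * (1 - 2 * q) + q\<^sup>2"
      unfolding X_sq using int_ind[OF that] E_ind[OF that] by (simp add: prob_space)
    then have "expectation (\<lambda>\<omega>. X i \<omega> * X i \<omega>) + q * q = q" by (simp add: power2_eq_square algebra_simps)
    then show ?thesis using zero_le_square[of q] by linarith
  qed
  have XX_int: "integrable M (\<lambda>\<omega>. X i \<omega> * X j \<omega>)" if "i \<in> {1..n}" "j \<in> {1..n}" for i j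
  proof (rule integrable_const_bound[where B=1])
    show "AE \<omega> in M. norm (X i \<omega> * X j \<omega>) \<le> 1"
    proof (intro AE_I2)
      fix \<omega>
      have "\<bar>X i \<omega>\<bar> \<le> 1" "\<bar>X j \<omega>\<bar> \<le> 1" using q01[OF that(1)] by (auto simp: X_def indicator_def)
      then show "norm (X i \<omega> * X j \<omega>) \<le> 1" by (simp add: abs_mult mult_le_one)
    qed
  qed (use X_meas that in measurable)
  have uncorr: "expectation (\<lambda>\<omega>. X i \<omega> * X j \<omega>) = 0" if "i \<in> {1..n}" "j \<in> {1..n}" "i \<noteq> j" for i j
  proof -
    have "indep_vars (\<lambda>_. borel) Y {i, j}" using that by (intro indep_vars_subset[OF indep]) auto
    then have "indep_vars (\<lambda>_. borel) (\<lambda>i \<omega>. indicator B (Y i \<omega>) - q) {i, j}"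
      by (rule indep_vars_compose2) measurable
    then have "indep_vars (\<lambda>_. borel) X {i, j}" by (simp add: X_def[abs_def])
    then have "expectation (\<lambda>\<omega>. \<Prod>l\<in>{i,j}. X l \<omega>) = (\<Prod>l\<in>{i,j}. expectation (X l))"
      using that X_int by (intro indep_vars_lebesgue_integral) auto
    then show ?thesis using that X_mean by simp
  qed
  define f where "f \<omega> = (\<Sum>i\<in>{1..n}. X i \<omega>)" for \<omega>
  have f_meas [measurable]: "f \<in> borel_measurable M" unfolding f_def using X_meas by measurable
  have f_sq: "(f \<omega>)\<^sup>2 = (\<Sum>i\<in>{1..n}. \<Sum>j\<in>{1..n}. X i \<omega> * X j \<omega>)" for \<omega>
    by (simp add: f_def power2_eq_square sum_product)
  have f_sq_int: "integrable M (\<lambda>\<omega>. (f \<omega>)\<^sup>2)"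
    unfolding f_sq using XX_int by (intro Bochner_Integration.integrable_sum) auto
  have f_mean: "expectation f = 0"
    unfolding f_def using X_int X_mean by (subst Bochner_Integration.integral_sum) auto
  have "expectation (\<lambda>\<omega>. (f \<omega>)\<^sup>2) = (\<Sum>i\<in>{1..n}. \<Sum>j\<in>{1..n}. expectation (\<lambda>\<omega>. X i \<omega> * X j \<omega>))"
    unfolding f_sq using XX_int
    by (subst Bochner_Integration.integral_sum, auto intro!: Bochner_Integration.integrable_sum)+
  also have "\<dots> \<le> (\<Sum>i\<in>{1..n}. q)"
  proof (rule sum_mono)
    fix i assume i: "i \<in> {1..n}"
    have "(\<Sum>j\<in>{1..n}. expectation (\<lambda>\<omega>. X i \<omega> * X j \<omega>)) = (\<Sum>j\<in>{i}. expectation (\<lambda>\<omega>. X i \<omega> * X j \<omega>))"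
      using uncorr[OF i] i by (intro sum.mono_neutral_right) auto
    then show "(\<Sum>j\<in>{1..n}. expectation (\<lambda>\<omega>. X i \<omega> * X j \<omega>)) \<le> q" using X_var[OF i] by simp
  qed
  finally have f_var: "variance f \<le> real n * q" by (simp add: f_mean)
  have f_eq: "f \<omega> = cnt \<omega> - real n * q" for \<omega>
  proof -
    have "real (card {i\<in>{1..n}. Y i \<omega> \<in> B}) = (\<Sum>i\<in>{1..n}. indicator B (Y i \<omega>))"
      by (simp add: indicator_def sum.If_cases Int_def)
    then show ?thesis by (simp add: f_def X_def cnt_def sum_subtractf)
  qed
  show "{\<omega>\<in>space M. s \<le> \<bar>cnt \<omega> - real n * measure \<mu> B\<bar>} \<in> events"
    unfolding q_def[symmetric] f_eq[symmetric] by measurable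
  have "prob {\<omega>\<in>space M. s \<le> \<bar>f \<omega> - expectation f\<bar>} \<le> variance f / s\<^sup>2"
    using f_meas f_sq_int \<open>s > 0\<close> by (rule Chebyshev_inequality)
  also have "\<dots> \<le> real n * q / s\<^sup>2" using f_var by (simp add: divide_right_mono)
  finally show "prob {\<omega>\<in>space M. s \<le> \<bar>cnt \<omega> - real n * measure \<mu> B\<bar>} \<le> real n * measure \<mu> B / s\<^sup>2"
    by (simp add: f_mean f_eq q_def)
qed

text \<open>
  Whatever the centre \<open>c\<close> is, one of the two separated groups lies at distance at least half the gap from
  it, and each group makes up at least one sixteenth of the values.
\<close>
lemma variance_ge_separated:
  fixes l :: "nat \<Rightarrow> real"
  assumes k: "k \<ge> 2" and \<alpha>: "\<And>j. real k / 2 \<le> real j \<Longrightarrow> j < k \<Longrightarrow> l j \<le> \<alpha>"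
    and \<beta>: "\<And>j. real j < real k / 16 \<Longrightarrow> \<beta> \<le> l j" and "\<alpha> \<le> \<beta>"
  shows "((\<beta> - \<alpha>) / 8)\<^sup>2 \<le> (1 / real k) * (\<Sum>j<k. (l j - c)\<^sup>2)"
proof -
  define g where "g = (\<beta> - \<alpha>) / 2"
  have g: "g \<ge> 0" using assms by (simp add: g_def)
  have *: "real k / 16 * g\<^sup>2 \<le> (\<Sum>j<k. (l j - c)\<^sup>2)"
    if J: "J \<subseteq> {..<k}" "real k / 16 \<le> real (card J)" "\<And>j. j \<in> J \<Longrightarrow> g \<le> \<bar>l j - c\<bar>" for J
  proof -
    have "real k / 16 * g\<^sup>2 \<le> real (card J) * g\<^sup>2" using J by (intro mult_right_mono) auto
    also have "\<dots> = (\<Sum>j\<in>J. g\<^sup>2)" by simp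
    also have "\<dots> \<le> (\<Sum>j\<in>J. (l j - c)\<^sup>2)"
    proof (rule sum_mono)
      fix j assume "j \<in> J"
      then have "g\<^sup>2 \<le> \<bar>l j - c\<bar>\<^sup>2" using J(3) g by (intro power_mono) auto
      then show "g\<^sup>2 \<le> (l j - c)\<^sup>2" by simp
    qed
    also have "\<dots> \<le> (\<Sum>j<k. (l j - c)\<^sup>2)" using J by (intro sum_mono2) auto
    finally show ?thesis .
  qed
  have "real k / 16 * g\<^sup>2 \<le> (\<Sum>j<k. (l j - c)\<^sup>2)"
  proof (cases "c \<ge> (\<alpha> + \<beta>) / 2")
    case True
    show ?thesis
    \<comment> \<open>the indices \<open>j \<ge> k / 2\<close>, at least \<open>k / 16\<close> in number as \<open>k \<ge> 2\<close>\<close>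
    proof (rule * [of "{(k + 1) div 2..<k}"])
      show "real k / 16 \<le> real (card {(k + 1) div 2..<k})" using k by simp
      fix j assume "j \<in> {(k + 1) div 2..<k}"
      then have "l j \<le> \<alpha>" by (intro \<alpha>) auto
      with True have "g \<le> c - l j" by (simp add: g_def field_simps)
      then show "g \<le> \<bar>l j - c\<bar>" by linarith
    qed auto
  next
    case False
    show ?thesis
    \<comment> \<open>the indices \<open>j < k / 16\<close>, rounded up\<close>
    proof (rule * [of "{..<(k + 15) div 16}"])
      show "real k / 16 \<le> real (card {..<(k + 15) div 16})" by simp
      fix j assume "j \<in> {..<(k + 15) div 16}"
      then have "\<beta> \<le> l j" by (intro \<beta>) auto
      with False have "g \<le> l j - c" by (simp add: g_def field_simps)
      then show "g \<le> \<bar>l j - c\<bar>" by linarith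
    qed (use k in auto)
  qed
  then show ?thesis using k by (simp add: g_def field_simps power2_eq_square)
qed

lemma mean_square_about_mean:
  fixes l :: "nat \<Rightarrow> real"
  assumes "k > 0"
  defines "m \<equiv> (1 / real k) * (\<Sum>j<k. l j)"
  shows "(1 / real k) * (\<Sum>j<k. (l j - m)\<^sup>2) = (1 / real k) * (\<Sum>j<k. (l j)\<^sup>2) - m\<^sup>2"
proof -
  have "(\<Sum>j<k. (l j - m)\<^sup>2) = (\<Sum>j<k. (l j)\<^sup>2) - 2 * m * (\<Sum>j<k. l j) + real k * m\<^sup>2"
    by (simp add: power2_diff sum.distrib sum_subtractf sum_distrib_left sum_distrib_right mult_ac)
  moreover have "(\<Sum>j<k. l j) = real k * m" using assms by simp
  ultimately show ?thesis using assms(1) by (simp add: field_simps power2_eq_square)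
qed

section \<open>Stability of the moment estimators under small relative perturbations\<close>

lemma abs_ln_one_plus_le:
  fixes e :: real
  assumes "\<bar>e\<bar> \<le> 1/2"
  shows "\<bar>ln (1 + e)\<bar> \<le> 2 * \<bar>e\<bar>"
proof -
  have "\<bar>ln (1 + e) - e\<bar> \<le> 2 * \<bar>e\<bar>\<^sup>2"
    using abs_ln_one_plus_x_minus_x_bound[OF assms] by simp
  also have "\<dots> \<le> \<bar>e\<bar>"
    using mult_right_mono[OF assms, of "2 * \<bar>e\<bar>"] by (simp add: power2_eq_square)
  finally show ?thesis by linarith
qed

text \<open>
  The relative error of an observation becomes an additive error of at most twice its size in the
  logarithm, and a log-excess involves two observations, hence the factor \<open>4\<close>.
\<close>
lemma log_moment_perturb:
  assumes "0 < k" "k < n" and pos: "order_stat (sample n y) (n - k) > 0"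
    and D: "\<And>j. j \<le> k \<Longrightarrow> \<bar>order_stat (sample n y') (n - j) / order_stat (sample n y) (n - j) - 1\<bar> \<le> D"
    and "D \<le> 1/2"
  shows "\<bar>log_moment 1 k (sample n y') - log_moment 1 k (sample n y)\<bar> \<le> 4 * D"
    and "\<bar>log_moment 2 k (sample n y') - log_moment 2 k (sample n y)\<bar>
           \<le> 4 * D * (2 * log_moment 1 k (sample n y) + 4 * D)"
    and "log_moment 1 k (sample n y) \<ge> 0"
proof -
  define x where "x j = order_stat (sample n y) (n - j)" for j
  define x' where "x' j = order_stat (sample n y') (n - j)" for j
  define l where "l j = ln (x j) - ln (x k)" for j
  define l' where "l' j = ln (x' j) - ln (x' k)" for j
  have D0: "D \<ge> 0" using D[of 0] by linarith
  have x: "x k \<le> x j" "x j > 0" if "j \<le> k" for j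
    using order_stat_sample_mono[OF that \<open>k < n\<close>, of y] pos by (auto simp: x_def)
  have ln_x': "\<bar>ln (x' j) - ln (x j)\<bar> \<le> 2 * D" if "j \<le> k" for j
  proof -
    define e where "e = x' j / x j - 1"
    have e: "\<bar>e\<bar> \<le> D" using D[OF that] by (simp add: e_def x_def x'_def)
    have "ln (1 + e) = ln (x' j) - ln (x j)"
    proof -
      have "x' j / x j = 1 + e" by (simp add: e_def)
      moreover have "1 + e > 0" using e \<open>D \<le> 1/2\<close> by linarith
      ultimately have "0 < x' j / x j" by linarith
      then have "x' j > 0" using x(2)[OF that] by (simp add: zero_less_divide_iff)
      then show ?thesis using x(2)[OF that] by (simp add: e_def ln_div)
    qed
    then show ?thesis using abs_ln_one_plus_le[of e] e \<open>D \<le> 1/2\<close> by linarith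
  qed
  have l: "l j \<ge> 0" if "j < k" for j using x[of j] x[of k] that by (simp add: l_def)
  have ll: "\<bar>l' j - l j\<bar> \<le> 4 * D" if "j < k" for j
    using ln_x'[of j] ln_x'[of k] that unfolding l_def l'_def by linarith
  have mom: "log_moment i k (sample n y) = (1 / real k) * (\<Sum>j<k. l j ^ i)"
            "log_moment i k (sample n y') = (1 / real k) * (\<Sum>j<k. l' j ^ i)" for i
    by (simp_all add: log_moment_def l_def l'_def x_def x'_def)
  have "\<bar>\<Sum>j<k. l' j - l j\<bar> \<le> (\<Sum>j<k. 4 * D)"
    using ll by (intro order.trans[OF sum_abs] sum_mono) auto
  then show "\<bar>log_moment 1 k (sample n y') - log_moment 1 k (sample n y)\<bar> \<le> 4 * D"
    using \<open>0 < k\<close> by (simp add: mom sum_subtractf diff_divide_distrib[symmetric] divide_le_eq mult.commute)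
  have "\<bar>l' j ^ 2 - l j ^ 2\<bar> \<le> 4 * D * (2 * l j + 4 * D)" if "j < k" for j
  proof -
    have "\<bar>l' j ^ 2 - l j ^ 2\<bar> = \<bar>l' j - l j\<bar> * \<bar>l' j + l j\<bar>"
      by (simp add: power2_eq_square abs_mult[symmetric] algebra_simps)
    also have "\<dots> \<le> 4 * D * (2 * l j + 4 * D)"
      using ll[OF that] l[OF that] D0 by (intro mult_mono) auto
    finally show ?thesis .
  qed
  then have "\<bar>\<Sum>j<k. l' j ^ 2 - l j ^ 2\<bar> \<le> (\<Sum>j<k. 4 * D * (2 * l j + 4 * D))"
    by (intro order.trans[OF sum_abs] sum_mono) auto
  also have "\<dots> = 4 * D * (2 * (\<Sum>j<k. l j) + real k * (4 * D))"
    by (simp add: sum_distrib_left[symmetric] sum.distrib)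
  also have "\<dots> = (4 * D * (2 * log_moment 1 k (sample n y) + 4 * D)) * real k"
    using \<open>0 < k\<close> by (simp add: mom field_simps)
  finally show "\<bar>log_moment 2 k (sample n y') - log_moment 2 k (sample n y)\<bar>
      \<le> 4 * D * (2 * log_moment 1 k (sample n y) + 4 * D)"
    using \<open>0 < k\<close> by (simp add: mom(1)[of 2] mom(2)[of 2] sum_subtractf diff_divide_distrib[symmetric] divide_le_eq)
  show "log_moment 1 k (sample n y) \<ge> 0"
    unfolding mom using l by (intro mult_nonneg_nonneg sum_nonneg) auto
qed

text \<open>
  The map \<open>(m\<^sub>1, m\<^sub>2) \<mapsto> m\<^sub>2 / (2 (m\<^sub>2 - m\<^sub>1\<^sup>2))\<close>, which is \<open>1 - \<gamma>\<^sub>-\<close>, is Lipschitz where \<open>m\<^sub>2\<close> is bounded and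
  the variance is bounded below. The smallness condition on \<open>\<delta>\<close> ensures that the perturbed variance
  loses at most half of its lower bound.
\<close>
lemma shape_stable:
  fixes m1 m2 m1' m2' C \<delta> :: real
  assumes C: "C \<ge> 1" "m2 \<le> C" "1 \<le> C * (m2 - m1\<^sup>2)" and "m1 \<ge> 0" "\<delta> \<ge> 0" "18 * C\<^sup>2 * \<delta> \<le> 1"
    and d1: "\<bar>m1' - m1\<bar> \<le> \<delta>" and d2: "\<bar>m2' - m2\<bar> \<le> \<delta> * (2 * m1 + \<delta>)"
  shows "m1 \<le> C" "m2 - m1\<^sup>2 > 0" "m2' - m1'\<^sup>2 > 0"
    and "0 \<le> m2 / (2 * (m2 - m1\<^sup>2))" "m2 / (2 * (m2 - m1\<^sup>2)) \<le> C\<^sup>2"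
    and "\<bar>m2' / (2 * (m2' - m1'\<^sup>2)) - m2 / (2 * (m2 - m1\<^sup>2))\<bar> \<le> 9 * C ^ 4 * \<delta>"
proof -
  define v where "v = m2 - m1\<^sup>2"
  define v' where "v' = m2' - m1'\<^sup>2"
  have v: "1 / C \<le> v" using C by (simp add: v_def divide_le_eq mult.commute)
  have "1 / C > 0" using C by simp
  with v have v0: "v > 0" by linarith
  have m2: "m1\<^sup>2 \<le> m2" "v \<le> C" using v0 C by (auto simp: v_def) (smt (verit) zero_le_power2)
  have "C * 1 \<le> C * C" using C by (intro mult_left_mono) auto
  then have "m1\<^sup>2 \<le> C\<^sup>2" using m2 C unfolding power2_eq_square by linarith
  moreover have "0 \<le> C" using C by linarith
  ultimately show m1: "m1 \<le> C" by (rule power2_le_imp_le)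
  have "1 \<le> C\<^sup>2" using C(1) by (rule one_le_power)
  then have "1 * (18 * \<delta>) \<le> C\<^sup>2 * (18 * \<delta>)" using \<open>\<delta> \<ge> 0\<close> by (intro mult_right_mono) auto
  then have "18 * \<delta> \<le> 18 * C\<^sup>2 * \<delta>" by (simp only: mult_ac mult_1)
  then have \<delta>1: "\<delta> \<le> 1" using assms(6) by simp
  have "2 * m1 + \<delta> \<le> 3 * C" using m1 \<delta>1 C by linarith
  from mult_left_mono[OF this \<open>\<delta> \<ge> 0\<close>]
  have s: "\<delta> * (2 * m1 + \<delta>) \<le> 3 * C * \<delta>" by (simp only: mult_ac)
  have e2: "\<bar>m2' - m2\<bar> \<le> 3 * C * \<delta>" using d2 s by linarith
  have "\<bar>m1'\<^sup>2 - m1\<^sup>2\<bar> = \<bar>m1' - m1\<bar> * \<bar>m1' + m1\<bar>"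
    by (simp add: power2_eq_square abs_mult[symmetric] algebra_simps)
  also have "\<dots> \<le> \<delta> * (2 * m1 + \<delta>)" using d1 \<open>m1 \<ge> 0\<close> \<open>\<delta> \<ge> 0\<close> by (intro mult_mono) auto
  finally have e1: "\<bar>m1'\<^sup>2 - m1\<^sup>2\<bar> \<le> 3 * C * \<delta>" using s by linarith
  have ev: "\<bar>v' - v\<bar> \<le> 6 * C * \<delta>" using e1 e2 unfolding v_def v'_def by linarith
  have "C * (6 * C * \<delta>) \<le> 1/2" using assms(6) \<open>\<delta> \<ge> 0\<close> by (simp add: power2_eq_square mult_ac)
  then have "6 * C * \<delta> \<le> 1 / (2 * C)" using C by (simp add: field_simps)
  moreover have "1 / C = 1 / (2 * C) + 1 / (2 * C)" by simp
  ultimately have v': "1 / (2 * C) \<le> v'" using ev v by linarith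
  have "1 / (2 * C) > 0" using C by simp
  with v' have v'0: "v' > 0" by linarith
  show "m2 - m1\<^sup>2 > 0" "m2' - m1'\<^sup>2 > 0" using v0 v'0 by (simp_all add: v_def v'_def)
  have m20: "m2 \<ge> 0" using m2(1) by (smt (verit) zero_le_power2)
  then show "0 \<le> m2 / (2 * (m2 - m1\<^sup>2))" using v0 by (simp add: v_def)
  have "m2 / (2 * v) \<le> C / (2 * (1 / C))" using v m20 C by (intro frac_le) auto
  also have "\<dots> \<le> C\<^sup>2" by (simp add: power2_eq_square)
  finally show "m2 / (2 * (m2 - m1\<^sup>2)) \<le> C\<^sup>2" by (simp add: v_def)
  have eq: "m2' / (2 * v') - m2 / (2 * v) = ((m2' - m2) * v - m2 * (v' - v)) / (2 * v * v')"
    using v0 v'0 by (simp add: field_simps)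
  have "\<bar>(m2' - m2) * v - m2 * (v' - v)\<bar> \<le> \<bar>m2' - m2\<bar> * v + m2 * \<bar>v' - v\<bar>"
    using v0 m20 abs_triangle_ineq4[of "(m2' - m2) * v" "m2 * (v' - v)"] by (simp add: abs_mult)
  also have "\<dots> \<le> (3 * C * \<delta>) * C + C * (6 * C * \<delta>)"
    using e2 ev m2 C v0 m20 \<open>\<delta> \<ge> 0\<close> by (intro add_mono mult_mono) auto
  finally have num: "\<bar>(m2' - m2) * v - m2 * (v' - v)\<bar> \<le> 9 * C\<^sup>2 * \<delta>"
    by (simp add: power2_eq_square mult_ac)
  have "1 / C * (1 / (2 * C)) \<le> v * v'" using v v' C v0 by (intro mult_mono) auto
  then have den: "1 / C\<^sup>2 \<le> 2 * v * v'" by (simp add: power2_eq_square)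
  have "\<bar>m2' / (2 * v') - m2 / (2 * v)\<bar> = \<bar>(m2' - m2) * v - m2 * (v' - v)\<bar> / (2 * v * v')"
    unfolding eq using v0 v'0 by (simp add: abs_divide abs_mult)
  also have "\<dots> \<le> (9 * C\<^sup>2 * \<delta>) / (1 / C\<^sup>2)"
    using num den C \<open>\<delta> \<ge> 0\<close> by (intro frac_le) auto
  also have "\<dots> = 9 * C ^ 4 * \<delta>" by (simp add: power4_eq_xxxx power2_eq_square)
  finally show "\<bar>m2' / (2 * (m2' - m1'\<^sup>2)) - m2 / (2 * (m2 - m1\<^sup>2))\<bar> \<le> 9 * C ^ 4 * \<delta>"
    by (simp add: v_def v'_def)
qed

lemma one_minus_gamma_minus:
  assumes "log_moment 2 k y - (log_moment 1 k y)\<^sup>2 > 0"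
  shows "1 - gamma_minus k y = log_moment 2 k y / (2 * (log_moment 2 k y - (log_moment 1 k y)\<^sup>2))"
proof -
  have "log_moment 2 k y > 0" using assms zero_le_power2[of "log_moment 1 k y"] by linarith
  then show ?thesis using assms by (simp add: gamma_minus_def field_simps)
qed

text \<open>
  The only properties of the true sample that enter. The last inequality bounds the variance of the
  log-excesses from below; every parameter is measured on its natural scale, \<open>u\<close> for the threshold
  and \<open>A\<close> for the log-excesses.
\<close>
definition regular_tail :: "real \<Rightarrow> real \<Rightarrow> real \<Rightarrow> nat \<Rightarrow> real list \<Rightarrow> bool" where
  "regular_tail C A u k y \<longleftrightarrow> 1 \<le> C
    \<and> 0 < order_stat y (length y - k) \<and> order_stat y (length y - k) \<le> C * u
    \<and> log_moment 2 k y \<le> C * A\<^sup>2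
    \<and> A\<^sup>2 \<le> C * (log_moment 2 k y - (log_moment 1 k y)\<^sup>2)"

lemma abs_triple_product_diff:
  fixes a b c a' b' c' :: real
  assumes "\<bar>a' - a\<bar> \<le> \<alpha>" "\<bar>b' - b\<bar> \<le> \<beta>" "\<bar>c' - c\<bar> \<le> \<eta>" "\<bar>a\<bar> \<le> A" "\<bar>b\<bar> \<le> B" "\<bar>b'\<bar> \<le> B'" "\<bar>c'\<bar> \<le> C'"
  shows "\<bar>a' * b' * c' - a * b * c\<bar> \<le> \<alpha> * B' * C' + A * \<beta> * C' + A * B * \<eta>"
proof -
  have nn: "\<alpha> \<ge> 0" "\<beta> \<ge> 0" "\<eta> \<ge> 0" "A \<ge> 0" "B \<ge> 0" "B' \<ge> 0" "C' \<ge> 0"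
    using order_trans[OF abs_ge_zero assms(1)] order_trans[OF abs_ge_zero assms(2)]
      order_trans[OF abs_ge_zero assms(3)] order_trans[OF abs_ge_zero assms(4)]
      order_trans[OF abs_ge_zero assms(5)] order_trans[OF abs_ge_zero assms(6)]
      order_trans[OF abs_ge_zero assms(7)] by blast+
  have "\<bar>(a' - a) * b' * c'\<bar> \<le> \<alpha> * B' * C'"
    unfolding abs_mult by (intro mult_mono assms nn mult_nonneg_nonneg abs_ge_zero)
  moreover have "\<bar>a * (b' - b) * c'\<bar> \<le> A * \<beta> * C'"
    unfolding abs_mult by (intro mult_mono assms nn mult_nonneg_nonneg abs_ge_zero)
  moreover have "\<bar>a * b * (c' - c)\<bar> \<le> A * B * \<eta>"
    unfolding abs_mult by (intro mult_mono assms nn mult_nonneg_nonneg abs_ge_zero)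
  moreover have "a' * b' * c' - a * b * c = (a' - a) * b' * c' + a * (b' - b) * c' + a * b * (c' - c)"
    by (simp add: algebra_simps)
  ultimately show ?thesis by linarith
qed

text \<open>
  All quantities are rescaled so that they become bounded: the log-moments by powers of \<open>A\<close>, which
  cancel in \<open>\<gamma>\<^sub>-\<close>, and the scale estimator by \<open>A u\<close>. The exponents of \<open>C\<close> are generous; only their
  independence of the sample matters.
\<close>
lemma estimators_stable:
  assumes k: "0 < k" "k < n" and reg: "regular_tail C A u k (sample n y)"
    and A: "0 < A" "A \<le> C" and u: "u > 0" and \<delta>: "0 \<le> \<delta>" "18 * C\<^sup>2 * \<delta> \<le> 1"
    and D: "\<And>j. j \<le> k \<Longrightarrow>
      \<bar>order_stat (sample n y') (n - j) / order_stat (sample n y) (n - j) - 1\<bar> \<le> A * \<delta> / 4"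
  shows "\<bar>gamma_moment k (sample n y') - gamma_moment k (sample n y)\<bar> \<le> 15 * C ^ 6 * \<delta>"
    and "\<bar>(order_stat (sample n y') (n - k) - order_stat (sample n y) (n - k)) / (A * u)\<bar> \<le> 15 * C ^ 6 * \<delta>"
    and "\<bar>(sigma_moment k (sample n y') - sigma_moment k (sample n y)) / (A * u)\<bar> \<le> 15 * C ^ 6 * \<delta>"
    and "\<bar>sigma_moment k (sample n y) / (A * u)\<bar> \<le> C ^ 4"
proof -
  define x where "x = order_stat (sample n y) (n - k)"
  define x' where "x' = order_stat (sample n y') (n - k)"
  define M1 where "M1 = log_moment 1 k (sample n y)"
  define M2 where "M2 = log_moment 2 k (sample n y)"
  define M1' where "M1' = log_moment 1 k (sample n y')"
  define M2' where "M2' = log_moment 2 k (sample n y')"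
  have C: "C \<ge> 1" and x: "x > 0" "x \<le> C * u" and M2: "M2 \<le> C * A\<^sup>2" "A\<^sup>2 \<le> C * (M2 - M1\<^sup>2)"
    using reg by (auto simp: regular_tail_def x_def M1_def M2_def)
  have pw: "1 \<le> C ^ i" "C ^ i \<le> C ^ j" if "i \<le> j" for i j using C that by (auto intro: power_increasing)
  have "18 * C\<^sup>2 * \<delta> = C * (18 * (C * \<delta>))" by (simp add: power2_eq_square)
  moreover have "1 * (18 * (C * \<delta>)) \<le> C * (18 * (C * \<delta>))" using C \<delta> by (intro mult_right_mono) auto
  ultimately have C\<delta>: "18 * (C * \<delta>) \<le> 1" using \<delta> by linarith
  have \<delta>1: "\<delta> \<le> 1" using C\<delta> C \<delta> mult_right_mono[of 1 C \<delta>] by linarith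
  have A\<delta>: "A * \<delta> \<le> C * \<delta>" using A \<delta> by (intro mult_right_mono)
  then have half: "A * \<delta> / 4 \<le> 1/2" using C\<delta> by linarith
  note pert = log_moment_perturb[OF k x(1)[unfolded x_def] D half]
  define m1 where "m1 = M1 / A"
  define m2 where "m2 = M2 / A\<^sup>2"
  define m1' where "m1' = M1' / A"
  define m2' where "m2' = M2' / A\<^sup>2"
  have Mm: "M1 = A * m1" "M1' = A * m1'" "M2 = A\<^sup>2 * m2" "M2' = A\<^sup>2 * m2'"
    using A by (simp_all add: m1_def m1'_def m2_def m2'_def)
  have p1: "\<bar>M1' - M1\<bar> \<le> A * \<delta>" using pert(1) by (simp add: M1_def M1'_def)
  have d1: "\<bar>m1' - m1\<bar> \<le> \<delta>"
    using p1 A unfolding Mm right_diff_distrib[symmetric] abs_mult by simp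
  have "\<bar>M2' - M2\<bar> \<le> A * \<delta> * (2 * M1 + A * \<delta>)" using pert(2) by (simp add: M1_def M2_def M2'_def)
  also have "\<dots> = A\<^sup>2 * (\<delta> * (2 * m1 + \<delta>))" by (simp add: Mm power2_eq_square algebra_simps)
  finally have d2: "\<bar>m2' - m2\<bar> \<le> \<delta> * (2 * m1 + \<delta>)"
    using A unfolding Mm right_diff_distrib[symmetric] abs_mult by simp
  have m10: "m1 \<ge> 0" using pert(3) A by (simp add: m1_def M1_def)
  have m2C: "m2 \<le> C" using M2(1) A by (simp add: m2_def divide_le_eq)
  have "A\<^sup>2 * 1 \<le> A\<^sup>2 * (C * (m2 - m1\<^sup>2))" using M2(2) by (simp add: Mm power_mult_distrib algebra_simps)
  then have vC: "1 \<le> C * (m2 - m1\<^sup>2)" using A by (simp only: mult_le_cancel_left_pos zero_less_power)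
  note st = shape_stable[OF C m2C vC m10 \<delta> d1 d2]
  define W where "W = m2 / (2 * (m2 - m1\<^sup>2))"
  define W' where "W' = m2' / (2 * (m2' - m1'\<^sup>2))"
  have W: "1 - gamma_minus k (sample n y) = W"
  proof -
    have v: "M2 - M1\<^sup>2 = A\<^sup>2 * (m2 - m1\<^sup>2)" by (simp add: Mm power_mult_distrib algebra_simps)
    with st(2) A have "M2 - M1\<^sup>2 > 0" by simp
    then have "1 - gamma_minus k (sample n y) = M2 / (2 * (M2 - M1\<^sup>2))"
      using one_minus_gamma_minus[of k "sample n y"] by (simp add: M1_def M2_def)
    also have "\<dots> = (A\<^sup>2 * m2) / (2 * (A\<^sup>2 * (m2 - m1\<^sup>2)))" by (simp only: v[symmetric] Mm(3)[symmetric])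
    also have "\<dots> = W" unfolding W_def using A by simp
    finally show ?thesis .
  qed
  have W': "1 - gamma_minus k (sample n y') = W'"
  proof -
    have v: "M2' - M1'\<^sup>2 = A\<^sup>2 * (m2' - m1'\<^sup>2)" by (simp add: Mm power_mult_distrib algebra_simps)
    with st(3) A have "M2' - M1'\<^sup>2 > 0" by simp
    then have "1 - gamma_minus k (sample n y') = M2' / (2 * (M2' - M1'\<^sup>2))"
      using one_minus_gamma_minus[of k "sample n y'"] by (simp add: M1'_def M2'_def)
    also have "\<dots> = (A\<^sup>2 * m2') / (2 * (A\<^sup>2 * (m2' - m1'\<^sup>2)))" by (simp only: v[symmetric] Mm(4)[symmetric])
    also have "\<dots> = W'" unfolding W'_def using A by simp
    finally show ?thesis .
  qed
  have dW: "\<bar>W' - W\<bar> \<le> 9 * C ^ 4 * \<delta>" and WC: "0 \<le> W" "W \<le> C\<^sup>2"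
    using st by (simp_all add: W_def W'_def)
  have "\<bar>gamma_moment k (sample n y') - gamma_moment k (sample n y)\<bar> \<le> \<bar>M1' - M1\<bar> + \<bar>W' - W\<bar>"
    using W W' unfolding gamma_moment_def gamma_plus_def M1_def[symmetric] M1'_def[symmetric] by linarith
  also have "\<dots> \<le> C * \<delta> + 9 * C ^ 4 * \<delta>" using p1 A\<delta> dW by linarith
  also have "\<dots> \<le> C ^ 6 * \<delta> + 9 * C ^ 6 * \<delta>"
    using pw(2)[of 1 6] pw(2)[of 4 6] \<delta> by (intro add_mono mult_right_mono) auto
  also have "\<dots> \<le> 15 * C ^ 6 * \<delta>" using C \<delta> by simp
  finally show "\<bar>gamma_moment k (sample n y') - gamma_moment k (sample n y)\<bar> \<le> 15 * C ^ 6 * \<delta>" .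
  define \<tau> where "\<tau> = x / u"
  define \<tau>' where "\<tau>' = x' / u"
  have \<tau>: "0 \<le> \<tau>" "\<tau> \<le> C" using x u by (auto simp: \<tau>_def divide_le_eq)
  have "\<bar>x' / x - 1\<bar> \<le> A * \<delta> / 4" using D[of k] by (simp add: x_def x'_def)
  moreover have "\<tau>' - \<tau> = \<tau> * (x' / x - 1)" using x u by (simp add: \<tau>_def \<tau>'_def field_simps)
  moreover have "\<tau> * \<bar>x' / x - 1\<bar> \<le> C * (A * \<delta> / 4)"
    using calculation(1) \<tau> C by (intro mult_mono) auto
  ultimately have d\<tau>: "\<bar>\<tau>' - \<tau>\<bar> \<le> C * (A * \<delta> / 4)"
    using \<tau>(1) by (simp add: abs_mult)
  have "\<bar>(x' - x) / (A * u)\<bar> = \<bar>\<tau>' - \<tau>\<bar> / A"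
    using A u by (simp add: \<tau>_def \<tau>'_def diff_divide_distrib[symmetric] abs_divide abs_mult)
  also have "\<dots> \<le> C * (A * \<delta> / 4) / A" using d\<tau> A by (intro divide_right_mono) auto
  also have "\<dots> \<le> C ^ 1 * \<delta>" using A C \<delta> by (simp add: field_simps)
  also have "\<dots> \<le> C ^ 6 * \<delta>" using \<delta> by (intro mult_right_mono pw(2)) auto
  also have "\<dots> \<le> 15 * C ^ 6 * \<delta>" using C \<delta> by simp
  finally show "\<bar>(order_stat (sample n y') (n - k) - order_stat (sample n y) (n - k)) / (A * u)\<bar> \<le> 15 * C ^ 6 * \<delta>"
    by (simp add: x_def x'_def)
  have sig: "sigma_moment k (sample n y) / (A * u) = \<tau> * m1 * W"
    using A u W by (simp add: sigma_moment_def \<tau>_def m1_def M1_def x_def)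
  have sig': "sigma_moment k (sample n y') / (A * u) = \<tau>' * m1' * W'"
    using A u W' by (simp add: sigma_moment_def \<tau>'_def m1'_def M1'_def x'_def)
  have m1C: "m1 \<le> C" by (rule st(1))
  have "\<tau> * m1 * W \<le> C * C * C\<^sup>2" using \<tau> m10 m1C WC C by (intro mult_mono) auto
  moreover have "\<tau> * m1 * W \<ge> 0" using \<tau> m10 WC by simp
  ultimately show "\<bar>sigma_moment k (sample n y) / (A * u)\<bar> \<le> C ^ 4"
    unfolding sig by (simp add: power4_eq_xxxx power2_eq_square mult_ac)
  have "9 * C ^ 4 * \<delta> = (18 * C\<^sup>2 * \<delta>) * (C\<^sup>2 / 2)" by (simp add: power4_eq_xxxx power2_eq_square)
  also have "\<dots> \<le> 1 * (C\<^sup>2 / 2)" using \<delta> by (intro mult_right_mono) auto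
  finally have W'C: "\<bar>W'\<bar> \<le> 2 * C\<^sup>2" using dW WC pw(1)[of 2] by linarith
  have m1'C: "\<bar>m1'\<bar> \<le> 2 * C" using d1 m10 m1C \<delta>1 C by linarith
  have d\<tau>2: "\<bar>\<tau>' - \<tau>\<bar> \<le> C\<^sup>2 * \<delta>"
  proof -
    have "0 \<le> C * \<delta>" using C \<delta> by simp
    then have "A * \<delta> / 4 \<le> C * \<delta>" using A\<delta> by linarith
    then have "C * (A * \<delta> / 4) \<le> C * (C * \<delta>)" using C by (intro mult_left_mono) auto
    then show ?thesis using d\<tau> by (simp add: power2_eq_square mult_ac)
  qed
  have "\<bar>(sigma_moment k (sample n y') - sigma_moment k (sample n y)) / (A * u)\<bar>
      = \<bar>\<tau>' * m1' * W' - \<tau> * m1 * W\<bar>"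
    by (simp add: diff_divide_distrib sig sig')
  also have "\<dots> \<le> (C\<^sup>2 * \<delta>) * (2 * C) * (2 * C\<^sup>2) + C * \<delta> * (2 * C\<^sup>2) + C * C * (9 * C ^ 4 * \<delta>)"
    using \<tau> m10 m1C by (intro abs_triple_product_diff d\<tau>2 d1 dW W'C m1'C) auto
  also have "\<dots> = 4 * (C ^ 5 * \<delta>) + 2 * (C ^ 3 * \<delta>) + 9 * (C ^ 6 * \<delta>)"
    by (simp add: eval_nat_numeral algebra_simps)
  also have "\<dots> \<le> 4 * (C ^ 6 * \<delta>) + 2 * (C ^ 6 * \<delta>) + 9 * (C ^ 6 * \<delta>)"
    using \<delta> by (intro add_mono mult_left_mono mult_right_mono pw(2)) auto
  also have "\<dots> = 15 * C ^ 6 * \<delta>" by linarith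
  finally show "\<bar>(sigma_moment k (sample n y') - sigma_moment k (sample n y)) / (A * u)\<bar> \<le> 15 * C ^ 6 * \<delta>"
    .
qed

lemma le_mult_mono:
  fixes s :: real
  assumes "s \<le> C * v" "C \<le> C'" "0 \<le> v"
  shows "s \<le> C' * v"
  using assms mult_right_mono[of C C' v] by linarith

text \<open>
  The variance in the last condition is positive, so enlarging \<open>C\<close> weakens all conditions.
\<close>
lemma regular_tail_mono:
  assumes "regular_tail C A u k y" "C \<le> C'" "A \<noteq> 0" "u \<ge> 0"
  shows "regular_tail C' A u k y"
proof -
  have v: "log_moment 2 k y - (log_moment 1 k y)\<^sup>2 \<ge> 0"
  proof (rule ccontr)
    assume "\<not> ?thesis"
    moreover have "0 < C * (log_moment 2 k y - (log_moment 1 k y)\<^sup>2)"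
      using assms by (auto simp: regular_tail_def intro: less_le_trans[of 0 "A\<^sup>2"])
    ultimately show False using assms(1) by (auto simp: regular_tail_def zero_less_mult_iff)
  qed
  have "C * u \<le> C' * u" "C * A\<^sup>2 \<le> C' * A\<^sup>2"
    "C * (log_moment 2 k y - (log_moment 1 k y)\<^sup>2) \<le> C' * (log_moment 2 k y - (log_moment 1 k y)\<^sup>2)"
    using assms v by (auto intro: mult_right_mono)
  with assms show ?thesis unfolding regular_tail_def by linarith
qed

section \<open>Stability of the extrapolated quantile\<close>

lemma abs_exp_diff_le:
  fixes u v :: real
  assumes "\<bar>u\<bar> \<le> 1" "\<bar>v\<bar> \<le> 1"
  shows "\<bar>exp u - exp v\<bar> \<le> exp 1 * \<bar>u - v\<bar>"
proof -
  have le: "\<bar>exp y - exp x\<bar> \<le> exp 1 * \<bar>y - x\<bar>" if "x \<le> y" "y \<le> 1" for x y :: real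
  proof -
    have "exp y * (1 + (x - y)) \<le> exp y * exp (x - y)"
      by (intro mult_left_mono exp_ge_add_one_self) auto
    then have "exp y - exp x \<le> exp y * (y - x)"
      by (simp add: exp_add[symmetric] algebra_simps)
    also have "\<dots> \<le> exp 1 * (y - x)" using that by (intro mult_right_mono) auto
    finally show ?thesis using that by simp
  qed
  show ?thesis
    using le[of u v] le[of v u] assms by (cases "u \<le> v") (auto simp: abs_minus_commute)
qed

lemma box_cox_has_integral:
  assumes "1 \<le> c" "c \<le> d"
  shows "((\<lambda>s. s powr (g - 1)) has_integral (box_cox g d - box_cox g c)) {c..d}"
proof (rule fundamental_theorem_of_calculus)
  fix s assume "s \<in> {c..d}"
  then have "s > 0" using assms by auto
  then have "(box_cox g has_real_derivative s powr (g - 1)) (at s)"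
    unfolding box_cox_def
    by (cases "g = 0") (auto intro!: derivative_eq_intros simp: powr_minus_divide powr_diff field_simps)
  then show "(box_cox g has_vector_derivative s powr (g - 1)) (at s within {c..d})"
    by (simp add: has_real_derivative_iff_has_vector_derivative has_vector_derivative_at_within)
qed (use assms in auto)

lemma q_integrand_continuous:
  fixes c d \<gamma> :: real
  assumes "c \<ge> 1"
  shows "continuous_on {c..d} (\<lambda>s. s powr (\<gamma> - 1) * ln s)"
  using assms by (intro continuous_intros) auto

lemma q_fun_has_integral:
  assumes "1 \<le> d"
  shows "((\<lambda>s. s powr (\<gamma> - 1) * ln s) has_integral q_fun \<gamma> d) {1..d}"
proof -
  let ?f = "\<lambda>s::real. s powr (\<gamma> - 1) * ln s"
  have "set_integrable lborel {1..d} ?f"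
    by (intro borel_integrable_atLeastAtMost' q_integrand_continuous) auto
  then have "q_fun \<gamma> d = integral {1..d} ?f"
    unfolding q_fun_def using assms interval_integral_eq_integral[of 1 d ?f] by (simp add: one_ereal_def)
  moreover have "?f integrable_on {1..d}"
    by (intro integrable_continuous_real q_integrand_continuous) auto
  ultimately show ?thesis by (simp add: has_integral_integral)
qed

text \<open>
  Passing from the exponent \<open>\<gamma>\<close> to \<open>g\<close> costs the factor \<open>exp ((g - \<gamma>) ln s)\<close>, which lies between
  \<open>exp (-1)\<close> and \<open>exp 1\<close> for \<open>s \<le> d\<close> if \<open>|g - \<gamma>| ln d \<le> 1\<close>.
\<close>
lemma powr_shift:
  assumes "s \<ge> (1::real)"
  shows "s powr (g - 1) = s powr (\<gamma> - 1) * exp ((g - \<gamma>) * ln s)"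
proof -
  have "s powr (g - 1) = s powr (\<gamma> - 1) * s powr (g - \<gamma>)" by (simp flip: powr_add)
  then show ?thesis using assms by (simp add: powr_def)
qed

lemma abs_mult_ln_le:
  assumes "\<bar>u\<bar> * ln d \<le> 1" "1 \<le> s" "s \<le> d"
  shows "\<bar>u * ln s\<bar> \<le> (1::real)"
proof -
  have "\<bar>u\<bar> * ln s \<le> \<bar>u\<bar> * ln d" using assms by (intro mult_left_mono) auto
  then show ?thesis using assms by (simp add: abs_mult)
qed

text \<open>
  Both transforms are integrals of powers over \<open>[1, d]\<close>; the difference of the integrands at \<open>s\<close> is at
  most \<open>exp 1 |g' - g| ln s\<close> times \<open>s powr (\<gamma> - 1)\<close>, and the integral of the latter product is
  \<open>q_fun \<gamma> d\<close>.
\<close>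
lemma box_cox_diff_le_q_fun:
  assumes "d \<ge> 1" "\<bar>g - \<gamma>\<bar> * ln d \<le> 1" "\<bar>g' - \<gamma>\<bar> * ln d \<le> 1"
  shows "\<bar>box_cox g' d - box_cox g d\<bar> \<le> exp 1 * \<bar>g' - g\<bar> * q_fun \<gamma> d"
proof -
  have 1: "((\<lambda>s. s powr (g' - 1) - s powr (g - 1)) has_integral (box_cox g' d - box_cox g d)) {1..d}"
    using has_integral_diff[OF box_cox_has_integral[of 1 d g'] box_cox_has_integral[of 1 d g]] assms(1)
    by simp
  have 2: "((\<lambda>s. (exp 1 * \<bar>g' - g\<bar>) * (s powr (\<gamma> - 1) * ln s)) has_integral exp 1 * \<bar>g' - g\<bar> * q_fun \<gamma> d) {1..d}"
    using q_fun_has_integral[OF assms(1)] by (rule has_integral_mult_right)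
  have bound: "norm (s powr (g' - 1) - s powr (g - 1)) \<le> (exp 1 * \<bar>g' - g\<bar>) * (s powr (\<gamma> - 1) * ln s)"
    if "s \<in> {1..d}" for s
  proof -
    have s: "1 \<le> s" "s \<le> d" using that by auto
    have "\<bar>exp ((g' - \<gamma>) * ln s) - exp ((g - \<gamma>) * ln s)\<bar> \<le> exp 1 * \<bar>(g' - \<gamma>) * ln s - (g - \<gamma>) * ln s\<bar>"
      using assms s by (intro abs_exp_diff_le abs_mult_ln_le) auto
    also have "(g' - \<gamma>) * ln s - (g - \<gamma>) * ln s = (g' - g) * ln s" by (simp add: algebra_simps)
    finally have "s powr (\<gamma> - 1) * \<bar>exp ((g' - \<gamma>) * ln s) - exp ((g - \<gamma>) * ln s)\<bar>
        \<le> s powr (\<gamma> - 1) * (exp 1 * (\<bar>g' - g\<bar> * ln s))"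
      using s by (intro mult_left_mono) (auto simp: abs_mult)
    moreover have "s powr (g' - 1) - s powr (g - 1)
        = s powr (\<gamma> - 1) * (exp ((g' - \<gamma>) * ln s) - exp ((g - \<gamma>) * ln s))"
      unfolding powr_shift[OF s(1), of g' \<gamma>] powr_shift[OF s(1), of g \<gamma>] by (simp add: algebra_simps)
    ultimately show ?thesis by (simp add: abs_mult mult_ac)
  qed
  have "norm (integral {1..d} (\<lambda>s. s powr (g' - 1) - s powr (g - 1)))
      \<le> integral {1..d} (\<lambda>s. (exp 1 * \<bar>g' - g\<bar>) * (s powr (\<gamma> - 1) * ln s))"
    using 1 2 bound by (intro integral_norm_bound_integral) (auto simp: has_integral_integrable)
  then show ?thesis by (simp only: integral_unique[OF 1] integral_unique[OF 2] real_norm_def)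
qed

lemma box_cox_le_shifted:
  assumes "d \<ge> 1" "\<bar>g - \<gamma>\<bar> * ln d \<le> 1"
  shows "\<bar>box_cox g d\<bar> \<le> exp 1 * box_cox \<gamma> d"
proof -
  have 1: "((\<lambda>s. s powr (g - 1)) has_integral box_cox g d) {1..d}"
    using box_cox_has_integral[of 1 d g] assms(1) by simp
  have "((\<lambda>s. s powr (\<gamma> - 1)) has_integral box_cox \<gamma> d) {1..d}"
    using box_cox_has_integral[of 1 d \<gamma>] assms(1) by simp
  then have 2: "((\<lambda>s. exp 1 * s powr (\<gamma> - 1)) has_integral exp 1 * box_cox \<gamma> d) {1..d}"
    by (rule has_integral_mult_right)
  have bound: "norm (s powr (g - 1)) \<le> exp 1 * s powr (\<gamma> - 1)" if "s \<in> {1..d}" for s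
  proof -
    have s: "1 \<le> s" "s \<le> d" using that by auto
    have "exp ((g - \<gamma>) * ln s) \<le> exp 1"
      using abs_mult_ln_le[OF assms(2) s] by auto
    then have "s powr (\<gamma> - 1) * exp ((g - \<gamma>) * ln s) \<le> s powr (\<gamma> - 1) * exp 1"
      by (intro mult_left_mono) auto
    then show ?thesis
      unfolding powr_shift[OF s(1), of g \<gamma>] by (simp add: mult.commute)
  qed
  have "norm (integral {1..d} (\<lambda>s. s powr (g - 1))) \<le> integral {1..d} (\<lambda>s. exp 1 * s powr (\<gamma> - 1))"
    using 1 2 bound by (intro integral_norm_bound_integral) (auto simp: has_integral_integrable)
  then show ?thesis by (simp only: integral_unique[OF 1] integral_unique[OF 2] real_norm_def)
qed

text \<open>
  Away from \<open>1\<close> the weight \<open>ln s\<close> is bounded below, so the part of the integral over \<open>[2, d]\<close> already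
  dominates a multiple of \<open>box_cox \<gamma> d - box_cox \<gamma> 2\<close>; for \<open>d \<ge> 3\<close> this difference is comparable to
  \<open>box_cox \<gamma> d\<close> and bounded away from zero.
\<close>
lemma q_fun_lower_bounds:
  "\<exists>c>0. \<forall>d\<ge>3. c \<le> q_fun \<gamma> d \<and> c * box_cox \<gamma> d \<le> q_fun \<gamma> d"
proof -
  define b where "b = box_cox \<gamma> 3 - box_cox \<gamma> 2"
  have mono: "box_cox \<gamma> d \<ge> box_cox \<gamma> 3" if "d \<ge> 3" for d
    using box_cox_mult[of 3 "d / 3" \<gamma>] box_cox_pos[of "d / 3" \<gamma>] that
    by (cases "d = 3") (auto intro: mult_nonneg_nonneg)
  have b: "b > 0" using box_cox_mult[of 2 "3/2" \<gamma>] box_cox_pos[of "3/2" \<gamma>] by (simp add: b_def)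
  have B2: "box_cox \<gamma> 2 > 0" by (simp add: box_cox_pos)
  have q: "ln 2 * (box_cox \<gamma> d - box_cox \<gamma> 2) \<le> q_fun \<gamma> d" if d: "d \<ge> 3" for d
  proof -
    have 1: "((\<lambda>s. ln 2 * s powr (\<gamma> - 1)) has_integral (ln 2 * (box_cox \<gamma> d - box_cox \<gamma> 2))) {2..d}"
      using d by (intro has_integral_mult_right box_cox_has_integral) auto
    have int: "(\<lambda>s. s powr (\<gamma> - 1) * ln s) integrable_on {2..d}"
      by (intro integrable_continuous_real q_integrand_continuous) auto
    have 2: "((\<lambda>s. s powr (\<gamma> - 1) * ln s) has_integral q_fun \<gamma> d) {1..d}"
      using d by (intro q_fun_has_integral) auto
    have "ln 2 * (box_cox \<gamma> d - box_cox \<gamma> 2) \<le> integral {2..d} (\<lambda>s. s powr (\<gamma> - 1) * ln s)"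
      using 1 int
    proof (rule has_integral_le[OF _ integrable_integral])
      fix s assume "s \<in> {2..d}"
      then have "ln 2 \<le> ln s" by simp
      then have "ln 2 * s powr (\<gamma> - 1) \<le> ln s * s powr (\<gamma> - 1)" by (intro mult_right_mono) auto
      then show "ln 2 * s powr (\<gamma> - 1) \<le> s powr (\<gamma> - 1) * ln s" by (simp add: mult.commute)
    qed
    also have "\<dots> \<le> integral {1..d} (\<lambda>s. s powr (\<gamma> - 1) * ln s)"
      using int 2 by (intro integral_subset_le) (auto simp: has_integral_integrable)
    also have "\<dots> = q_fun \<gamma> d" using 2 by (simp add: integral_unique)
    finally show ?thesis .
  qed
  define c1 where "c1 = ln 2 * b"
  define c2 where "c2 = ln 2 / (1 + box_cox \<gamma> 2 / b)"
  have pos: "c1 > 0" "c2 > 0" using b B2 by (auto simp: c1_def c2_def intro!: divide_pos_pos add_pos_pos)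
  show ?thesis
  proof (intro exI[of _ "min c1 c2"] conjI allI impI)
    show "min c1 c2 > 0" using pos by simp
    fix d :: real assume d: "d \<ge> 3"
    have db: "b \<le> box_cox \<gamma> d - box_cox \<gamma> 2" using mono[OF d] by (simp add: b_def)
    have "c1 \<le> ln 2 * (box_cox \<gamma> d - box_cox \<gamma> 2)"
      unfolding c1_def using db by (intro mult_left_mono) auto
    then show "min c1 c2 \<le> q_fun \<gamma> d" using q[OF d] by linarith
    have "(box_cox \<gamma> 2 / b) * b \<le> (box_cox \<gamma> 2 / b) * (box_cox \<gamma> d - box_cox \<gamma> 2)"
      using db B2 b by (intro mult_left_mono) auto
    then have "box_cox \<gamma> d \<le> (1 + box_cox \<gamma> 2 / b) * (box_cox \<gamma> d - box_cox \<gamma> 2)"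
      using b by (simp add: distrib_right)
    moreover have "1 + box_cox \<gamma> 2 / b > 0" using b B2 by (intro add_pos_pos divide_pos_pos) auto
    ultimately have "box_cox \<gamma> d / (1 + box_cox \<gamma> 2 / b) \<le> box_cox \<gamma> d - box_cox \<gamma> 2"
      by (simp only: pos_divide_le_eq mult.commute)
    then have "ln 2 * (box_cox \<gamma> d / (1 + box_cox \<gamma> 2 / b)) \<le> ln 2 * (box_cox \<gamma> d - box_cox \<gamma> 2)"
      by (intro mult_left_mono) auto
    then have "c2 * box_cox \<gamma> d \<le> q_fun \<gamma> d" using q[OF d] by (simp add: c2_def)
    moreover have "min c1 c2 * box_cox \<gamma> d \<le> c2 * box_cox \<gamma> d"
      using db b B2 by (intro mult_right_mono) auto
    ultimately show "min c1 c2 * box_cox \<gamma> d \<le> q_fun \<gamma> d" by linarith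
  qed
qed

text \<open>
  The error splits as \<open>\<Delta>T + \<Delta>\<sigma> B' + \<sigma> \<Delta>B\<close>, with \<open>T\<close> the threshold and \<open>B, B'\<close> the two transforms of
  \<open>d\<close>. Relative to \<open>q_fun \<gamma> d\<close>, the threshold and \<open>B'\<close> are controlled by the lower bounds for
  \<open>q_fun\<close>, and \<open>\<Delta>B\<close> by its Lipschitz estimate in the shape parameter.
\<close>
lemma quantile_stable:
  fixes C \<epsilon> b c q :: real
  assumes T: "\<bar>(order_stat y' (length y' - k) - order_stat y (length y - k)) / b\<bar> \<le> \<epsilon>"
    and \<sigma>: "\<bar>(sigma_moment k y' - sigma_moment k y) / b\<bar> \<le> \<epsilon>" "\<bar>sigma_moment k y / b\<bar> \<le> C"
    and g: "\<bar>gamma_moment k y' - gamma_moment k y\<bar> \<le> \<epsilon>"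
    and d: "d \<ge> 1" "d = real k / (real (length y) * p)" "length y' = length y"
    and shift: "\<bar>gamma_moment k y - \<gamma>\<bar> * ln d \<le> 1" "\<bar>gamma_moment k y' - \<gamma>\<bar> * ln d \<le> 1"
    and c: "c > 0" "c \<le> q_fun \<gamma> d" "c * box_cox \<gamma> d \<le> q_fun \<gamma> d"
  shows "\<bar>(quantile_moment k p y' - quantile_moment k p y) / (b * q_fun \<gamma> d)\<bar>
    \<le> (1 / c + exp 1 / c + C * exp 1) * \<epsilon>"
proof -
  define q where "q = q_fun \<gamma> d"
  have q: "q > 0" "c \<le> q" "c * box_cox \<gamma> d \<le> q" using c by (auto simp: q_def)
  have e0: "\<epsilon> \<ge> 0" "C \<ge> 0" using order_trans[OF abs_ge_zero T] order_trans[OF abs_ge_zero \<sigma>(2)] .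
  define B where "B = box_cox (gamma_moment k y) d"
  define B' where "B' = box_cox (gamma_moment k y') d"
  define \<tau> where "\<tau> = (order_stat y' (length y' - k) - order_stat y (length y - k)) / b"
  define s where "s = sigma_moment k y / b"
  define s' where "s' = sigma_moment k y' / b"
  have "\<bar>B'\<bar> \<le> exp 1 * box_cox \<gamma> d"
    unfolding B'_def by (rule box_cox_le_shifted[OF d(1) shift(2)])
  also have "\<dots> \<le> exp 1 * (q / c)" using q c by (intro mult_left_mono) (auto simp: field_simps)
  finally have B': "\<bar>B'\<bar> \<le> exp 1 / c * q" by simp
  have "\<bar>B' - B\<bar> \<le> exp 1 * \<bar>gamma_moment k y' - gamma_moment k y\<bar> * q"
    unfolding B'_def B_def q_def by (rule box_cox_diff_le_q_fun[OF d(1) shift])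
  also have "\<dots> \<le> exp 1 * \<epsilon> * q" using g q by (intro mult_right_mono mult_left_mono) auto
  finally have dB: "\<bar>B' - B\<bar> \<le> exp 1 * \<epsilon> * q" .
  have "(quantile_moment k p y' - quantile_moment k p y) / b = \<tau> + (s' - s) * B' + s * (B' - B)"
    unfolding quantile_moment_def d(3) d(2)[symmetric] \<tau>_def s_def s'_def B_def B'_def
    by (cases "b = 0") (auto simp: field_simps)
  then have "\<bar>(quantile_moment k p y' - quantile_moment k p y) / b\<bar> \<le> \<bar>\<tau>\<bar> + \<bar>(s' - s) * B'\<bar> + \<bar>s * (B' - B)\<bar>"
    by (simp only:)
  also have "\<bar>\<tau>\<bar> + \<bar>(s' - s) * B'\<bar> + \<bar>s * (B' - B)\<bar> \<le> \<epsilon> * (q / c) + \<epsilon> * (exp 1 / c * q) + C * (exp 1 * \<epsilon> * q)"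
  proof (intro add_mono)
    have "\<epsilon> * 1 \<le> \<epsilon> * (q / c)" using q c e0 by (intro mult_left_mono) auto
    then show "\<bar>\<tau>\<bar> \<le> \<epsilon> * (q / c)" using T by (simp add: \<tau>_def)
    have "\<bar>s' - s\<bar> \<le> \<epsilon>" using \<sigma>(1) by (simp add: s_def s'_def diff_divide_distrib)
    then show "\<bar>(s' - s) * B'\<bar> \<le> \<epsilon> * (exp 1 / c * q)"
      unfolding abs_mult using B' e0 by (intro mult_mono) auto
    show "\<bar>s * (B' - B)\<bar> \<le> C * (exp 1 * \<epsilon> * q)"
      unfolding abs_mult using \<sigma>(2) dB e0 by (intro mult_mono) (auto simp: s_def)
  qed
  also have "\<dots> = (1 / c + exp 1 / c + C * exp 1) * \<epsilon> * q" by (simp add: algebra_simps)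
  finally have "\<bar>(quantile_moment k p y' - quantile_moment k p y) / b\<bar> / q \<le> (1 / c + exp 1 / c + C * exp 1) * \<epsilon>"
    by (simp only: pos_divide_le_eq[OF q(1)])
  moreover have "\<bar>(quantile_moment k p y' - quantile_moment k p y) / (b * q)\<bar>
      = \<bar>(quantile_moment k p y' - quantile_moment k p y) / b\<bar> / q"
    using q by (simp add: abs_divide abs_mult)
  ultimately show ?thesis unfolding q_def by (simp only:)
qed

section \<open>Intermediate order statistics of an i.i.d. sample\<close>

locale intermediate_sample = extended_regular_variation U a \<gamma>
  for U a :: "real \<Rightarrow> real" and \<gamma> :: real +
  fixes \<mu> :: "real measure" and M :: "nat \<Rightarrow> 'a measure" and Y :: "nat \<Rightarrow> nat \<Rightarrow> 'a \<Rightarrow> real"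
    and k :: "nat \<Rightarrow> nat"
  assumes distribution: "real_distribution \<mu>" and pos: "AE y in \<mu>. y > 0"
    and U_eq: "U = tail_quantile (cdf \<mu>)"
    and M: "prob_space (M n)"
    and indep: "prob_space.indep_vars (M n) (\<lambda>_. borel) (Y n) {1..n}"
    and copies: "i \<in> {1..n} \<Longrightarrow> distr (M n) borel (Y n i) = \<mu>"
    and k: "n \<ge> 2 \<Longrightarrow> 0 < k n \<and> k n < n"
    and k_inf: "filterlim k at_top sequentially"
    and k_small: "(\<lambda>n. real (k n) / real n) \<longlonglongrightarrow> 0"
begin

definition t :: "nat \<Rightarrow> real" where "t n = real n / real (k n)"

text \<open>
  Numbered downwards, so that \<open>x n \<omega> 0\<close> is the maximum and \<open>x n \<omega> (k n)\<close> the threshold.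
\<close>
definition x :: "nat \<Rightarrow> 'a \<Rightarrow> nat \<Rightarrow> real" where
  "x n \<omega> j = order_stat (sample n (\<lambda>i. Y n i \<omega>)) (n - j)"

lemma Y_measurable: "i \<in> {1..n} \<Longrightarrow> Y n i \<in> borel_measurable (M n)"
  using indep[of n] unfolding prob_space.indep_vars_def[OF M] by simp

lemma eventually_k: "\<forall>\<^sub>F n in sequentially. n \<ge> 2 \<and> 0 < k n \<and> k n < n"
  using eventually_ge_at_top[of 2] by eventually_elim (use k in auto)

lemma t_at_top: "filterlim t at_top sequentially"
proof -
  have "filterlim (\<lambda>n. inverse (real (k n) / real n)) at_top sequentially"
    using k_small by (rule filterlim_inverse_at_top)
      (use eventually_k in \<open>eventually_elim, auto\<close>)
  then show ?thesis by (simp add: t_def[abs_def])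
qed

lemma eventually_t: "eventually P at_top \<Longrightarrow> \<forall>\<^sub>F n in sequentially. P (t n)"
  using t_at_top by (simp add: filterlim_iff)

lemma over_k_tendsto_0: "(\<lambda>n. c / real (k n)) \<longlonglongrightarrow> 0"
  by (intro tendsto_divide_0[OF tendsto_const] filterlim_at_top_imp_at_infinity
      filterlim_compose[OF filterlim_real_sequentially k_inf])

text \<open>
  The expected number of observations at or above \<open>U (t c)\<close> is at least \<open>k / c\<close>, and with high
  probability at least half of the expected number occurs.
\<close>
lemma order_stats_above:
  assumes c: "c > 0"
  shows "bounded_whp M (\<lambda>C n \<omega>. \<forall>j. real j \<le> real (k n) / (2 * c) \<longrightarrow> j < n \<longrightarrow> U (t n * c) \<le> x n \<omega> j)"
proof -
  define q where "q n = measure \<mu> {U (t n * c)..}" for n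
  define cnt where "cnt n \<omega> = real (card {i\<in>{1..n}. Y n i \<omega> \<in> {U (t n * c)..}})" for n \<omega>
  define B where "B n = {\<omega>\<in>space (M n). real n * q n / 2 \<le> \<bar>cnt n \<omega> - real n * q n\<bar>}" for n
  have large: "\<forall>\<^sub>F n in sequentially. t n * c > 1"
    using eventually_t[OF eventually_gt_at_top[of "1 / c"]]
    by eventually_elim (use c in \<open>simp add: divide_less_eq\<close>)
  have q: "\<forall>\<^sub>F n in sequentially. real (k n) / c \<le> real n * q n"
    using large eventually_k
  proof eventually_elim
    case (elim n)
    have "1 / (t n * c) \<le> q n" unfolding q_def U_eq
      by (intro measure_ge_tail_quantile distribution) (use elim in auto)
    then have "real n * (1 / (t n * c)) \<le> real n * q n" by (intro mult_left_mono) auto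
    then show ?case using elim by (simp add: t_def)
  qed
  show ?thesis
  proof (rule bounded_whp_tendsto[where B=B and e="\<lambda>n. 4 * c / real (k n)"])
    show "\<forall>\<^sub>F n in sequentially. B n \<in> sets (M n) \<and> measure (M n) (B n) \<le> 4 * c / real (k n)"
      using q eventually_k
    proof eventually_elim
      case (elim n)
      interpret prob_space "M n" by (rule M)
      have kc: "real (k n) / c > 0" using elim c by simp
      with elim have nq: "real n * q n > 0" by linarith
      have ch: "B n \<in> events" "prob (B n) \<le> real n * q n / (real n * q n / 2)\<^sup>2"
        using nq unfolding B_def cnt_def q_def
        by (intro chebyshev_count indep copies; simp)+
      note ch(2)
      also have "\<dots> = 4 / (real n * q n)" using nq by (simp add: power2_eq_square)
      also have "\<dots> \<le> 4 / (real (k n) / c)" using elim(1) by (intro divide_left_mono mult_pos_pos[OF nq kc]) auto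
      finally have "prob (B n) \<le> 4 * c / real (k n)" by simp
      with ch(1) show ?case by blast
    qed
    show "\<forall>\<^sub>F n in sequentially. \<forall>\<omega>\<in>space (M n). \<omega> \<notin> B n \<longrightarrow>
        (\<forall>j. real j \<le> real (k n) / (2 * c) \<longrightarrow> j < n \<longrightarrow> U (t n * c) \<le> x n \<omega> j)"
      using q
    proof eventually_elim
      case (elim n)
      show ?case
      proof (intro ballI impI allI)
        fix \<omega> j assume \<omega>: "\<omega> \<in> space (M n)" "\<omega> \<notin> B n" and j: "real j \<le> real (k n) / (2 * c)" "j < n"
        have "\<bar>cnt n \<omega> - real n * q n\<bar> < real n * q n / 2" using \<omega> by (auto simp: B_def)
        then have "real n * q n / 2 < cnt n \<omega>" by linarith
        moreover have "real (k n) / (2 * c) = real (k n) / c / 2" by simp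
        ultimately have "real j < cnt n \<omega>" using j(1) elim by linarith
        then have "j < card {i\<in>{1..n}. U (t n * c) \<le> Y n i \<omega>}" by (simp add: cnt_def)
        then show "U (t n * c) \<le> x n \<omega> j"
          unfolding x_def
          by (subst order_stat_upper_iff[where P="\<lambda>v. U (t n * c) \<le> v", OF _ j(2)]) auto
      qed
    qed
  qed (rule M, rule over_k_tendsto_0)
qed

text \<open>
  The expected number of observations above \<open>U (4 t)\<close> is at most \<open>k / 4\<close>, and a deviation by another
  \<open>k / 4\<close> is unlikely.
\<close>
lemma order_stats_below:
  "bounded_whp M (\<lambda>C n \<omega>. \<forall>j. real (k n) / 2 \<le> real j \<longrightarrow> j < n \<longrightarrow> x n \<omega> j \<le> U (t n * 4))"
proof -
  define q where "q n = measure \<mu> {U (t n * 4)<..}" for n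
  define cnt where "cnt n \<omega> = real (card {i\<in>{1..n}. Y n i \<omega> \<in> {U (t n * 4)<..}})" for n \<omega>
  define B where "B n = {\<omega>\<in>space (M n). real (k n) / 4 \<le> \<bar>cnt n \<omega> - real n * q n\<bar>}" for n
  have q: "\<forall>\<^sub>F n in sequentially. real n * q n \<le> real (k n) / 4"
    using eventually_t[OF eventually_gt_at_top[of 1]] eventually_k
  proof eventually_elim
    case (elim n)
    have "q n \<le> 1 / (t n * 4)" unfolding q_def U_eq
      by (intro measure_greater_tail_quantile distribution) (use elim in auto)
    then have "real n * q n \<le> real n * (1 / (t n * 4))" by (intro mult_left_mono) auto
    then show ?case using elim by (simp add: t_def)
  qed
  show ?thesis
  proof (rule bounded_whp_tendsto[where B=B and e="\<lambda>n. 4 / real (k n)"])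
    show "\<forall>\<^sub>F n in sequentially. B n \<in> sets (M n) \<and> measure (M n) (B n) \<le> 4 / real (k n)"
      using q eventually_k
    proof eventually_elim
      case (elim n)
      interpret prob_space "M n" by (rule M)
      have k0: "real (k n) / 4 > 0" using elim by simp
      have ch: "B n \<in> events" "prob (B n) \<le> real n * q n / (real (k n) / 4)\<^sup>2"
        using k0 unfolding B_def cnt_def q_def
        by (intro chebyshev_count indep copies; simp)+
      note ch(2)
      also have "\<dots> \<le> real (k n) / 4 / (real (k n) / 4)\<^sup>2" using elim by (intro divide_right_mono) auto
      also have "\<dots> = 4 / real (k n)" using elim by (simp add: power2_eq_square)
      finally have "prob (B n) \<le> 4 / real (k n)" .
      with ch(1) show ?case by blast
    qed
    show "\<forall>\<^sub>F n in sequentially. \<forall>\<omega>\<in>space (M n). \<omega> \<notin> B n \<longrightarrow>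
        (\<forall>j. real (k n) / 2 \<le> real j \<longrightarrow> j < n \<longrightarrow> x n \<omega> j \<le> U (t n * 4))"
      using q
    proof eventually_elim
      case (elim n)
      show ?case
      proof (intro ballI impI allI)
        fix \<omega> j assume \<omega>: "\<omega> \<in> space (M n)" "\<omega> \<notin> B n" and j: "real (k n) / 2 \<le> real j" "j < n"
        have "\<bar>cnt n \<omega> - real n * q n\<bar> < real (k n) / 4" using \<omega> by (auto simp: B_def)
        then have "cnt n \<omega> < real j" using j(1) elim by linarith
        then have "\<not> j < card {i\<in>{1..n}. U (t n * 4) < Y n i \<omega>}" by (simp add: cnt_def)
        then have "\<not> U (t n * 4) < x n \<omega> j"
          unfolding x_def
          by (subst order_stat_upper_iff[where P="\<lambda>v. U (t n * 4) < v", OF _ j(2)]) auto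
        then show "x n \<omega> j \<le> U (t n * 4)" by simp
      qed
    qed
  qed (rule M, rule over_k_tendsto_0)
qed

text \<open>
  Markov's inequality for the sum over the whole sample. The reference level is \<open>U (t / 2)\<close> instead of
  the random threshold, which exceeds it with high probability.
\<close>
lemma log_excess_bounded:
  "bounded_whp M (\<lambda>C n \<omega>. (\<Sum>j<k n. (max 0 (ln (x n \<omega> j) - ln (U (t n * (1/2)))))\<^sup>2)
      \<le> C * (real (k n) * (A (t n))\<^sup>2))"
proof -
  obtain C1 where C1: "C1 > 0" "\<forall>\<^sub>F s in at_top.
    (\<integral>\<^sup>+y. ennreal ((max 0 (ln y - ln (U s)))\<^sup>2) \<partial>\<mu>) \<le> ennreal (C1 * (A s)\<^sup>2 / s)"
    using log_excess_second_moment[OF distribution pos U_eq] by blast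
  obtain C2 where C2: "C2 > 0" "\<forall>\<^sub>F s in at_top. A (s * (1/2)) \<le> C2 * A s"
    using A_shift[of "1/2"] by auto
  define D where "D = 2 * C1 * C2\<^sup>2"
  have D: "D > 0" using C1 C2 by (simp add: D_def)
  define g where "g n y = (max 0 (ln y - ln (U (t n * (1/2)))))\<^sup>2" for n y
  have g_meas [measurable]: "g n \<in> borel_measurable borel" for n unfolding g_def by measurable
  have mean: "\<forall>\<^sub>F n in sequentially. (\<integral>\<^sup>+y. ennreal (g n y) \<partial>\<mu>) \<le> ennreal (D * (A (t n))\<^sup>2 / t n)"
    using eventually_t[OF eventually_compose_filterlim[OF C1(2) at_top_scale[OF half_gt_zero[OF zero_less_one]]]]
      eventually_t[OF C2(2)] eventually_t[OF eventually_gt_at_top[of 2]]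
  proof eventually_elim
    case (elim n)
    have "0 < A (t n * (1/2))" using elim by (intro A_pos) auto
    then have "(A (t n * (1/2)))\<^sup>2 \<le> (C2 * A (t n))\<^sup>2" using elim by (intro power_mono) auto
    then have "C1 * (A (t n * (1/2)))\<^sup>2 / (t n * (1/2)) \<le> C1 * (C2 * A (t n))\<^sup>2 / (t n * (1/2))"
      using C1 elim by (intro divide_right_mono mult_left_mono) auto
    also have "\<dots> = D * (A (t n))\<^sup>2 / t n" by (simp add: D_def power_mult_distrib)
    finally have "ennreal (C1 * (A (t n * (1/2)))\<^sup>2 / (t n * (1/2))) \<le> ennreal (D * (A (t n))\<^sup>2 / t n)"
      by (rule ennreal_leI)
    with elim show ?case unfolding g_def by (auto intro: order_trans)
  qed
  show ?thesis
    unfolding bounded_whp_def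
  proof (intro allI impI)
    fix \<epsilon> :: real assume \<epsilon>: "\<epsilon> > 0"
    show "\<exists>C. \<forall>\<^sub>F n in sequentially. \<exists>E\<in>sets (M n). measure (M n) E \<ge> 1 - \<epsilon> \<and>
      (\<forall>\<omega>\<in>E. (\<Sum>j<k n. (max 0 (ln (x n \<omega> j) - ln (U (t n * (1/2)))))\<^sup>2) \<le> C * (real (k n) * (A (t n))\<^sup>2))"
    proof (rule exI[of _ "D / \<epsilon>"], use mean eventually_k eventually_t[OF eventually_gt_at_top[of 1]] in eventually_elim)
      case (elim n)
      interpret prob_space "M n" by (rule M)
      have Ym [measurable]: "Y n i \<in> borel_measurable (M n)" if "i \<in> {1..n}" for i using Y_measurable that .
      define S where "S \<omega> = (\<Sum>i\<in>{1..n}. g n (Y n i \<omega>))" for \<omega>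
      have S_meas [measurable]: "S \<in> borel_measurable (M n)"
        unfolding S_def by (intro borel_measurable_sum measurable_compose[OF Ym g_meas])
      define V where "V = real (k n) * (A (t n))\<^sup>2"
      have V: "V > 0" using elim A_pos[of "t n"] by (simp add: V_def)
      have "(\<integral>\<^sup>+\<omega>. ennreal (S \<omega>) \<partial>M n) = (\<Sum>i\<in>{1..n}. \<integral>\<^sup>+\<omega>. ennreal (g n (Y n i \<omega>)) \<partial>M n)"
        unfolding S_def
        by (subst nn_integral_sum[symmetric])
           (auto simp: g_def intro!: measurable_compose[OF Ym] nn_integral_cong sum_ennreal[symmetric])
      also have "\<dots> = (\<Sum>i\<in>{1..n}. \<integral>\<^sup>+y. ennreal (g n y) \<partial>\<mu>)"
      proof (rule sum.cong[OF refl])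
        fix i assume i: "i \<in> {1..n}"
        show "(\<integral>\<^sup>+\<omega>. ennreal (g n (Y n i \<omega>)) \<partial>M n) = (\<integral>\<^sup>+y. ennreal (g n y) \<partial>\<mu>)"
          unfolding copies[OF i, symmetric] by (subst nn_integral_distr[OF Ym[OF i]]) auto
      qed
      also have "\<dots> \<le> (\<Sum>i\<in>{1..n}. ennreal (D * (A (t n))\<^sup>2 / t n))"
        using elim by (intro sum_mono) auto
      also have "\<dots> = ennreal (real n * (D * (A (t n))\<^sup>2 / t n))"
        using D elim by (subst sum_ennreal) auto
      also have "real n * (D * (A (t n))\<^sup>2 / t n) = D * V"
        using elim by (simp add: V_def t_def)
      finally have S_mean: "(\<integral>\<^sup>+\<omega>. ennreal (S \<omega>) \<partial>M n) \<le> ennreal (D * V)" .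
      define c where "c = \<epsilon> / (D * V)"
      have c: "c > 0" using \<epsilon> D V by (simp add: c_def)
      \<comment> \<open>the event that the sum exceeds its mean bound \<open>D V\<close> by the factor \<open>1 / \<epsilon>\<close>\<close>
      define B where "B = {\<omega>\<in>space (M n). 1 \<le> ennreal c * ennreal (S \<omega>)}"
      have "emeasure (M n) B \<le> ennreal c * (\<integral>\<^sup>+\<omega>. ennreal (S \<omega>) * indicator (space (M n)) \<omega> \<partial>M n)"
        unfolding B_def by (intro nn_integral_Markov_inequality) auto
      also have "(\<integral>\<^sup>+\<omega>. ennreal (S \<omega>) * indicator (space (M n)) \<omega> \<partial>M n) = (\<integral>\<^sup>+\<omega>. ennreal (S \<omega>) \<partial>M n)"
        by (intro nn_integral_cong) auto
      also have "ennreal c * (\<integral>\<^sup>+\<omega>. ennreal (S \<omega>) \<partial>M n) \<le> ennreal c * ennreal (D * V)"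
        using S_mean by (intro mult_left_mono) auto
      also have "\<dots> = ennreal \<epsilon>" using c D V by (simp add: c_def ennreal_mult[symmetric])
      finally have B_le: "prob B \<le> \<epsilon>" using \<epsilon> by (simp add: emeasure_eq_measure)
      have B_ev: "B \<in> events" unfolding B_def by measurable
      show ?case
      proof (intro bexI[of _ "space (M n) - B"] conjI ballI)
        show "prob (space (M n) - B) \<ge> 1 - \<epsilon>" using B_le B_ev by (simp add: prob_compl)
        fix \<omega> assume \<omega>: "\<omega> \<in> space (M n) - B"
        have S0: "S \<omega> \<ge> 0" unfolding S_def g_def by (intro sum_nonneg) auto
        have "\<not> 1 \<le> c * S \<omega>"
          using \<omega> c S0 by (auto simp: B_def ennreal_mult[symmetric])
        then have "S \<omega> \<le> D / \<epsilon> * V" using \<epsilon> D V by (simp add: c_def field_simps)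
        moreover have "(\<Sum>j<k n. g n (x n \<omega> j)) \<le> S \<omega>"
          unfolding x_def S_def using elim by (intro sum_order_stat_le) (auto simp: g_def)
        ultimately show "(\<Sum>j<k n. (max 0 (ln (x n \<omega> j) - ln (U (t n * (1/2)))))\<^sup>2) \<le> D / \<epsilon> * (real (k n) * (A (t n))\<^sup>2)"
          unfolding g_def V_def by linarith
      qed (use B_ev in auto)
    qed
  qed
qed

text \<open>
  The probabilistic core. The threshold lies between \<open>U (t / 2)\<close> and \<open>U (4 t)\<close>; the observations
  with \<open>j \<ge> k / 2\<close> are at most \<open>U (4 t)\<close> and those with \<open>j < k / 16\<close> at least \<open>U (8 t)\<close>, which separates
  their logarithms by a multiple of \<open>A\<close> and so gives the variance.
\<close>
lemma regular_tail_whp: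
  "bounded_whp M (\<lambda>C n \<omega>. regular_tail C (A (t n)) (U (t n)) (k n) (sample n (\<lambda>i. Y n i \<omega>)))"
proof -
  obtain E where E: "E > 0" "\<forall>\<^sub>F s in at_top. U (s * 4) \<le> E * U s"
    using U_ratio_bounded[of 4] by auto
  obtain c where c: "c > 0" "\<forall>\<^sub>F s in at_top. c * A s \<le> ln (U (s * 8)) - ln (U (s * 4))"
    using log_gap by blast
  define Q1 where "Q1 n \<omega> \<longleftrightarrow> (\<forall>j. real j \<le> real (k n) / (2 * 8) \<longrightarrow> j < n \<longrightarrow> U (t n * 8) \<le> x n \<omega> j)" for n \<omega>
  define Q2 where "Q2 n \<omega> \<longleftrightarrow> (\<forall>j. real j \<le> real (k n) / (2 * (1/2)) \<longrightarrow> j < n \<longrightarrow> U (t n * (1/2)) \<le> x n \<omega> j)" for n \<omega>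
  define Q3 where "Q3 n \<omega> \<longleftrightarrow> (\<forall>j. real (k n) / 2 \<le> real j \<longrightarrow> j < n \<longrightarrow> x n \<omega> j \<le> U (t n * 4))" for n \<omega>
  define Q4 where "Q4 C n \<omega> \<longleftrightarrow> (\<Sum>j<k n. (max 0 (ln (x n \<omega> j) - ln (U (t n * (1/2)))))\<^sup>2)
      \<le> C * (real (k n) * (A (t n))\<^sup>2)" for C n \<omega>
  have mono4: "Q4 C' n \<omega>" if "C \<le> C'" "Q4 C n \<omega>" for C C' n \<omega>
    using that unfolding Q4_def by (elim le_mult_mono) auto
  have "bounded_whp M (\<lambda>C. Q1)" "bounded_whp M (\<lambda>C. Q2)" "bounded_whp M (\<lambda>C. Q3)" "bounded_whp M Q4"
    using order_stats_above[of 8] order_stats_above[of "1/2"] order_stats_below log_excess_bounded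
    unfolding Q1_def[abs_def] Q2_def[abs_def] Q3_def[abs_def] Q4_def[abs_def] by simp_all
  then have "bounded_whp M (\<lambda>C n \<omega>. (Q1 n \<omega> \<and> Q2 n \<omega>) \<and> (Q3 n \<omega> \<and> Q4 C n \<omega>))" (is "bounded_whp M ?Q")
    by (intro bounded_whp_conj M) (auto intro: mono4)
  then show ?thesis
  proof (rule bounded_whp_mono)
    fix C :: real
    \<comment> \<open>the last entry converts the variance bound \<open>(c A / 8)\<^sup>2\<close> into one of the form \<open>A\<^sup>2 / C'\<close>\<close>
    define C' where "C' = Max {1, E, C, 64 / c\<^sup>2}"
    have C': "1 \<le> C'" "E \<le> C'" "C \<le> C'" "64 / c\<^sup>2 \<le> C'" by (auto simp: C'_def)
    have "\<forall>\<^sub>F n in sequentially. \<forall>\<omega>\<in>space (M n). ?Q C n \<omega> \<longrightarrow>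
        regular_tail C' (A (t n)) (U (t n)) (k n) (sample n (\<lambda>i. Y n i \<omega>))"
      using eventually_t[OF E(2)] eventually_t[OF c(2)] eventually_t[OF eventually_gt_at_top[of 2]] eventually_k
        k_inf[unfolded filterlim_at_top, rule_format, of 2]
    proof eventually_elim
      case (elim n)
      show ?case
      proof (intro ballI impI)
        fix \<omega> assume Q: "?Q C n \<omega>"
        define K where "K = k n"
        have K: "2 \<le> K" "K < n" using elim by (auto simp: K_def)
        define y where "y = sample n (\<lambda>i. Y n i \<omega>)"
        define l where "l j = ln (x n \<omega> j) - ln (x n \<omega> K)" for j
        have U: "U (t n * (1/2)) > 0" "U (t n) > 0" "U (t n * 4) > 0" "U (t n * 8) > 0" "A (t n) > 0"
          using elim by (auto intro!: U_pos A_pos)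
        have xK: "U (t n * (1/2)) \<le> x n \<omega> K" "x n \<omega> K \<le> U (t n * 4)"
          using Q K by (auto simp: K_def Q2_def Q3_def)
        have xj: "x n \<omega> K \<le> x n \<omega> j" if "j \<le> K" for j
          using that K unfolding x_def by (intro order_stat_sample_mono)
        have mom: "log_moment i K y = (1 / real K) * (\<Sum>j<K. l j ^ i)" for i
          by (simp add: log_moment_def y_def l_def x_def)
        have l0: "0 \<le> l j" "l j \<le> max 0 (ln (x n \<omega> j) - ln (U (t n * (1/2))))" if "j < K" for j
          using xj[of j] xK U that by (auto simp: l_def)
        have "(\<Sum>j<K. (l j)\<^sup>2) \<le> (\<Sum>j<K. (max 0 (ln (x n \<omega> j) - ln (U (t n * (1/2)))))\<^sup>2)"
          using l0 by (intro sum_mono power_mono) auto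
        also have "\<dots> \<le> C * (real K * (A (t n))\<^sup>2)" using Q by (simp add: K_def Q4_def)
        finally have "log_moment 2 K y \<le> C * (A (t n))\<^sup>2"
          using K by (simp add: mom divide_le_eq mult_ac)
        also have "\<dots> \<le> C' * (A (t n))\<^sup>2" using C' by (intro mult_right_mono) auto
        finally have m2: "log_moment 2 K y \<le> C' * (A (t n))\<^sup>2" .
        define \<alpha> where "\<alpha> = ln (U (t n * 4)) - ln (x n \<omega> K)"
        define \<beta> where "\<beta> = ln (U (t n * 8)) - ln (x n \<omega> K)"
        have gap: "c * A (t n) \<le> \<beta> - \<alpha>" using elim by (simp add: \<alpha>_def \<beta>_def)
        have cA: "c * A (t n) > 0" using c U by simp
        have "((\<beta> - \<alpha>) / 8)\<^sup>2 \<le> (1 / real K) * (\<Sum>j<K. (l j - (1 / real K) * (\<Sum>j<K. l j))\<^sup>2)"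
        proof (rule variance_ge_separated[OF K(1)])
          fix j assume j: "real K / 2 \<le> real j" "j < K"
          then have "x n \<omega> j \<le> U (t n * 4)" using Q K by (auto simp: K_def Q3_def)
          moreover have "x n \<omega> j > 0" using xj[of j] xK U j by linarith
          ultimately show "l j \<le> \<alpha>" by (simp add: l_def \<alpha>_def)
        next
          fix j assume j: "real j < real K / 16"
          then have "j < n" using K by linarith
          then have "U (t n * 8) \<le> x n \<omega> j" using Q j by (auto simp: K_def Q1_def)
          then show "\<beta> \<le> l j" using U by (simp add: l_def \<beta>_def)
        qed (use gap cA in linarith)
        also have "\<dots> = log_moment 2 K y - (log_moment 1 K y)\<^sup>2"
          using mean_square_about_mean[of K l] K by (simp add: mom)
        finally have var: "((\<beta> - \<alpha>) / 8)\<^sup>2 \<le> log_moment 2 K y - (log_moment 1 K y)\<^sup>2" .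
        have "(c * A (t n) / 8)\<^sup>2 \<le> ((\<beta> - \<alpha>) / 8)\<^sup>2" using gap cA by (intro power_mono) auto
        also note var
        finally have v: "(c * A (t n) / 8)\<^sup>2 \<le> log_moment 2 K y - (log_moment 1 K y)\<^sup>2" .
        have "(A (t n))\<^sup>2 = 64 / c\<^sup>2 * (c * A (t n) / 8)\<^sup>2"
          using c by (simp add: power_divide power_mult_distrib)
        also have "\<dots> \<le> C' * (log_moment 2 K y - (log_moment 1 K y)\<^sup>2)"
          using v C' by (intro mult_mono) auto
        finally have m3: "(A (t n))\<^sup>2 \<le> C' * (log_moment 2 K y - (log_moment 1 K y)\<^sup>2)" .
        have "x n \<omega> K \<le> E * U (t n)" using xK elim by linarith
        also have "\<dots> \<le> C' * U (t n)" using C' U by (intro mult_right_mono) auto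
        finally have xC: "x n \<omega> K \<le> C' * U (t n)" .
        have "x n \<omega> K > 0" using xK U by linarith
        then show "regular_tail C' (A (t n)) (U (t n)) (k n) (sample n (\<lambda>i. Y n i \<omega>))"
          unfolding regular_tail_def using m2 m3 xC C' by (simp add: K_def y_def x_def)
      qed
    qed
    then show "\<exists>C'. \<forall>\<^sub>F n in sequentially. \<forall>\<omega>\<in>space (M n). ?Q C n \<omega> \<longrightarrow>
        regular_tail C' (A (t n)) (U (t n)) (k n) (sample n (\<lambda>i. Y n i \<omega>))" by blast
  qed
qed

end

section \<open>Comparison of the two samples\<close>

locale approximated_sample = intermediate_sample U a \<gamma> \<mu> M Y k
  for U a :: "real \<Rightarrow> real" and \<gamma> :: real and \<mu> :: "real measure" and M :: "nat \<Rightarrow> 'a measure"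
    and Y :: "nat \<Rightarrow> nat \<Rightarrow> 'a \<Rightarrow> real" and k :: "nat \<Rightarrow> nat" +
  fixes Y' :: "nat \<Rightarrow> nat \<Rightarrow> 'a \<Rightarrow> real" and h z :: "nat \<Rightarrow> real"
  assumes Y'_measurable: "i \<in> {1..n} \<Longrightarrow> Y' n i \<in> borel_measurable (M n)"
    and close: "big_o_prob M
      (\<lambda>n \<omega>. Max ((\<lambda>j. \<bar>order_stat (sample n (\<lambda>i. Y' n i \<omega>)) (n - j)
          / order_stat (sample n (\<lambda>i. Y n i \<omega>)) (n - j) - 1\<bar>) ` {0..k n})) h"
    and z_eq: "z n = h n * U (t n) / a (t n)"
    and z_small: "z \<in> o(\<lambda>_. 1)"
begin

abbreviation S :: "nat \<Rightarrow> 'a \<Rightarrow> real list" where "S n \<omega> \<equiv> sample n (\<lambda>i. Y n i \<omega>)"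
abbreviation S' :: "nat \<Rightarrow> 'a \<Rightarrow> real list" where "S' n \<omega> \<equiv> sample n (\<lambda>i. Y' n i \<omega>)"

text \<open>
  The first three conjuncts are the errors to be estimated. The last one, the size of the scale
  estimator itself, is needed as a factor in the error of the quantile estimator.
\<close>
definition errors_within :: "real \<Rightarrow> nat \<Rightarrow> 'a \<Rightarrow> bool" where
  "errors_within C n \<omega> \<longleftrightarrow>
     \<bar>gamma_moment (k n) (S' n \<omega>) - gamma_moment (k n) (S n \<omega>)\<bar> \<le> C * \<bar>z n\<bar>
   \<and> \<bar>(order_stat (S' n \<omega>) (n - k n) - order_stat (S n \<omega>) (n - k n)) / a (t n)\<bar> \<le> C * \<bar>z n\<bar>
   \<and> \<bar>(sigma_moment (k n) (S' n \<omega>) - sigma_moment (k n) (S n \<omega>)) / a (t n)\<bar> \<le> C * \<bar>z n\<bar>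
   \<and> \<bar>sigma_moment (k n) (S n \<omega>) / a (t n)\<bar> \<le> C"

lemma errors_within_mono:
  assumes "C \<le> C'" "errors_within C n \<omega>"
  shows "errors_within C' n \<omega>"
proof -
  have le: "C * \<bar>z n\<bar> \<le> C' * \<bar>z n\<bar>" using assms(1) by (rule mult_right_mono) simp
  show ?thesis using assms(2) unfolding errors_within_def
    by (elim conjE) (intro conjI; erule order_trans; rule le assms(1))
qed

lemma z_tendsto_0: "z \<longlonglongrightarrow> 0"
  using smalloD_tendsto[OF z_small] by simp

text \<open>
  With \<open>\<delta> = 4 C |z|\<close> the relative error bound \<open>C |h| = C |z| A\<close> takes the form \<open>A \<delta> / 4\<close> used in
  \<open>estimators_stable\<close>, and \<open>\<delta>\<close> is small for large \<open>n\<close>.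
\<close>
lemma errors_within_whp: "bounded_whp M errors_within"
proof -
  let ?D = "\<lambda>n \<omega>. Max ((\<lambda>j. \<bar>order_stat (S' n \<omega>) (n - j) / order_stat (S n \<omega>) (n - j) - 1\<bar>) ` {0..k n})"
  obtain CA where CA: "\<forall>\<^sub>F s in at_top. A s \<le> CA" using A_bounded by blast
  have t1: "\<forall>\<^sub>F n in sequentially. t n > 1" by (rule eventually_t[OF eventually_gt_at_top])
  \<comment> \<open>guarded by \<open>t n > 1\<close>, where \<open>A\<close> and \<open>U\<close> are positive, to be monotone in \<open>C\<close> for every \<open>n\<close>\<close>
  define R where "R C n \<omega> \<longleftrightarrow> t n > 1 \<longrightarrow> regular_tail C (A (t n)) (U (t n)) (k n) (S n \<omega>)" for C n \<omega>
  have R: "bounded_whp M R"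
    using regular_tail_whp by (rule bounded_whp_weaken) (simp add: R_def)
  have R_mono: "R C' n \<omega>" if "C \<le> C'" "R C n \<omega>" for C C' n \<omega>
    using that A_pos[of "t n"] U_pos[of "t n"] unfolding R_def by (auto elim!: regular_tail_mono)
  define H where "H C n \<omega> \<longleftrightarrow> \<bar>?D n \<omega>\<bar> \<le> C * \<bar>h n\<bar>" for C n \<omega>
  have H: "bounded_whp M H"
    unfolding H_def by (rule big_o_probD[OF M close])
  have H_mono: "H C' n \<omega>" if "C \<le> C'" "H C n \<omega>" for C C' n \<omega>
    using that unfolding H_def by (meson abs_ge_zero mult_right_mono order_trans)
  have "bounded_whp M (\<lambda>C n \<omega>. R C n \<omega> \<and> H C n \<omega>)"
    using M R H R_mono H_mono by (rule bounded_whp_conj)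
  then show ?thesis
  proof (rule bounded_whp_mono)
    fix C :: real
    define C2 where "C2 = Max {1, C, CA}"
    have C2: "1 \<le> C2" "C \<le> C2" "CA \<le> C2" by (auto simp: C2_def)
    define K where "K = max (15 * C2 ^ 6 * (4 * C2)) (C2 ^ 4)"
    have "(\<lambda>n. 18 * C2\<^sup>2 * (4 * C2 * \<bar>z n\<bar>)) \<longlonglongrightarrow> 18 * C2\<^sup>2 * (4 * C2 * \<bar>0\<bar>)"
      by (intro tendsto_intros z_tendsto_0)
    then have small: "\<forall>\<^sub>F n in sequentially. 18 * C2\<^sup>2 * (4 * C2 * \<bar>z n\<bar>) < 1"
      by (rule order_tendstoD(2)) simp
    have "\<forall>\<^sub>F n in sequentially. \<forall>\<omega>\<in>space (M n). R C n \<omega> \<and> H C n \<omega> \<longrightarrow> errors_within K n \<omega>"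
      using t1 small eventually_k eventually_t[OF CA]
    proof eventually_elim
      case (elim n)
      show ?case
      proof (intro ballI impI)
        fix \<omega> assume RH: "R C n \<omega> \<and> H C n \<omega>"
        have p: "A (t n) > 0" "U (t n) > 0" "a (t n) > 0" using A_pos U_pos a_pos elim by auto
        have a: "A (t n) * U (t n) = a (t n)" using p by (simp add: A_def)
        have reg: "regular_tail C2 (A (t n)) (U (t n)) (k n) (S n \<omega>)"
          using R_mono[OF C2(2), of n \<omega>] RH elim by (simp add: R_def)
        define \<delta> where "\<delta> = 4 * C2 * \<bar>z n\<bar>"
        have "\<bar>h n\<bar> = \<bar>z n\<bar> * A (t n)" using p by (simp add: z_eq A_def abs_mult abs_divide)
        moreover have "H C2 n \<omega>" using H_mono[OF C2(2)] RH by blast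
        then have "?D n \<omega> \<le> C2 * \<bar>h n\<bar>"
          unfolding H_def by (rule order_trans[OF abs_ge_self])
        ultimately have D: "?D n \<omega> \<le> A (t n) * \<delta> / 4" by (simp add: \<delta>_def mult_ac)
        have close_n: "\<bar>order_stat (S' n \<omega>) (n - j) / order_stat (S n \<omega>) (n - j) - 1\<bar> \<le> A (t n) * \<delta> / 4"
          if "j \<le> k n" for j
          using that by (intro order_trans[OF Max_ge D]) auto
        have \<delta>: "0 \<le> \<delta>" "18 * C2\<^sup>2 * \<delta> \<le> 1" using C2 elim by (auto simp: \<delta>_def)
        have "A (t n) \<le> C2" using elim C2 by linarith
        note st = estimators_stable[OF _ _ reg p(1) this p(2) \<delta> close_n, unfolded a]
        have "15 * C2 ^ 6 * \<delta> = 15 * C2 ^ 6 * (4 * C2) * \<bar>z n\<bar>" by (simp add: \<delta>_def)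
        also have "\<dots> \<le> K * \<bar>z n\<bar>" by (intro mult_right_mono) (auto simp: K_def)
        finally have K1: "15 * C2 ^ 6 * \<delta> \<le> K * \<bar>z n\<bar>" .
        have K2: "C2 ^ 4 \<le> K" by (simp add: K_def)
        show "errors_within K n \<omega>"
          unfolding errors_within_def using elim
          by (intro conjI order_trans[OF st(1) K1] order_trans[OF st(2) K1] order_trans[OF st(3) K1]
              order_trans[OF st(4) K2]) auto
      qed
    qed
    then show "\<exists>K. \<forall>\<^sub>F n in sequentially. \<forall>\<omega>\<in>space (M n). R C n \<omega> \<and> H C n \<omega> \<longrightarrow> errors_within K n \<omega>" by blast
  qed
qed

text \<open>
  \<open>z\<^sub>n\<close> vanishes only together with \<open>h\<^sub>n\<close>, and then all relative errors vanish almost surely. The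
  convention \<open>0 / 0 = 0\<close> does no harm, as a relative error of zero means that the quotient is \<open>1\<close>.
\<close>
lemma equal_if_z_0:
  "\<forall>\<^sub>F n in sequentially. z n = 0 \<longrightarrow>
     (AE \<omega> in M n. \<forall>j\<le>k n. order_stat (S' n \<omega>) (n - j) = order_stat (S n \<omega>) (n - j))"
proof -
  have "\<forall>\<^sub>F n in sequentially. h n = 0 \<longrightarrow> (AE \<omega> in M n.
      Max ((\<lambda>j. \<bar>order_stat (S' n \<omega>) (n - j) / order_stat (S n \<omega>) (n - j) - 1\<bar>) ` {0..k n}) = 0)"
    using close unfolding big_o_prob_def by (auto elim!: eventually_mono)
  with eventually_t[OF eventually_gt_at_top[of 1]] show ?thesis
  proof eventually_elim
    case (elim n)
    show ?case
    proof
      assume "z n = 0"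
      then have "h n = 0" using U_pos[of "t n"] a_pos[of "t n"] elim by (simp add: z_eq)
      with elim have "AE \<omega> in M n.
        Max ((\<lambda>j. \<bar>order_stat (S' n \<omega>) (n - j) / order_stat (S n \<omega>) (n - j) - 1\<bar>) ` {0..k n}) = 0" by blast
      then show "AE \<omega> in M n. \<forall>j\<le>k n. order_stat (S' n \<omega>) (n - j) = order_stat (S n \<omega>) (n - j)"
      proof eventually_elim
        case (elim \<omega>)
        show ?case
        proof (intro allI impI)
          fix j assume "j \<le> k n"
          then have "\<bar>order_stat (S' n \<omega>) (n - j) / order_stat (S n \<omega>) (n - j) - 1\<bar> \<le>
            Max ((\<lambda>j. \<bar>order_stat (S' n \<omega>) (n - j) / order_stat (S n \<omega>) (n - j) - 1\<bar>) ` {0..k n})"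
            by (intro Max_ge) auto
          then have "order_stat (S' n \<omega>) (n - j) / order_stat (S n \<omega>) (n - j) = 1" using elim by simp
          then show "order_stat (S' n \<omega>) (n - j) = order_stat (S n \<omega>) (n - j)"
            by (cases "order_stat (S n \<omega>) (n - j) = 0") auto
        qed
      qed
    qed
  qed
qed

text \<open>
  All errors to be estimated vanish where the samples have the same top order statistics, so the case
  \<open>z\<^sub>n = 0\<close> is the same for each of them.
\<close>
lemma big_o_prob_if_errors_vanish:
  assumes meas: "\<forall>\<^sub>F n in sequentially. X n \<in> borel_measurable (M n)"
    and bd: "bounded_whp M (\<lambda>C n \<omega>. \<bar>X n \<omega>\<bar> \<le> C * \<bar>z n\<bar>)"
    and eq: "\<And>n \<omega>. 0 < k n \<Longrightarrow> k n < n \<Longrightarrow>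
      (\<And>j. j \<le> k n \<Longrightarrow> order_stat (S' n \<omega>) (n - j) = order_stat (S n \<omega>) (n - j)) \<Longrightarrow> X n \<omega> = 0"
  shows "big_o_prob M X z"
proof (rule big_o_probI[OF M meas bd])
  show "\<forall>\<^sub>F n in sequentially. z n = 0 \<longrightarrow> (AE \<omega> in M n. X n \<omega> = 0)"
    using equal_if_z_0 eventually_k
  proof eventually_elim
    case (elim n)
    show ?case
    proof
      assume "z n = 0"
      with elim have "AE \<omega> in M n. \<forall>j\<le>k n. order_stat (S' n \<omega>) (n - j) = order_stat (S n \<omega>) (n - j)"
        by blast
      then show "AE \<omega> in M n. X n \<omega> = 0" by eventually_elim (use elim eq in blast)
    qed
  qed
qed

lemma estimators_measurable_eventually:
  "\<forall>\<^sub>F n in sequentially. (\<lambda>\<omega>. gamma_moment (k n) (S n \<omega>)) \<in> borel_measurable (M n)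
     \<and> (\<lambda>\<omega>. gamma_moment (k n) (S' n \<omega>)) \<in> borel_measurable (M n)
     \<and> (\<lambda>\<omega>. sigma_moment (k n) (S n \<omega>)) \<in> borel_measurable (M n)
     \<and> (\<lambda>\<omega>. sigma_moment (k n) (S' n \<omega>)) \<in> borel_measurable (M n)
     \<and> (\<lambda>\<omega>. quantile_moment (k n) (p n) (S n \<omega>)) \<in> borel_measurable (M n)
     \<and> (\<lambda>\<omega>. quantile_moment (k n) (p n) (S' n \<omega>)) \<in> borel_measurable (M n)
     \<and> (\<lambda>\<omega>. order_stat (S n \<omega>) (n - k n)) \<in> borel_measurable (M n)
     \<and> (\<lambda>\<omega>. order_stat (S' n \<omega>) (n - k n)) \<in> borel_measurable (M n)"
  using eventually_k
proof eventually_elim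
  case (elim n)
  then have k: "k n < n" by simp
  note Y = Y_measurable[of _ n] and Y' = Y'_measurable[of _ n]
  show ?case
    by (intro conjI estimators_measurable[OF Y k] estimators_measurable[OF Y' k]
        borel_measurable_order_stat[OF Y k] borel_measurable_order_stat[OF Y' k])
qed

lemma gamma_moment_error:
  "big_o_prob M (\<lambda>n \<omega>. \<bar>gamma_moment (k n) (S' n \<omega>) - gamma_moment (k n) (S n \<omega>)\<bar>) z"
proof (rule big_o_prob_if_errors_vanish)
  show "bounded_whp M (\<lambda>C n \<omega>. \<bar>\<bar>gamma_moment (k n) (S' n \<omega>) - gamma_moment (k n) (S n \<omega>)\<bar>\<bar> \<le> C * \<bar>z n\<bar>)"
    using errors_within_whp by (rule bounded_whp_weaken) (simp add: errors_within_def)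
  show "\<forall>\<^sub>F n in sequentially. (\<lambda>\<omega>. \<bar>gamma_moment (k n) (S' n \<omega>) - gamma_moment (k n) (S n \<omega>)\<bar>) \<in> borel_measurable (M n)"
    using estimators_measurable_eventually[of "\<lambda>_. 0"] 
    by eventually_elim (auto intro!: borel_measurable_abs borel_measurable_divide borel_measurable_diff)
qed (simp add: sample_estimators_cong(1)[where y'="\<lambda>i. Y' _ i _" and y="\<lambda>i. Y _ i _"])

lemma threshold_error:
  "big_o_prob M (\<lambda>n \<omega>. \<bar>(order_stat (S' n \<omega>) (n - k n) - order_stat (S n \<omega>) (n - k n)) / a (t n)\<bar>) z"
proof (rule big_o_prob_if_errors_vanish)
  show "bounded_whp M (\<lambda>C n \<omega>. \<bar>\<bar>(order_stat (S' n \<omega>) (n - k n) - order_stat (S n \<omega>) (n - k n)) / a (t n)\<bar>\<bar> \<le> C * \<bar>z n\<bar>)"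
    using errors_within_whp by (rule bounded_whp_weaken) (simp add: errors_within_def)
  show "\<forall>\<^sub>F n in sequentially. (\<lambda>\<omega>. \<bar>(order_stat (S' n \<omega>) (n - k n) - order_stat (S n \<omega>) (n - k n)) / a (t n)\<bar>) \<in> borel_measurable (M n)"
    using estimators_measurable_eventually[of "\<lambda>_. 0"] 
    by eventually_elim (auto intro!: borel_measurable_abs borel_measurable_divide borel_measurable_diff)
qed simp

lemma sigma_moment_error:
  "big_o_prob M (\<lambda>n \<omega>. \<bar>(sigma_moment (k n) (S' n \<omega>) - sigma_moment (k n) (S n \<omega>)) / a (t n)\<bar>) z"
proof (rule big_o_prob_if_errors_vanish)
  show "bounded_whp M (\<lambda>C n \<omega>. \<bar>\<bar>(sigma_moment (k n) (S' n \<omega>) - sigma_moment (k n) (S n \<omega>)) / a (t n)\<bar>\<bar> \<le> C * \<bar>z n\<bar>)"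
    using errors_within_whp by (rule bounded_whp_weaken) (simp add: errors_within_def)
  show "\<forall>\<^sub>F n in sequentially. (\<lambda>\<omega>. \<bar>(sigma_moment (k n) (S' n \<omega>) - sigma_moment (k n) (S n \<omega>)) / a (t n)\<bar>) \<in> borel_measurable (M n)"
    using estimators_measurable_eventually[of "\<lambda>_. 0"] 
    by eventually_elim (auto intro!: borel_measurable_abs borel_measurable_divide borel_measurable_diff)
qed (simp add: sample_estimators_cong(2)[where y'="\<lambda>i. Y' _ i _" and y="\<lambda>i. Y _ i _"])

text \<open>
  From \<open>ln d = ln k - ln (n p)\<close> one gets \<open>ln d = o(\<surd>k)\<close>. The two rate conditions place both shape
  estimates within \<open>O(1 / \<surd>k)\<close> of \<open>\<gamma>\<close>, so their distance to \<open>\<gamma>\<close> times \<open>ln d\<close> is eventually at most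
  \<open>1\<close>, as \<open>quantile_stable\<close> requires.
\<close>
lemma quantile_moment_error:
  fixes p d :: "nat \<Rightarrow> real"
  assumes p: "\<And>n. p n \<in> {0<..<1}"
    and np: "(\<lambda>n. real n * p n) \<in> o(\<lambda>n. real (k n))"
    and ln_np: "(\<lambda>n. ln (real n * p n)) \<in> o(\<lambda>n. sqrt (real (k n)))"
    and rate: "big_o_prob M (\<lambda>n \<omega>. sqrt (real (k n)) * (gamma_moment (k n) (S n \<omega>) - \<gamma>)) (\<lambda>_. 1)"
    and kz: "(\<lambda>n. sqrt (real (k n)) * z n) \<in> O(\<lambda>_. 1)"
    and d: "\<And>n. d n = real (k n) / (real n * p n)"
  shows "big_o_prob M (\<lambda>n \<omega>. \<bar>(quantile_moment (k n) (p n) (S' n \<omega>) - quantile_moment (k n) (p n) (S n \<omega>))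
            / (a (t n) * q_fun \<gamma> (d n))\<bar>) z"
proof (rule big_o_prob_if_errors_vanish)
  obtain c where c: "c > 0" "\<And>d. d \<ge> 3 \<Longrightarrow> c \<le> q_fun \<gamma> d \<and> c * box_cox \<gamma> d \<le> q_fun \<gamma> d"
    using q_fun_lower_bounds[of \<gamma>] by blast
  obtain Cz where Cz: "\<forall>\<^sub>F n in sequentially. sqrt (real (k n)) * \<bar>z n\<bar> \<le> Cz"
    using kz by (auto simp: bigo_def abs_mult)
  have d3: "\<forall>\<^sub>F n in sequentially. d n \<ge> 3"
    using landau_o.smallD[OF np, of "1/3", simplified] eventually_k
  proof eventually_elim
    case (elim n)
    have "p n > 0" using p[of n] by simp
    with elim show ?case by (simp add: d le_divide_eq abs_mult)
  qed
  have ln_d: "(\<lambda>n. ln (d n) / sqrt (real (k n))) \<longlonglongrightarrow> 0"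
  proof -
    have "(\<lambda>n. ln (real (k n)) / real (k n) powr (1/2)) \<longlonglongrightarrow> 0"
      using filterlim_compose[OF lim_ln_over_power[of "1/2"] k_inf] by simp
    then have "(\<lambda>n. ln (real (k n)) / sqrt (real (k n))) \<longlonglongrightarrow> 0" by (simp add: powr_half_sqrt)
    moreover have "(\<lambda>n. ln (real n * p n) / sqrt (real (k n))) \<longlonglongrightarrow> 0"
      by (rule smalloD_tendsto[OF ln_np])
    ultimately have "(\<lambda>n. ln (real (k n)) / sqrt (real (k n)) - ln (real n * p n) / sqrt (real (k n))) \<longlonglongrightarrow> 0 - 0"
      by (rule tendsto_diff)
    moreover have "\<forall>\<^sub>F n in sequentially. ln (real (k n)) / sqrt (real (k n)) - ln (real n * p n) / sqrt (real (k n))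
        = ln (d n) / sqrt (real (k n))"
      using eventually_k
    proof eventually_elim
      case (elim n)
      have "p n > 0" using p[of n] by simp
      with elim have "ln (d n) = ln (real (k n)) - ln (real n * p n)" by (simp add: d ln_div)
      then show ?case by (simp add: diff_divide_distrib)
    qed
    ultimately show ?thesis by (simp add: filterlim_cong[OF refl refl])
  qed
  define G where "G C n \<omega> \<longleftrightarrow> \<bar>sqrt (real (k n)) * (gamma_moment (k n) (S n \<omega>) - \<gamma>)\<bar> \<le> C" for C n \<omega>
  have G: "bounded_whp M G" using big_o_probD[OF M rate] by (simp add: G_def[abs_def])
  have "bounded_whp M (\<lambda>C n \<omega>. errors_within C n \<omega> \<and> G C n \<omega>)"
    using M errors_within_whp G errors_within_mono by (rule bounded_whp_conj) (auto simp: G_def)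
  then show "bounded_whp M (\<lambda>C n \<omega>. \<bar>\<bar>(quantile_moment (k n) (p n) (S' n \<omega>) - quantile_moment (k n) (p n) (S n \<omega>))
            / (a (t n) * q_fun \<gamma> (d n))\<bar>\<bar> \<le> C * \<bar>z n\<bar>)"
  proof (rule bounded_whp_mono)
    fix C :: real
    define C1 where "C1 = max C 0"
    \<comment> \<open>bounds \<open>\<surd>k\<close> times the distance of either shape estimate to \<open>\<gamma>\<close>\<close>
    define L where "L = C1 + C1 * Cz"
    define K where "K = (1 / c + exp 1 / c + C1 * exp 1) * C1"
    have "(\<lambda>n. L * (ln (d n) / sqrt (real (k n)))) \<longlonglongrightarrow> L * 0"
      by (intro tendsto_mult tendsto_const ln_d)
    then have small: "\<forall>\<^sub>F n in sequentially. L * (ln (d n) / sqrt (real (k n))) < 1"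
      by (rule order_tendstoD(2)) simp
    have "\<forall>\<^sub>F n in sequentially. \<forall>\<omega>\<in>space (M n). errors_within C n \<omega> \<and> G C n \<omega> \<longrightarrow>
        \<bar>\<bar>(quantile_moment (k n) (p n) (S' n \<omega>) - quantile_moment (k n) (p n) (S n \<omega>)) / (a (t n) * q_fun \<gamma> (d n))\<bar>\<bar> \<le> K * \<bar>z n\<bar>"
      using small eventually_k d3 Cz
    proof eventually_elim
      case (elim n)
      show ?case
      proof (intro ballI impI)
        fix \<omega> assume SG: "errors_within C n \<omega> \<and> G C n \<omega>"
        have st: "errors_within C1 n \<omega>" using SG errors_within_mono[of C C1] by (auto simp: C1_def)
        define r where "r = sqrt (real (k n))"
        define g where "g = gamma_moment (k n) (S n \<omega>)"
        define g' where "g' = gamma_moment (k n) (S' n \<omega>)"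
        have r: "r > 0" using elim by (simp add: r_def)
        have C1: "C1 \<ge> 0" by (simp add: C1_def)
        have Cz: "r * \<bar>z n\<bar> \<le> Cz" using elim by (simp add: r_def)
        have "0 \<le> r * \<bar>z n\<bar>" using r by simp
        with Cz have Cz0: "0 \<le> Cz" by linarith
        have "r * \<bar>g - \<gamma>\<bar> \<le> C" using SG r by (simp add: G_def g_def r_def abs_mult)
        then have gr: "r * \<bar>g - \<gamma>\<bar> \<le> C1" by (simp add: C1_def)
        have "\<bar>g' - g\<bar> \<le> C1 * \<bar>z n\<bar>" using st by (simp add: errors_within_def g_def g'_def)
        then have "r * \<bar>g' - g\<bar> \<le> r * (C1 * \<bar>z n\<bar>)" using r by (intro mult_left_mono) auto
        also have "\<dots> = C1 * (r * \<bar>z n\<bar>)" by simp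
        also have "\<dots> \<le> C1 * Cz" using Cz C1 by (intro mult_left_mono)
        finally have "r * \<bar>g' - g\<bar> \<le> C1 * Cz" .
        moreover have "r * \<bar>g' - \<gamma>\<bar> \<le> r * (\<bar>g' - g\<bar> + \<bar>g - \<gamma>\<bar>)" using r by (intro mult_left_mono) auto
        ultimately have g'r: "r * \<bar>g' - \<gamma>\<bar> \<le> L" using gr unfolding L_def distrib_left by linarith
        have gr: "r * \<bar>g - \<gamma>\<bar> \<le> L" using gr C1 Cz0 unfolding L_def by (intro order_trans[OF gr]) auto
        have ln: "ln (d n) / r \<ge> 0" using elim r by simp
        have shift: "\<bar>u\<bar> * ln (d n) \<le> 1" if "r * \<bar>u\<bar> \<le> L" for u
        proof -
          have "\<bar>u\<bar> * ln (d n) = (r * \<bar>u\<bar>) * (ln (d n) / r)" using r by simp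
          also have "\<dots> \<le> L * (ln (d n) / r)" using that ln by (intro mult_right_mono)
          also have "\<dots> \<le> 1" using elim by (simp add: r_def)
          finally show ?thesis .
        qed
        have "\<bar>(quantile_moment (k n) (p n) (S' n \<omega>) - quantile_moment (k n) (p n) (S n \<omega>)) / (a (t n) * q_fun \<gamma> (d n))\<bar>
            \<le> (1 / c + exp 1 / c + C1 * exp 1) * (C1 * \<bar>z n\<bar>)"
          using st elim c shift[OF gr] shift[OF g'r]
          by (intro quantile_stable) (auto simp: errors_within_def g_def g'_def d)
        then show "\<bar>\<bar>(quantile_moment (k n) (p n) (S' n \<omega>) - quantile_moment (k n) (p n) (S n \<omega>)) / (a (t n) * q_fun \<gamma> (d n))\<bar>\<bar>
            \<le> K * \<bar>z n\<bar>"
          by (simp add: K_def mult.assoc)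
      qed
    qed
    then show "\<exists>K. \<forall>\<^sub>F n in sequentially. \<forall>\<omega>\<in>space (M n). errors_within C n \<omega> \<and> G C n \<omega> \<longrightarrow>
        \<bar>\<bar>(quantile_moment (k n) (p n) (S' n \<omega>) - quantile_moment (k n) (p n) (S n \<omega>)) / (a (t n) * q_fun \<gamma> (d n))\<bar>\<bar> \<le> K * \<bar>z n\<bar>"
      by blast
  qed
next
  show "\<forall>\<^sub>F n in sequentially. (\<lambda>\<omega>. \<bar>(quantile_moment (k n) (p n) (S' n \<omega>) - quantile_moment (k n) (p n) (S n \<omega>))
      / (a (t n) * q_fun \<gamma> (d n))\<bar>) \<in> borel_measurable (M n)"
    using estimators_measurable_eventually[of p] 
    by eventually_elim (auto intro!: borel_measurable_abs borel_measurable_divide borel_measurable_diff)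
qed (simp add: sample_estimators_cong(3)[where y'="\<lambda>i. Y' _ i _" and y="\<lambda>i. Y _ i _"])

end

theorem theorem1:
  fixes N :: "'b measure" and Y0 :: "'b \<Rightarrow> real" and F :: "real \<Rightarrow> real" and \<gamma> :: real
    and M :: "nat \<Rightarrow> 'a measure"
    and Y Y' :: "nat \<Rightarrow> nat \<Rightarrow> 'a \<Rightarrow> real"
    and S S' :: "nat \<Rightarrow> 'a \<Rightarrow> real list"
    and a :: "real \<Rightarrow> real" and k :: "nat \<Rightarrow> nat" and h z :: "nat \<Rightarrow> real"
  assumes "prob_space N" and "Y0 \<in> borel_measurable N" and "AE x in N. Y0 x > 0"
    and F: "F = cdf (distr N borel Y0)"
    and dom: "in_max_domain (distr N borel Y0) \<gamma>"
    and a: "scaling_function F \<gamma> a"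
    and M: "\<And>n. prob_space (M n)"
    and indep: "\<And>n. prob_space.indep_vars (M n) (\<lambda>_. borel) (Y n) {1..n}"
    and copies: "\<And>n i. i \<in> {1..n} \<Longrightarrow> distr (M n) borel (Y n i) = distr N borel Y0"
    and approx: "\<And>n i. i \<in> {1..n} \<Longrightarrow> Y' n i \<in> borel_measurable (M n)"
    and S: "\<And>n \<omega>. S n \<omega> = sample n (\<lambda>i. Y n i \<omega>)"
    and S': "\<And>n \<omega>. S' n \<omega> = sample n (\<lambda>i. Y' n i \<omega>)"
    and k: "\<And>n. n \<ge> 2 \<Longrightarrow> 0 < k n \<and> k n < n"
    and k_inf: "filterlim k at_top sequentially"
    and k_small: "(\<lambda>n. real (k n) / real n) \<longlonglongrightarrow> 0"
    and close: "big_o_prob M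
      (\<lambda>n \<omega>. Max ((\<lambda>j. \<bar>order_stat (S' n \<omega>) (n - j) / order_stat (S n \<omega>) (n - j) - 1\<bar>) ` {0..k n})) h"
    and z: "\<And>n. z n = h n * tail_quantile F (real n / real (k n)) / a (real n / real (k n))"
    and z_small: "z \<in> o(\<lambda>_. 1)"
  shows "big_o_prob M
           (\<lambda>n \<omega>. \<bar>gamma_moment (k n) (S' n \<omega>) - gamma_moment (k n) (S n \<omega>)\<bar>) z
       \<and> big_o_prob M
           (\<lambda>n \<omega>. \<bar>(order_stat (S' n \<omega>) (n - k n) - order_stat (S n \<omega>) (n - k n))
                    / a (real n / real (k n))\<bar>) z
       \<and> big_o_prob M
           (\<lambda>n \<omega>. \<bar>(sigma_moment (k n) (S' n \<omega>) - sigma_moment (k n) (S n \<omega>))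
                    / a (real n / real (k n))\<bar>) z
       \<and> (\<forall>p d :: nat \<Rightarrow> real.
            (\<forall>n. p n \<in> {0<..<1})
            \<and> (\<lambda>n. real n * p n) \<in> o(\<lambda>n. real (k n))
            \<and> (\<lambda>n. ln (real n * p n)) \<in> o(\<lambda>n. sqrt (real (k n)))
            \<and> big_o_prob M (\<lambda>n \<omega>. sqrt (real (k n)) * (gamma_moment (k n) (S n \<omega>) - \<gamma>)) (\<lambda>_. 1)
            \<and> (\<lambda>n. sqrt (real (k n)) * z n) \<in> O(\<lambda>_. 1)
            \<and> (\<forall>n. d n = real (k n) / (real n * p n))
            \<longrightarrow> big_o_prob M
                  (\<lambda>n \<omega>. \<bar>(quantile_moment (k n) (p n) (S' n \<omega>) - quantile_moment (k n) (p n) (S n \<omega>))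
                           / (a (real n / real (k n)) * q_fun \<gamma> (d n))\<bar>) z)"
proof -
  define \<mu> where "\<mu> = distr N borel Y0"
  have F_eq: "F = cdf \<mu>" by (simp add: F \<mu>_def)
  have distribution: "real_distribution \<mu>"
    unfolding \<mu>_def using assms(1,2) by (rule prob_space.real_distribution_distr)
  have pos: "AE y in \<mu>. y > 0"
    unfolding \<mu>_def using assms(2,3) by (simp add: AE_distr_iff)
  interpret I: intermediate_sample "tail_quantile F" a \<gamma> \<mu> M Y k
  proof (intro intermediate_sample.intro extended_regular_variation.intro intermediate_sample_axioms.intro)
    show "tail_quantile F t > 0" if "t > 1" for t
      unfolding F_eq using distribution pos that by (rule tail_quantile_pos)
    show "tail_quantile F s \<le> tail_quantile F t" if "1 < s" "s \<le> t" for s t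
      unfolding F_eq using distribution that by (rule tail_quantile_mono)
    show "a t > 0" if "t > 1" for t
      using a that by (simp add: scaling_function_def)
    show "((\<lambda>t. (tail_quantile F (t * x) - tail_quantile F t) / a t) \<longlongrightarrow> box_cox \<gamma> x) at_top"
      if "x > 0" for x
      using a that by (simp add: scaling_function_def)
    show "distr (M n) borel (Y n i) = \<mu>" if "i \<in> {1..n}" for n i
      using copies[OF that] by (simp add: \<mu>_def)
  qed (use distribution pos F_eq M indep k k_inf k_small in simp_all)
  have t: "I.t n = real n / real (k n)" for n by (rule I.t_def)
  interpret J: approximated_sample "tail_quantile F" a \<gamma> \<mu> M Y k Y' h z
    using approx close[unfolded S S'] z z_small by unfold_locales (simp_all add: t)
  show ?thesis
    using J.gamma_moment_error J.threshold_error J.sigma_moment_error J.quantile_moment_error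
    unfolding S S' t by simp
qed

end
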